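(* Let $d\in\mathbb{N}$, $a>0$, $b\in\mathbb{R}$. There exist constants $c(a,d)$, $c'(a,d)$ and $C'(a,b,d)$ such that for every $v\in\mathbb{N}$ there is $M$ with $|\Gamma(M)|\le v^{c(a,d)}$ such that, with $\Phi_N:=\{e^{i(\mathbf{k},\mathbf{x})}\}_{\mathbf{k}\in\Gamma(M)}$, $$\varrho^{ls}_{m,v}(\mathbf{W}^{a,b}_A,\Phi_N,L_2(\mathbb{T}^d))\le C'(a,b,d)\,v^{-a-1/2}(\log v)^{(d-1)(a+b)}$$ for any $m\ge c'(a,d)\,v(\log(2v))^4$.
   Context: $\mathbb{T}^d=[0,2\pi)^d$ with normalized Lebesgue measure, $\|f\|_p=((2\pi)^{-d}\int_{\mathbb{T}^d}|f|^p)^{1/p}$, $\hat f(\mathbf{k})=(2\pi)^{-d}\int f(\mathbf{x})e^{-i(\mathbf{k},\mathbf{x})}d\mathbf{x}$. $\Gamma(M)=\{\mathbf{k}\in\mathbb{Z}^d:\prod_j\max(|k_j|,1)\le M\}$. For $\mathbf{s}\in\mathbb{N}_0^d$, $\rho(\mathbf{s})=\{\mathbf{k}\in\mathbb{Z}^d:[2^{s_j-1}]\le|k_j|<2^{s_j}\}$, $\delta_{\mathbf{s}}(f)=\sum_{\mathbf{k}\in\rho(\mathbf{s})}\hat f(\mathbf{k})e^{i(\mathbf{k},\cdot)}$, $f_j=\sum_{\|\mathbf{s}\|_1=j}\delta_{\mathbf{s}}(f)$, $\|g\|_A=\sum_{\mathbf{k}}|\hat g(\mathbf{k})|$. $\mathbf{W}^{a,b}_A:=\{f\in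 L_1(\mathbb{T}^d):\|f_j\|_A\le2^{-aj}\bar j^{(d-1)b},\ \bar j=\max(j,1),\ j\in\mathbb{N}_0\}$. $\mathcal{X}_v(\Phi_N)$ is the collection of spans of $v$-element subsets of $\Phi_N$; $LS(\xi,L)(f)$ is an element $u\in L$ minimizing $\frac1m\sum_j|f(\xi^j)-u(\xi^j)|^2$; $\varrho^{ls}_{m,v}(\mathbf{F},\Phi_N,L_2(\mathbb{T}^d)):=\inf_{\xi\in(\mathbb{T}^d)^m}\sup_{f\in\mathbf{F}}\min_{L\in\mathcal{X}_v(\Phi_N)}\|f-LS(\xi,L)(f)\|_2$.
   Formalization: The bound is stated for v ≥ 2 only: for v = 1, |Γ(M)| ≤ 1 forces Γ(M) to be empty (|Γ(1)| = 3^d), so no v-element subset exists, and log v = 0. Functions in W^{a,b}_A are taken as their continuous periodic representatives. *)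

theory Defs
  imports "HOL-Analysis.Analysis"
begin

definition Td :: "(real^'d) set" where
  "Td = {x. \<forall>i. 0 \<le> x$i \<and> x$i < 2*pi}"

definition ipk :: "int^'d \<Rightarrow> real^'d \<Rightarrow> real" where
  "ipk k x = (\<Sum>i\<in>UNIV. of_int (k$i) * x$i)"

definition cexpk :: "int^'d \<Rightarrow> real^'d \<Rightarrow> complex" where
  "cexpk k = (\<lambda>x. exp (\<i> * complex_of_real (ipk k x)))"

definition fourier :: "(real^'d \<Rightarrow> complex) \<Rightarrow> int^'d \<Rightarrow> complex" where
  "fourier f k = complex_of_real (1 / (2*pi) ^ CARD('d)) *
     (LINT x:Td|lborel. f x * exp (- (\<i> * complex_of_real (ipk k x))))"

definition L2norm :: "(real^'d \<Rightarrow> complex) \<Rightarrow> real" where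
  "L2norm f = sqrt ((1 / (2*pi) ^ CARD('d)) * (LINT x:Td|lborel. (cmod (f x))^2))"

definition Gamma_hc :: "real \<Rightarrow> (int^'d) set" where
  "Gamma_hc M = {k. (\<Prod>i\<in>UNIV. max \<bar>real_of_int (k$i)\<bar> 1) \<le> M}"

definition rho_blk :: "nat^'d \<Rightarrow> (int^'d) set" where
  "rho_blk s = {k. \<forall>j. \<lfloor>2 powr (real (s$j) - 1)\<rfloor> \<le> \<bar>k$j\<bar> \<and> \<bar>k$j\<bar> < 2 ^ (s$j)}"

text \<open>A-norm of f_j = sum over s with |s|_1 = j of delta_s(f): the Fourier
  coefficients of f_j are those of f on the union of the (disjoint) blocks rho(s).\<close>
definition blockA :: "(real^'d \<Rightarrow> complex) \<Rightarrow> nat \<Rightarrow> real" where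
  "blockA f j = (\<Sum>k\<in>(\<Union>s\<in>{s::nat^'d. (\<Sum>i\<in>UNIV. s$i) = j}. rho_blk s). cmod (fourier f k))"

text \<open>The class W^{a,b}_A; elements are taken as their continuous representatives
  (continuous, 2pi-periodic in each variable), so that point evaluation makes sense.\<close>
definition WA :: "real \<Rightarrow> real \<Rightarrow> (real^'d \<Rightarrow> complex) set" where
  "WA a b = {f. set_integrable lborel Td f \<and> continuous_on UNIV f \<and>
       (\<forall>x i. f (x + (2*pi) *\<^sub>R axis i 1) = f x) \<and>
       (\<forall>j::nat. blockA f j \<le> 2 powr (- a * real j) *
            (real (max j 1)) powr ((real CARD('d) - 1) * b))}"

definition Phi :: "(int^'d) set \<Rightarrow> (real^'d \<Rightarrow> complex) set" where
  "Phi \<Lambda> = cexpk ` \<Lambda>"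

definition spanc :: "(real^'d \<Rightarrow> complex) set \<Rightarrow> (real^'d \<Rightarrow> complex) set" where
  "spanc S = {(\<lambda>x. \<Sum>\<phi>\<in>S. c \<phi> * \<phi> x) | c. True}"

definition Xv :: "nat \<Rightarrow> (real^'d \<Rightarrow> complex) set \<Rightarrow> (real^'d \<Rightarrow> complex) set set" where
  "Xv v P = {spanc S | S. S \<subseteq> P \<and> finite S \<and> card S = v}"

definition lserr :: "nat \<Rightarrow> (nat \<Rightarrow> real^'d) \<Rightarrow> (real^'d \<Rightarrow> complex) \<Rightarrow> (real^'d \<Rightarrow> complex) \<Rightarrow> real" where
  "lserr m \<xi> f u = (1 / real m) * (\<Sum>j<m. (cmod (f (\<xi> j) - u (\<xi> j)))^2)"

definition LSset :: "nat \<Rightarrow> (nat \<Rightarrow> real^'d) \<Rightarrow> (real^'d \<Rightarrow> complex) set \<Rightarrow> (real^'d \<Rightarrow> complex) \<Rightarrow> (real^'d \<Rightarrow> complex) set" where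
  "LSset m \<xi> L f = {u \<in> L. \<forall>w\<in>L. lserr m \<xi> f u \<le> lserr m \<xi> f w}"

text \<open>varrho^{ls}_{m,v}(F, Phi, L2); the worst admissible choice of LS is taken.\<close>
definition rho_ls :: "nat \<Rightarrow> nat \<Rightarrow> (real^'d \<Rightarrow> complex) set \<Rightarrow> (real^'d \<Rightarrow> complex) set \<Rightarrow> ereal" where
  "rho_ls m v F P = (INF \<xi> \<in> ({..<m} \<rightarrow> Td). SUP f \<in> F. INF L \<in> Xv v P.
      SUP u \<in> LSset m \<xi> L f. ereal (L2norm (\<lambda>x. f x - u x)))"

end

theory Submission
  imports Defs
begin

text \<open>
  The proof rests on a restricted isometry property with absolute constants: for
  \<open>m \<ge> C v (ln v)\<^sup>3\<close> some points \<open>\<xi>\<close> make the empirical and the true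
  \<open>L\<^sub>2\<close> norm comparable on all \<open>v\<close>-sparse trigonometric polynomials from a cross of
  size polynomial in \<open>v\<close>. Since only comparability up to a constant is needed, no chaining is
  required: for each dyadic level, Maurey's averaging argument replaces a normalised sparse
  polynomial, uniformly on a fine grid, by one of at most \<open>exp (C 2\<^sup>i (ln v)\<^sup>2)\<close> averages of
  exponentials, and a Chernoff bound controls the empirical measure of the
  level set \<open>|y|\<^sup>2 \<ge> 2 powr (- i)\<close> of all these averages up to a factor 2 and an additive
  error of order \<open>2\<^sup>i / (v ln v)\<close>.
  Given \<open>f\<close>, the subspace is spanned by the frequencies in the low dyadic blocks together with those of
  the largest remaining coefficients. Splitting the rest of \<open>f\<close> into pieces of \<open>v\<close>
  frequencies in decreasing order of coefficients bounds both its \<open>L\<^sub>2\<close> norm and its empirical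
  norm by its \<open>A\<close> norm divided by \<open>sqrt v\<close>.
\<close>

text \<open>By Cauchy-Schwarz, a \<open>v\<close>-sparse polynomial scaled to squared L2 norm 1/(2v)
  lies in the convex hull of 0 and the exponentials with phases 1, -1, i, -i. Additive errors well
  below 1/(2v) can therefore be absorbed into constants, and about log v dyadic levels suffice. The
  three logarithms in the sample size are the number of levels, the logarithm of the grid size in
  Maurey's bound, and the logarithm of the number of atoms in the union bound. Beyond the finite
  cross the sampling inequality says nothing, so that part of \<open>f\<close> must be small in the
  sup norm outright. The choice \<kappa> = 1 + 1/(2a) makes 2^(-a J) at most v^(-a-1/2), and so
  forces a cross of size polynomial in \<open>v\<close>. The power of the logarithm in the rate is
  decided at the low end: the low blocks fill half of the \<open>v\<close> places when 2^n n^(d-1)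
  is of order v, and 2^(-a n) n^((d-1) b) then becomes v^(-a) (ln v)^((d-1)(a+b)). The isometry is
  needed for \<open>v\<close> frequencies only, since the least squares minimiser and the element it
  is compared with share one span.\<close>

subsection \<open>Derandomization and sparse sampling\<close>

text \<open>The method of conditional expectations; it stands in for all probability arguments below.\<close>

lemma derandomization:
  fixes p :: "'a \<Rightarrow> real" and h :: "'i \<Rightarrow> 'a \<Rightarrow> real"
  assumes A: "finite A" "\<And>a. a \<in> A \<Longrightarrow> 0 \<le> p a" "sum p A = 1"
    and h: "\<And>i a. i \<in> I \<Longrightarrow> a \<in> A \<Longrightarrow> 0 \<le> h i a"
    and r: "\<And>i. i \<in> I \<Longrightarrow> (\<Sum>a\<in>A. p a * h i a) \<le> r i"
    and W: "\<And>i. i \<in> I \<Longrightarrow> 0 \<le> W i"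
  shows "\<exists>\<xi>::nat \<Rightarrow> 'a. (\<forall>j. \<xi> j \<in> A) \<and>
           (\<Sum>i\<in>I. W i * (\<Prod>j<m. h i (\<xi> j))) \<le> (\<Sum>i\<in>I. W i * r i ^ m)"
  using W
proof (induction m arbitrary: W)
  case 0
  have "A \<noteq> {}" using A(3) by auto
  then obtain a where "a \<in> A" by blast
  then show ?case by (intro exI[of _ "\<lambda>_. a"]) auto
next
  case (Suc m)
  have r0: "0 \<le> r i" if "i \<in> I" for i
    using order_trans[OF sum_nonneg r[OF that]] A(2) h that by simp
  \<comment> \<open>The factor of the last point is first replaced by its bound \<open>r i\<close>,
    moved into the weights. With the first \<open>m\<close> points fixed, the last point is then
    found by averaging.\<close>
  obtain \<xi> :: "nat \<Rightarrow> 'a" where \<xi>: "\<forall>j. \<xi> j \<in> A"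
    "(\<Sum>i\<in>I. W i * r i * (\<Prod>j<m. h i (\<xi> j))) \<le> (\<Sum>i\<in>I. W i * r i * r i ^ m)"
    using Suc.IH[of "\<lambda>i. W i * r i"] Suc.prems r0 by auto
  define V where "V i = W i * (\<Prod>j<m. h i (\<xi> j))" for i
  have V0: "0 \<le> V i" if "i \<in> I" for i
    unfolding V_def using Suc.prems[OF that] h[OF that] \<xi>(1) by (intro mult_nonneg_nonneg prod_nonneg) auto
  have "\<exists>x\<in>A. (\<Sum>i\<in>I. V i * h i x) \<le> (\<Sum>i\<in>I. V i * r i)"
  proof (rule ccontr)
    assume "\<not> ?thesis"
    then have gt: "(\<Sum>i\<in>I. V i * r i) < (\<Sum>i\<in>I. V i * h i x)" if "x \<in> A" for x
      using that by force
    have "\<exists>x\<in>A. 0 < p x"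
      using A by (metis less_eq_real_def sum.neutral zero_neq_one)
    then have "(\<Sum>x\<in>A. p x * (\<Sum>i\<in>I. V i * r i)) < (\<Sum>x\<in>A. p x * (\<Sum>i\<in>I. V i * h i x))"
      using gt A by (intro sum_strict_mono_ex1) (auto intro: mult_left_mono mult_strict_left_mono less_imp_le)
    also have "\<dots> = (\<Sum>i\<in>I. V i * (\<Sum>x\<in>A. p x * h i x))"
      by (simp add: sum_distrib_left sum.swap[of _ A] mult_ac)
    also have "\<dots> \<le> (\<Sum>i\<in>I. V i * r i)"
      using r V0 by (intro sum_mono mult_left_mono) auto
    finally show False using A(3) by (simp flip: sum_distrib_right)
  qed
  then obtain x where x: "x \<in> A" "(\<Sum>i\<in>I. V i * h i x) \<le> (\<Sum>i\<in>I. V i * r i)" by blast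
  define \<zeta> where "\<zeta> = \<xi>(m := x)"
  have "(\<Prod>j<m. h i (\<zeta> j)) = (\<Prod>j<m. h i (\<xi> j))" for i
    unfolding \<zeta>_def by (intro prod.cong) auto
  then have "(\<Sum>i\<in>I. W i * (\<Prod>j<Suc m. h i (\<zeta> j))) = (\<Sum>i\<in>I. V i * h i x)"
    unfolding V_def by (simp add: \<zeta>_def mult_ac)
  also have "\<dots> \<le> (\<Sum>i\<in>I. W i * r i ^ Suc m)"
    using x(2) \<xi>(2) by (simp add: V_def mult_ac)
  finally show ?case using \<xi>(1) x(1) by (intro exI[of _ \<zeta>]) (auto simp: \<zeta>_def)
qed

section \<open>Exponential moment bounds: Chernoff and Maurey\<close>

lemma exp_le_quadratic:
  fixes s :: real assumes "\<bar>s\<bar> \<le> 1" shows "exp s \<le> 1 + s + s^2"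
proof (cases "0 \<le> s")
  case True then show ?thesis using exp_bound[of s] assms by auto
next
  case False
  then have "1 - s \<le> exp (- s)" using exp_ge_add_one_self[of "-s"] by simp
  then have e: "exp s \<le> 1 / (1 - s)" using False
    by (simp add: exp_minus field_simps) 
  have "1 \<le> (1 + s + s^2) * (1 - s)"
  proof -
    have "(1 + s + s^2) * (1 - s) = 1 - s * s^2" by (simp add: algebra_simps power2_eq_square)
    moreover have "s * s^2 \<le> 0" using False by (simp add: mult_nonpos_nonneg)
    ultimately show ?thesis by simp
  qed
  then have "1 / (1 - s) \<le> 1 + s + s^2" using False by (simp add: field_simps)
  then show ?thesis using e by linarith
qed

text \<open>A relative error of 2 makes this cheap: exponential moments at the fixed parameters 1
  and -1 suffice, and the failure bound exp(-m e/2) does not involve the measure \<mu> of the set.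
  From exp 1 <= 3 and exp (-1) <= 1/2 the moments of the indicator are at most 1 + 2 \<mu> <= exp(2
  \<mu>) and 1 - \<mu>/2 <= exp(-\<mu>/2).\<close>

lemma empirical_measure_two_sided:
  fixes B :: "'i \<Rightarrow> 'a set" and e :: "'i \<Rightarrow> real"
  assumes X: "finite X" "X \<noteq> {}" and I: "finite I" and m: "0 < m"
    and e: "\<And>i. i \<in> I \<Longrightarrow> 0 \<le> e i"
    and small: "(\<Sum>i\<in>I. exp (- (real m * e i / 2))) < 1/2"
  shows "\<exists>\<xi>::nat \<Rightarrow> 'a. (\<forall>j. \<xi> j \<in> X) \<and> (\<forall>i\<in>I.
      (\<Sum>j<m. indicat_real (B i) (\<xi> j)) / real m \<le> 2 * ((\<Sum>x\<in>X. indicat_real (B i) x) / real (card X)) + e i \<and>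
      (\<Sum>x\<in>X. indicat_real (B i) x) / real (card X) \<le> 2 * ((\<Sum>j<m. indicat_real (B i) (\<xi> j)) / real m) + e i)"
proof -
  define \<mu> where "\<mu> i = (\<Sum>x\<in>X. indicat_real (B i) x) / real (card X)" for i
  define h where "h = (\<lambda>(s::bool,i) x. exp (if s then indicat_real (B i) x else - indicat_real (B i) x))"
  define r where "r = (\<lambda>(s::bool,i). exp (if s then 2 * \<mu> i else - \<mu> i / 2))"
  \<comment> \<open>Each weight is calibrated so that a violated inequality would make its weighted
    product at least 1. The total is at most twice the sum in \<open>small\<close>, hence below 1,
    and so is every single term.\<close>
  define W where "W = (\<lambda>(s::bool,i). exp (if s then - (real m * (2 * \<mu> i + e i)) else real m * (\<mu> i - e i) / 2))"
  have cX: "0 < real (card X)" using X by (simp add: card_gt_0_iff)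
  have avg: "(\<Sum>x\<in>X. (1 / real (card X)) * (1 + c * indicat_real (B i) x)) = 1 + c * \<mu> i" for c i
    using cX by (simp add: \<mu>_def sum.distrib distrib_left mult_ac flip: sum_distrib_left sum_divide_distrib)
  have E1: "exp (1::real) \<le> 1 + 2" using exp_le by simp
  have E2: "exp (-1::real) \<le> 1 - 1/2"
    using exp_ge_add_one_self[of "1::real"] by (simp add: exp_minus field_simps)
  have rr: "(\<Sum>x\<in>X. (1 / real (card X)) * h si x) \<le> r si" for si
  proof (cases si)
    case (Pair s i)
    define c :: real where "c = (if s then 2 else -1/2)"
    have "(\<Sum>x\<in>X. (1 / real (card X)) * h si x) \<le> (\<Sum>x\<in>X. (1 / real (card X)) * (1 + c * indicat_real (B i) x))"
      using E1 E2 cX by (intro sum_mono mult_left_mono) (auto simp: h_def Pair c_def indicator_def)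
    also have "\<dots> = 1 + c * \<mu> i" by (rule avg)
    also have "\<dots> \<le> exp (c * \<mu> i)" by (rule exp_ge_add_one_self)
    also have "\<dots> = r si" by (simp add: r_def Pair c_def)
    finally show ?thesis .
  qed
  obtain \<xi> :: "nat \<Rightarrow> 'a" where \<xi>: "\<forall>j. \<xi> j \<in> X"
    "(\<Sum>i\<in>UNIV\<times>I. W i * (\<Prod>j<m. h i (\<xi> j))) \<le> (\<Sum>i\<in>UNIV\<times>I. W i * r i ^ m)"
    using derandomization[where A = X and p = "\<lambda>_. 1 / real (card X)" and I = "UNIV \<times> I" and h = h and r = r
        and W = W and m = m] X cX rr by (auto simp: h_def W_def)
  have Wr: "W si * r si ^ m \<le> exp (- (real m * e (snd si) / 2))" if "snd si \<in> I" for si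
    using e[OF that] by (cases si) (auto simp: W_def r_def exp_of_nat_mult[symmetric] exp_add[symmetric] algebra_simps diff_divide_distrib)
  have "(\<Sum>i\<in>UNIV\<times>I. W i * (\<Prod>j<m. h i (\<xi> j))) \<le> (\<Sum>si\<in>(UNIV::bool set)\<times>I. exp (- (real m * e (snd si) / 2)))"
    by (rule order_trans[OF \<xi>(2)]) (intro sum_mono Wr, auto)
  also have "\<dots> = (\<Sum>s\<in>(UNIV::bool set). \<Sum>i\<in>I. exp (- (real m * e i / 2)))"
    by (subst sum.cartesian_product) (simp add: split_def)
  also have "\<dots> < 1" using small by (simp add: UNIV_bool)
  finally have lt: "(\<Sum>i\<in>UNIV\<times>I. W i * (\<Prod>j<m. h i (\<xi> j))) < 1" .
  have each: "W (s,i) * (\<Prod>j<m. h (s,i) (\<xi> j)) < 1" if "i \<in> I" for s i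
  proof -
    have "W (s,i) * (\<Prod>j<m. h (s,i) (\<xi> j)) \<le> (\<Sum>i\<in>UNIV\<times>I. W i * (\<Prod>j<m. h i (\<xi> j)))"
      by (rule member_le_sum) (use that I in \<open>auto simp: W_def h_def intro!: mult_nonneg_nonneg prod_nonneg\<close>)
    then show ?thesis using lt by linarith
  qed
  have "(\<Sum>j<m. indicat_real (B i) (\<xi> j)) / real m \<le> 2 * \<mu> i + e i \<and>
      \<mu> i \<le> 2 * ((\<Sum>j<m. indicat_real (B i) (\<xi> j)) / real m) + e i" if i: "i \<in> I" for i
  proof
    have "W (True,i) * (\<Prod>j<m. h (True,i) (\<xi> j))
        = exp (- (real m * (2 * \<mu> i + e i)) + (\<Sum>j<m. indicat_real (B i) (\<xi> j)))"
      by (simp add: W_def h_def exp_sum[symmetric] exp_add[symmetric])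
    then have "exp (- (real m * (2 * \<mu> i + e i)) + (\<Sum>j<m. indicat_real (B i) (\<xi> j))) < 1"
      using each[OF i, of True] by metis
    then show "(\<Sum>j<m. indicat_real (B i) (\<xi> j)) / real m \<le> 2 * \<mu> i + e i"
      using m by (simp add: field_simps)
    have "W (False,i) * (\<Prod>j<m. h (False,i) (\<xi> j))
        = exp (real m * (\<mu> i - e i) / 2 - (\<Sum>j<m. indicat_real (B i) (\<xi> j)))"
      by (simp add: W_def h_def exp_sum[symmetric] exp_add[symmetric] sum_negf)
    then have "exp (real m * (\<mu> i - e i) / 2 - (\<Sum>j<m. indicat_real (B i) (\<xi> j))) < 1"
      using each[OF i, of False] by metis
    then show "\<mu> i \<le> 2 * ((\<Sum>j<m. indicat_real (B i) (\<xi> j)) / real m) + e i"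
      using m by (simp add: field_simps)
  qed
  then show ?thesis using \<xi>(1) unfolding \<mu>_def by blast
qed

text \<open>Maurey's argument: the average of \<open>L\<close> atoms drawn with probabilities
  \<open>p\<close> is close to the mean, here at all points of \<open>X\<close> at once, which costs
  the logarithm of the cardinality of \<open>X\<close>. The approximants are indexed by maps from
  \<open>{..<L}\<close> to \<open>A\<close>, a finite set independent of \<open>p\<close>, to which
  a union bound applies.\<close>

lemma maurey_sup_norm:
  fixes p :: "'a \<Rightarrow> real" and z :: "'a \<Rightarrow> 'x \<Rightarrow> complex"
  assumes A: "finite A" "\<And>a. a \<in> A \<Longrightarrow> 0 \<le> p a" "sum p A = 1"
    and X: "finite X" "X \<noteq> {}" and z: "\<And>a x. a \<in> A \<Longrightarrow> x \<in> X \<Longrightarrow> cmod (z a x) \<le> 1"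
    and \<epsilon>: "0 < \<epsilon>" "\<epsilon> \<le> 1" and L: "64 * ln (4 * real (card X)) / \<epsilon>^2 \<le> real L"
  shows "\<exists>\<zeta>\<in>PiE {..<L} (\<lambda>_. A). \<forall>x\<in>X.
           cmod ((\<Sum>a\<in>A. of_real (p a) * z a x) - (\<Sum>l<L. z (\<zeta> l) x) / of_nat L) \<le> \<epsilon>"
proof -
  define y where "y x = (\<Sum>a\<in>A. of_real (p a) * z a x)" for x
  \<comment> \<open>Real parts in four directions control both coordinates of a complex number:
    \<epsilon>/2 in each gives modulus at most \<epsilon>. They are the factor 4 inside the
    logarithm.\<close>
  define D where "D = {1, -1, \<i>, -\<i>}"
  \<comment> \<open>This value balances the exponent: with \<open>L\<close> as assumed, ln(4 card
    X)/\<theta> and 4 \<theta> L are each at most L \<epsilon>/4.\<close>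
  define \<theta> where "\<theta> = \<epsilon> / 16"
  define R where "R = (\<lambda>(x,\<sigma>) a. Re (\<sigma> * (z a x - y x)))"
  have card1: "1 \<le> real (card X)" using X by (simp add: Suc_leI card_gt_0_iff)
  have lnpos: "0 < ln (4 * real (card X))" using card1 by simp
  have "0 < 64 * ln (4 * real (card X)) / \<epsilon>^2" using lnpos \<epsilon> by simp
  then have Lpos: "0 < real L" using L by linarith
  have D: "finite D" "card D \<le> 4" "\<And>\<sigma>. \<sigma> \<in> D \<Longrightarrow> cmod \<sigma> = 1"
    by (auto simp: D_def card_insert_if)
  have y1: "cmod (y x) \<le> 1" if "x \<in> X" for x
  proof -
    have "cmod (y x) \<le> (\<Sum>a\<in>A. p a * 1)"
      unfolding y_def using A z that
      by (intro order_trans[OF norm_sum] sum_mono) (auto simp: norm_mult intro!: mult_left_le)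
    then show ?thesis using A by simp
  qed
  have R2: "\<bar>R i a\<bar> \<le> 2" if iXD: "i \<in> X \<times> D" and a: "a \<in> A" for i a
  proof -
    obtain x \<sigma> where i: "i = (x,\<sigma>)" "x \<in> X" "\<sigma> \<in> D" using iXD by (cases i) auto
    have "\<bar>R i a\<bar> \<le> cmod (\<sigma> * (z a x - y x))" unfolding R_def i by (simp only: prod.case abs_Re_le_cmod)
    also have "\<dots> \<le> cmod (z a x) + cmod (y x)" using D(3)[OF i(3)] by (simp add: norm_mult norm_triangle_ineq4)
    also have "\<dots> \<le> 2" using z[OF a i(2)] y1[OF i(2)] by simp
    finally show ?thesis .
  qed
  have mean: "(\<Sum>a\<in>A. p a * R i a) = 0" for i
  proof -
    obtain x \<sigma> where i: "i = (x,\<sigma>)" by fastforce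
    have "(\<Sum>a\<in>A. p a * R i a) = Re (\<Sum>a\<in>A. of_real (p a) * (\<sigma> * (z a x - y x)))"
      unfolding R_def i by (simp add: Re_sum)
    also have "(\<Sum>a\<in>A. of_real (p a) * (\<sigma> * (z a x - y x))) =
        \<sigma> * ((\<Sum>a\<in>A. of_real (p a) * z a x) - of_real (sum p A) * y x)"
      by (simp add: right_diff_distrib sum_subtractf sum_distrib_left sum_distrib_right mult_ac)
    also have "\<dots> = \<sigma> * (y x - of_real (sum p A) * y x)" by (simp add: y_def)
    finally show ?thesis using A(3) by simp
  qed
  have r: "(\<Sum>a\<in>A. p a * exp (\<theta> * R i a)) \<le> exp (4 * \<theta>^2)" if "i \<in> X \<times> D" for i
  proof -
    have "(\<Sum>a\<in>A. p a * exp (\<theta> * R i a)) \<le> (\<Sum>a\<in>A. p a * (1 + \<theta> * R i a + 4 * \<theta>^2))"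
    proof (intro sum_mono mult_left_mono A)
      fix a assume a: "a \<in> A"
      have b: "\<bar>\<theta> * R i a\<bar> \<le> 2 * \<theta>" using R2[OF that a] \<epsilon> by (simp add: abs_mult \<theta>_def field_simps)
      then have "exp (\<theta> * R i a) \<le> 1 + \<theta> * R i a + (\<theta> * R i a)^2"
        using \<epsilon> by (intro exp_le_quadratic) (simp add: \<theta>_def)
      also have "(\<theta> * R i a)^2 \<le> (2 * \<theta>)^2" using b by (metis abs_ge_zero power2_abs power_mono)
      finally show "exp (\<theta> * R i a) \<le> 1 + \<theta> * R i a + 4 * \<theta>^2" by (simp add: power_mult_distrib)
    qed
    also have "\<dots> = (1 + 4 * \<theta>^2) * sum p A + \<theta> * (\<Sum>a\<in>A. p a * R i a)"
      by (simp add: algebra_simps sum.distrib sum_distrib_left sum_distrib_right)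
    also have "\<dots> \<le> exp (4 * \<theta>^2)" using mean A(3) exp_ge_add_one_self[of "4 * \<theta>^2"] by simp
    finally show ?thesis .
  qed
  obtain \<zeta> :: "nat \<Rightarrow> 'a" where \<zeta>: "\<forall>j. \<zeta> j \<in> A"
    "(\<Sum>i\<in>X\<times>D. 1 * (\<Prod>l<L. exp (\<theta> * R i (\<zeta> l)))) \<le> (\<Sum>i\<in>X\<times>D. 1 * exp (4 * \<theta>^2) ^ L)"
    using derandomization[where A = A and p = p and I = "X \<times> D" and h = "\<lambda>i a. exp (\<theta> * R i a)"
        and r = "\<lambda>_. exp (4 * \<theta>^2)" and W = "\<lambda>_. 1" and m = L] A r by auto
  have dir: "(\<Sum>l<L. R (x,\<sigma>) (\<zeta> l)) \<le> real L * (\<epsilon> / 2)" if x: "x \<in> X" and \<sigma>: "\<sigma> \<in> D" for x \<sigma>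
  proof -
    have "exp (\<theta> * (\<Sum>l<L. R (x,\<sigma>) (\<zeta> l))) = (\<Prod>l<L. exp (\<theta> * R (x,\<sigma>) (\<zeta> l)))"
      by (simp add: exp_sum sum_distrib_left)
    also have "\<dots> \<le> (\<Sum>i\<in>X\<times>D. \<Prod>l<L. exp (\<theta> * R i (\<zeta> l)))"
      by (rule member_le_sum[of "(x,\<sigma>)" _ "\<lambda>i. \<Prod>l<L. exp (\<theta> * R i (\<zeta> l))"])
         (use x \<sigma> X D in \<open>auto intro!: prod_nonneg\<close>)
    also have "\<dots> \<le> real (card (X\<times>D)) * exp (4 * \<theta>^2) ^ L" using \<zeta>(2) by simp
    also have "\<dots> \<le> (4 * real (card X)) * exp (real L * (4 * \<theta>^2))"
    proof -
      have "real (card X) * real (card D) \<le> real (card X) * 4" using D(2) by (intro mult_left_mono) auto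
      then have "real (card (X\<times>D)) \<le> 4 * real (card X)" by (simp add: card_cartesian_product mult.commute)
      then show ?thesis by (subst exp_of_nat_mult) (intro mult_right_mono, auto)
    qed
    also have "\<dots> = exp (ln (4 * real (card X)) + real L * (4 * \<theta>^2))"
      using card1 by (simp add: exp_add)
    finally have 1: "\<theta> * (\<Sum>l<L. R (x,\<sigma>) (\<zeta> l)) \<le> ln (4 * real (card X)) + real L * (4 * \<theta>^2)" by simp
    have "ln (4 * real (card X)) \<le> real L * \<epsilon>^2 / 64" using L \<epsilon> by (simp add: field_simps)
    then have "\<theta> * (\<Sum>l<L. R (x,\<sigma>) (\<zeta> l)) \<le> \<theta> * (real L * (\<epsilon> / 2))"
      using 1 by (simp add: \<theta>_def power2_eq_square field_simps)
    then show ?thesis using \<epsilon> by (simp add: \<theta>_def)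
  qed
  have "cmod (y x - (\<Sum>l<L. z (restrict \<zeta> {..<L} l) x) / of_nat L) \<le> \<epsilon>" if x: "x \<in> X" for x
  proof -
    define w where "w = y x - (\<Sum>l<L. z (\<zeta> l) x) / of_nat L"
    have Rw: "(\<Sum>l<L. R (x,\<sigma>) (\<zeta> l)) = real L * Re (- \<sigma> * w)" for \<sigma>
    proof -
      have "(\<Sum>l<L. R (x,\<sigma>) (\<zeta> l)) = Re (\<Sum>l<L. \<sigma> * (z (\<zeta> l) x - y x))"
        by (simp only: R_def prod.case Re_sum)
      also have "(\<Sum>l<L. \<sigma> * (z (\<zeta> l) x - y x)) = \<sigma> * ((\<Sum>l<L. z (\<zeta> l) x) - of_nat L * y x)"
        by (simp add: sum_subtractf flip: sum_distrib_left)
      also have "\<sigma> * ((\<Sum>l<L. z (\<zeta> l) x) - of_nat L * y x) = of_real (real L) * (- \<sigma> * w)"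
        unfolding w_def using Lpos by (simp add: field_simps)
      finally show ?thesis by (simp add: algebra_simps)
    qed
    have "Re (- \<sigma> * w) \<le> \<epsilon> / 2" if "\<sigma> \<in> D" for \<sigma>
      using dir[OF x that] Lpos unfolding Rw by simp
    from this[of 1] this[of "-1"] this[of \<i>] this[of "-\<i>"]
    have "\<bar>Re w\<bar> \<le> \<epsilon> / 2" "\<bar>Im w\<bar> \<le> \<epsilon> / 2" by (auto simp: D_def)
    then have "cmod w \<le> \<epsilon>" using cmod_le[of w] by linarith
    moreover have "(\<Sum>l<L. z (restrict \<zeta> {..<L} l) x) = (\<Sum>l<L. z (\<zeta> l) x)" by (intro sum.cong) auto
    ultimately show ?thesis by (simp add: w_def)
  qed
  then show ?thesis unfolding y_def using \<zeta>(1) by (intro bexI[of _ "restrict \<zeta> {..<L}"]) auto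
qed

text \<open>The first level \<open>i\<close> reached by \<open>s\<close> satisfies s <= 2/2^i, so
  its single term pays for \<open>s\<close>; below the last level the additive 1/2^t does. The
  events \<open>b i\<close> need only be implied by reaching the level, so they may come from an
  approximation of the function.\<close>

lemma dyadic_level_sets_upper:
  fixes s :: real
  assumes "0 \<le> s" "s \<le> 1" and b: "\<And>i. i \<le> t \<Longrightarrow> 1 / 2^i \<le> s \<Longrightarrow> b i"
  shows "s \<le> 1 / 2^t + 2 * (\<Sum>i\<le>t. of_bool (b i) / 2^i)"
proof (cases "s < 1 / 2^t")
  case True
  have "0 \<le> (\<Sum>i\<le>t. of_bool (b i) / 2^i :: real)" by (intro sum_nonneg) auto
  then show ?thesis using True by linarith
next
  case False
  define i where "i = (LEAST i. 1 / 2^i \<le> s)"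
  have i: "1 / 2^i \<le> s" "i \<le> t"
    unfolding i_def using False LeastI[of "\<lambda>i. 1 / 2^i \<le> s" t] Least_le[of "\<lambda>i. 1 / 2^i \<le> s" t]
    by auto
  have "s \<le> 2 * (1 / 2^i)"
  proof (cases i)
    case 0 then show ?thesis using assms by simp
  next
    case (Suc k)
    then have "\<not> 1 / 2^k \<le> s" unfolding i_def by (metis not_less_Least lessI)
    then show ?thesis using Suc by simp
  qed
  also have "1 / 2^i = (of_bool (b i) / 2^i :: real)" using b i by simp
  also have "\<dots> \<le> (\<Sum>i\<le>t. of_bool (b i) / 2^i)"
    by (rule member_le_sum) (use i in auto)
  finally show ?thesis by (simp add: add_increasing)
qed

text \<open>The first event \<open>k\<close> that occurs dominates: all terms from there on sum to
  at most 2/2^k, hence to at most 8 s. The 4 leaves room for events that certify only half of the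
  level for the square root of \<open>s\<close>.\<close>

lemma dyadic_level_sets_lower:
  fixes s :: real
  assumes s: "0 \<le> s" and b: "\<And>i. i \<le> t \<Longrightarrow> b i \<Longrightarrow> 1 / 2^i \<le> 4 * s"
  shows "(\<Sum>i\<le>t. of_bool (b i) / 2^i) \<le> 8 * s"
proof (cases "\<exists>i\<le>t. b i")
  case False
  then show ?thesis using s by simp
next
  case True
  define k where "k = (LEAST i. i \<le> t \<and> b i)"
  have k: "k \<le> t" "b k" unfolding k_def using LeastI_ex[of "\<lambda>i. i \<le> t \<and> b i"] True by auto
  have "(\<Sum>i\<le>t. of_bool (b i) / 2^i :: real) \<le> (\<Sum>i\<in>{k..t}. 1 / 2^i)"
  proof -
    have "(\<Sum>i\<le>t. of_bool (b i) / 2^i :: real) = (\<Sum>i\<in>{k..t}. of_bool (b i) / 2^i)"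
      by (rule sum.mono_neutral_right) (auto simp: k_def intro: Least_le)
    also have "\<dots> \<le> (\<Sum>i\<in>{k..t}. 1 / 2^i)" by (intro sum_mono) auto
    finally show ?thesis .
  qed
  also have "(\<Sum>i\<in>{k..t}. 1 / 2^i :: real) \<le> 2 * (1 / 2^k)"
  proof -
    have "(\<Sum>i\<in>{k..<k + n}. 1 / 2^i :: real) = 2 * (1 / 2^k) - 2 / 2^(k+n)" for n
      by (induction n) simp_all
    from this[of "Suc t - k"] show ?thesis using k by (simp add: atLeastLessThanSuc_atLeastAtMost)
  qed
  also have "\<dots> \<le> 8 * s" using b[OF k] by simp
  finally show ?thesis .
qed

text \<open>The points are chosen before the convex combination. This is possible because
  \<open>y\<close> enters only through one Maurey average per level, and these range over finite
  sets fixed in advance. The 32 is 2 (dyadic upper bound) times 2 (empirical measure) times 8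
  (dyadic lower bound).\<close>

lemma sampling_convex_hull:
  fixes z :: "'a \<Rightarrow> 'x \<Rightarrow> complex"
  assumes A: "finite A" "A \<noteq> {}" and X: "finite X" "X \<noteq> {}"
    and z: "\<And>a x. a \<in> A \<Longrightarrow> x \<in> X \<Longrightarrow> cmod (z a x) \<le> 1"
    and K: "1024 * ln (4 * real (card X)) \<le> real K" and m: "0 < m" and \<eta>: "0 < \<eta>"
    and large: "real K * ln (real (card A)) + ln (4 * real (t + 1)) \<le> real m * \<eta> / (2 * real (t + 1))"
  shows "\<exists>\<xi>::nat \<Rightarrow> 'x. (\<forall>j. \<xi> j \<in> X) \<and> (\<forall>p y. (\<forall>a\<in>A. 0 \<le> p a) \<and> sum p A = 1 \<and>
       (\<forall>x\<in>X. y x = (\<Sum>a\<in>A. of_real (p a) * z a x)) \<longrightarrow>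
       (\<Sum>j<m. (cmod (y (\<xi> j)))^2) / real m
          \<le> 1 / 2^t + 2 * \<eta> + 32 * ((\<Sum>x\<in>X. (cmod (y x))^2) / real (card X)) \<and>
       (\<Sum>x\<in>X. (cmod (y x))^2) / real (card X)
          \<le> 1 / 2^t + 2 * \<eta> + 32 * ((\<Sum>j<m. (cmod (y (\<xi> j)))^2) / real m))"
proof -
  define G where "G i = PiE {..<K * 2^i} (\<lambda>_. A)" for i :: nat
  define g where "g i \<zeta> x = (\<Sum>l<K * 2^i. z (\<zeta> l) x) / of_nat (K * 2^i)" for i and \<zeta> :: "nat \<Rightarrow> 'a" and x
  \<comment> \<open>The approximation error is a quarter of the level 2^(-i/2). So |y| above the
    level forces membership, and membership forces |y| to be at least half the level.\<close>
  define B where "B = (\<lambda>(i,\<zeta>). {x. 3 / (4 * sqrt (2^i)) \<le> cmod (g i \<zeta> x)})"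
  define I where "I = Sigma {..t} G"
  \<comment> \<open>Level \<open>i\<close> has card A ^ (K 2^i) averages, so the union bound needs
    an error growing like 2^i. As the level carries weight 1/2^i, each of the \<open>t + 1\<close>
    levels contributes just \<eta>/(t+1).\<close>
  define e where "e = (\<lambda>(i::nat, \<zeta>::nat \<Rightarrow> 'a). 2^i * \<eta> / real (t + 1))"
  define H where "H = real m * \<eta> / (2 * real (t + 1))"
  have finG: "finite (G i)" and cardG: "card (G i) = card A ^ (K * 2^i)" for i
    using A by (auto simp: G_def card_PiE intro!: finite_PiE)
  have finI: "finite I" unfolding I_def using finG by auto
  have cA: "1 \<le> real (card A)" using A by (simp add: Suc_leI card_gt_0_iff)
  have cX: "0 < real (card X)" using X by (simp add: card_gt_0_iff)
  have eH: "real m * e (i, \<zeta>) / 2 = 2^i * H" for i \<zeta>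
    by (simp add: e_def H_def mult_ac del: of_nat_add of_nat_Suc)
  have "(\<Sum>i\<in>I. exp (- (real m * e i / 2))) = (\<Sum>i\<le>t. \<Sum>\<zeta>\<in>G i. exp (- (2^i * H)))"
    unfolding I_def using finG by (subst sum.Sigma) (auto simp: eH intro!: sum.cong)
  also have "\<dots> \<le> (\<Sum>i\<le>t. 1 / (4 * real (t + 1)))"
  proof (rule sum_mono)
    fix i
    have "2^i * (real K * ln (real (card A))) + ln (4 * real (t + 1))
        \<le> 2^i * (real K * ln (real (card A)) + ln (4 * real (t + 1)))"
      using mult_right_mono[of 1 "2^i" "ln (4 * real (t + 1))"] by (simp add: distrib_left)
    also have "\<dots> \<le> 2^i * H" using large by (intro mult_left_mono) (auto simp: H_def)
    finally have *: "real (K * 2^i) * ln (real (card A)) - 2^i * H \<le> - ln (4 * real (t + 1))"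
      by (simp add: mult_ac)
    have "(\<Sum>\<zeta>\<in>G i. exp (- (2^i * H))) = exp (real (K * 2^i) * ln (real (card A)) - 2^i * H)"
      using cA by (simp only: sum_constant cardG diff_conv_add_uminus exp_add exp_of_nat_mult) simp
    also have "\<dots> \<le> exp (- ln (4 * real (t + 1)))" using * by (simp only: exp_le_cancel_iff)
    also have "\<dots> = 1 / (4 * real (t + 1))" by (simp add: exp_minus field_simps)
    finally show "(\<Sum>\<zeta>\<in>G i. exp (- (2^i * H))) \<le> 1 / (4 * real (t + 1))" .
  qed
  also have "\<dots> < 1 / 2" by (simp add: field_simps)
  finally have small: "(\<Sum>i\<in>I. exp (- (real m * e i / 2))) < 1 / 2" .
  have e0: "0 \<le> e i" for i using \<eta> by (cases i) (simp add: e_def)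
  obtain \<xi> :: "nat \<Rightarrow> 'x" where \<xi>: "\<forall>j. \<xi> j \<in> X" and emp: "\<forall>i\<in>I.
      (\<Sum>j<m. indicat_real (B i) (\<xi> j)) / real m \<le> 2 * ((\<Sum>x\<in>X. indicat_real (B i) x) / real (card X)) + e i \<and>
      (\<Sum>x\<in>X. indicat_real (B i) x) / real (card X) \<le> 2 * ((\<Sum>j<m. indicat_real (B i) (\<xi> j)) / real m) + e i"
    using empirical_measure_two_sided[OF X finI m e0 small, of B] by blast
  have main: "(\<Sum>j<m. (cmod (y (\<xi> j)))^2) / real m
          \<le> 1 / 2^t + 2 * \<eta> + 32 * ((\<Sum>x\<in>X. (cmod (y x))^2) / real (card X)) \<and>
       (\<Sum>x\<in>X. (cmod (y x))^2) / real (card X)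
          \<le> 1 / 2^t + 2 * \<eta> + 32 * ((\<Sum>j<m. (cmod (y (\<xi> j)))^2) / real m)"
    if p: "\<forall>a\<in>A. 0 \<le> p a" "sum p A = 1" and y: "\<forall>x\<in>X. y x = (\<Sum>a\<in>A. of_real (p a) * z a x)" for p y
  proof -
    have "\<exists>\<zeta>\<in>G i. \<forall>x\<in>X. cmod (y x - g i \<zeta> x) \<le> 1 / (4 * sqrt (2^i))" for i
    proof -
      have "1 \<le> 4 * sqrt (2^i :: real)"
      proof -
        have "1 \<le> sqrt (2^i :: real)" by simp
        then show ?thesis by linarith
      qed
      then have "1 / (4 * sqrt (2^i)) \<le> (1::real)" by simp
      \<comment> \<open>Here 1024 = 64 * 4^2 comes in: accuracy 1/(4 sqrt(2^i)) costs 1024 * 2^i *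
        ln(4 card X) atoms.\<close>
      moreover have "64 * ln (4 * real (card X)) / (1 / (4 * sqrt (2^i)))^2 \<le> real (K * 2^i)"
        using mult_right_mono[OF K, of "2^i"] by (simp add: power_divide power_mult_distrib)
      ultimately have "\<exists>\<zeta>\<in>PiE {..<K * 2^i} (\<lambda>_. A). \<forall>x\<in>X.
          cmod ((\<Sum>a\<in>A. of_real (p a) * z a x) - (\<Sum>l<K * 2^i. z (\<zeta> l) x) / of_nat (K * 2^i))
            \<le> 1 / (4 * sqrt (2^i))"
        using A(1) X z p by (intro maurey_sup_norm) simp_all
      then show ?thesis using y by (simp add: G_def g_def)
    qed
    then obtain \<zeta> where \<zeta>: "\<And>i. \<zeta> i \<in> G i" "\<And>i x. x \<in> X \<Longrightarrow> cmod (y x - g i (\<zeta> i) x) \<le> 1 / (4 * sqrt (2^i))"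
      by metis
    have y1: "cmod (y x) \<le> 1" if "x \<in> X" for x
    proof -
      have "cmod (y x) \<le> (\<Sum>a\<in>A. p a)"
        unfolding y[rule_format, OF that] using p z that
        by (intro order_trans[OF norm_sum] sum_mono) (auto simp: norm_mult intro!: mult_left_le)
      then show ?thesis using p by simp
    qed
    have q: "1 / (4 * sqrt (2^i)) = 1/4 * (1 / sqrt (2^i))" "3 / (4 * sqrt (2^i)) = 3/4 * (1 / sqrt (2^i))"
      "1 / (2 * sqrt (2^i)) = 1/2 * (1 / sqrt (2^i :: real))" for i by simp_all
    define T where "T i = B (i, \<zeta> i)" for i
    define S where "S x = (\<Sum>i\<le>t. indicat_real (T i) x / 2^i)" for x
    have ind: "indicat_real (T i) x = of_bool (x \<in> T i)" for i x by (simp add: indicator_def)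
    have up: "(cmod (y x))^2 \<le> 1 / 2^t + 2 * S x" if x: "x \<in> X" for x
      unfolding S_def ind
    proof (rule dyadic_level_sets_upper)
      show "(cmod (y x))\<^sup>2 \<le> 1" using y1[OF x] by (simp add: power_le_one)
      fix i assume "1 / 2^i \<le> (cmod (y x))\<^sup>2"
      then have "1 / sqrt (2^i) \<le> cmod (y x)"
        using real_le_lsqrt[of "cmod (y x)" "1 / 2^i"] by (simp add: real_sqrt_divide)
      moreover have "cmod (y x) \<le> cmod (g i (\<zeta> i) x) + 1 / (4 * sqrt (2^i))"
        using \<zeta>(2)[OF x, of i] norm_triangle_sub[of "y x" "g i (\<zeta> i) x"] by linarith
      ultimately have "3 / (4 * sqrt (2^i)) \<le> cmod (g i (\<zeta> i) x)" using q[of i] by linarith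
      then show "x \<in> T i" by (simp add: T_def B_def)
    qed auto
    have low: "S x \<le> 8 * (cmod (y x))^2" if x: "x \<in> X" for x
      unfolding S_def ind
    proof (rule dyadic_level_sets_lower)
      fix i assume "x \<in> T i"
      then have "3 / (4 * sqrt (2^i)) \<le> cmod (g i (\<zeta> i) x)" by (simp add: T_def B_def)
      moreover have "cmod (g i (\<zeta> i) x) \<le> cmod (y x) + 1 / (4 * sqrt (2^i))"
        using \<zeta>(2)[OF x, of i] norm_triangle_sub[of "g i (\<zeta> i) x" "y x"] by (simp add: norm_minus_commute)
      ultimately have "1 / (2 * sqrt (2^i)) \<le> cmod (y x)" using q[of i] by linarith
      then have "(1 / (2 * sqrt (2^i)))^2 \<le> (cmod (y x))^2" by (intro power_mono) auto
      then show "1 / 2^i \<le> 4 * (cmod (y x))\<^sup>2" by (simp add: power_divide power_mult_distrib)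
    qed auto
    define Q where "Q f = (\<Sum>j<m. f (\<xi> j)) / real m" for f :: "'x \<Rightarrow> real"
    define P where "P f = (\<Sum>x\<in>X. f x) / real (card X)" for f :: "'x \<Rightarrow> real"
    have QS: "Q S = (\<Sum>i\<le>t. Q (indicat_real (T i)) / 2^i)"
      unfolding Q_def S_def by (subst sum.swap) (simp add: sum_divide_distrib mult.commute)
    have PS: "P S = (\<Sum>i\<le>t. P (indicat_real (T i)) / 2^i)"
      unfolding P_def S_def by (subst sum.swap) (simp add: sum_divide_distrib mult.commute)
    have Qup: "Q (\<lambda>x. (cmod (y x))^2) \<le> 1 / 2^t + 2 * Q S"
    proof -
      have "Q (\<lambda>x. (cmod (y x))^2) \<le> (\<Sum>j<m. 1 / 2^t + 2 * S (\<xi> j)) / real m"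
        unfolding Q_def using up \<xi> by (intro divide_right_mono sum_mono) auto
      then show ?thesis using m by (simp add: Q_def sum.distrib add_divide_distrib sum_distrib_left)
    qed
    have Pup: "P (\<lambda>x. (cmod (y x))^2) \<le> 1 / 2^t + 2 * P S"
    proof -
      have "P (\<lambda>x. (cmod (y x))^2) \<le> (\<Sum>x\<in>X. 1 / 2^t + 2 * S x) / real (card X)"
        unfolding P_def using up by (intro divide_right_mono sum_mono) auto
      then show ?thesis using cX by (simp add: P_def sum.distrib add_divide_distrib sum_distrib_left)
    qed
    have Qlow: "Q S \<le> 8 * Q (\<lambda>x. (cmod (y x))^2)"
      unfolding Q_def times_divide_eq_right sum_distrib_left using low \<xi> by (intro divide_right_mono sum_mono) auto
    have Plow: "P S \<le> 8 * P (\<lambda>x. (cmod (y x))^2)"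
      unfolding P_def times_divide_eq_right sum_distrib_left using low by (intro divide_right_mono sum_mono) auto
    have I: "(i, \<zeta> i) \<in> I" if "i \<le> t" for i using that \<zeta>(1) by (simp add: I_def)
    have err: "(\<Sum>i\<le>t. (2 * c i + e (i, \<zeta> i)) / 2^i) = 2 * (\<Sum>i\<le>t. c i / 2^i) + \<eta>" for c :: "nat \<Rightarrow> real"
      by (simp add: e_def add_divide_distrib sum.distrib sum_distrib_left del: of_nat_Suc of_nat_add)
    have "Q S \<le> (\<Sum>i\<le>t. (2 * P (indicat_real (T i)) + e (i, \<zeta> i)) / 2^i)"
      unfolding QS using emp I by (intro sum_mono divide_right_mono) (auto simp: Q_def P_def T_def)
    then have QP: "Q S \<le> 2 * P S + \<eta>" unfolding err PS .
    have "P S \<le> (\<Sum>i\<le>t. (2 * Q (indicat_real (T i)) + e (i, \<zeta> i)) / 2^i)"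
      unfolding PS using emp I by (intro sum_mono divide_right_mono) (auto simp: Q_def P_def T_def)
    then have PQ: "P S \<le> 2 * Q S + \<eta>" unfolding err QS .
    show ?thesis
      using Qup Pup Qlow Plow QP PQ by (simp add: Q_def P_def)
  qed
  show ?thesis
  proof (intro exI[of _ \<xi>] conjI \<xi> allI impI)
    fix p y
    assume "(\<forall>a\<in>A. 0 \<le> p a) \<and> sum p A = 1 \<and> (\<forall>x\<in>X. y x = (\<Sum>a\<in>A. complex_of_real (p a) * z a x))"
    then have *: "\<forall>a\<in>A. 0 \<le> p a" "sum p A = 1" "\<forall>x\<in>X. y x = (\<Sum>a\<in>A. complex_of_real (p a) * z a x)"
      by auto
    note main[OF *]
    then show "(\<Sum>j<m. (cmod (y (\<xi> j)))^2) / real m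
          \<le> 1 / 2^t + 2 * \<eta> + 32 * ((\<Sum>x\<in>X. (cmod (y x))^2) / real (card X))"
       "(\<Sum>x\<in>X. (cmod (y x))^2) / real (card X)
          \<le> 1 / 2^t + 2 * \<eta> + 32 * ((\<Sum>j<m. (cmod (y (\<xi> j)))^2) / real m)"
      by (rule conjunct1, rule conjunct2)
  qed
qed

subsection \<open>Sampling of sparse trigonometric polynomials\<close>

lemma cexpk_norm [simp]: "cmod (cexpk k x) = 1"
  by (simp add: cexpk_def)

lemma cexpk_0 [simp]: "cexpk 0 x = 1"
  by (simp add: cexpk_def ipk_def)

lemma cexpk_add: "cexpk (k + l) x = cexpk k x * cexpk l x"
  by (simp add: cexpk_def ipk_def distrib_right sum.distrib distrib_left exp_add)

lemma cexpk_cnj: "cnj (cexpk k x) = cexpk (- k) x"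
  by (simp add: cexpk_def ipk_def sum_negf exp_cnj)

lemma cexpk_mult_cnj: "cexpk k x * cnj (cexpk l x) = cexpk (k - l) x"
  by (simp only: cexpk_cnj cexpk_add[symmetric] diff_conv_add_uminus)

lemma cexpk_prod: "cexpk k x = (\<Prod>i\<in>UNIV. cis (of_int (k$i) * x$i))"
  by (simp add: cexpk_def ipk_def cis_conv_exp exp_sum[symmetric] sum_distrib_left)

lemma norm_sum_squared_expand:
  "complex_of_real ((cmod (\<Sum>k\<in>S. c k * w k))^2) = (\<Sum>k\<in>S. \<Sum>l\<in>S. c k * cnj (c l) * (w k * cnj (w l)))"
  unfolding complex_norm_square by (simp add: sum_product mult_ac)

section \<open>Discrete orthogonality on an equidistant grid\<close>

definition grid :: "nat \<Rightarrow> (real^'d) set" where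
  "grid n = (\<lambda>f. \<chi> i. 2 * pi * real (f i) / real n) ` PiE UNIV (\<lambda>_. {..<n})"

lemma grid_inj: "0 < n \<Longrightarrow> inj_on (\<lambda>f. (\<chi> i. 2 * pi * real (f i) / real n) :: real^'d) A"
  by (auto simp: inj_on_def vec_eq_iff)

lemma finite_grid: "finite (grid n :: (real^'d) set)"
  unfolding grid_def by (intro finite_imageI finite_PiE) auto

lemma card_grid: "0 < n \<Longrightarrow> card (grid n :: (real^'d) set) = n ^ CARD('d)"
  unfolding grid_def by (simp add: card_image grid_inj card_PiE)

lemma grid_subset_Td: "grid n \<subseteq> Td"
  by (cases "n = 0") (auto simp: grid_def Td_def PiE_def Pi_def divide_simps)

lemma sum_root_of_unity:
  fixes q :: int
  assumes "0 < n" "\<bar>q\<bar> < int n"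
  shows "(\<Sum>j<n. cis (of_int q * (2 * pi * real j / real n))) = (if q = 0 then of_nat n else 0)"
proof (cases "q = 0")
  case False
  define \<omega> where "\<omega> = cis (2 * pi * of_int q / real n)"
  have pw: "cis (of_int q * (2 * pi * real j / real n)) = \<omega> ^ j" for j
  proof -
    have "of_int q * (2 * pi * real j / real n) = real j * (2 * pi * of_int q / real n)" by simp
    then show ?thesis by (simp only: \<omega>_def Complex.DeMoivre)
  qed
  have "\<omega> ^ n = 1"
    using assms by (simp add: \<omega>_def Complex.DeMoivre)
  moreover have "\<omega> \<noteq> 1"
  proof
    assume "\<omega> = 1"
    then have "cos (2 * pi * of_int q / real n) = 1" by (simp add: \<omega>_def complex_eq_iff)
    then obtain x :: int where "2 * pi * of_int q / real n = of_int x * 2 * pi"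
      unfolding cos_one_2pi_int by blast
    then have "real_of_int q = of_int (x * int n)" using assms by (simp add: field_simps)
    then have "q = x * int n" by (simp only: of_int_eq_iff)
    then show False using assms False zdvd_imp_le[of "int n" "\<bar>q\<bar>"] by simp
  qed
  ultimately show ?thesis using False unfolding pw by (simp add: geometric_sum)
qed auto

text \<open>Differences of admissible frequencies have coordinates at most \<open>2 * R\<close> in
  absolute value, so \<open>2 * R + 1\<close> points per axis exclude aliasing. The grid is thus a
  finite probability space that carries the exact L2 norm of these polynomials, as the derandomized
  sampling requires.\<close>

lemma grid_orthogonality:
  fixes k l :: "int^'d"
  assumes "\<And>i. \<bar>k$i\<bar> \<le> int R" "\<And>i. \<bar>l$i\<bar> \<le> int R"
  shows "(\<Sum>x\<in>grid (2*R+1). cexpk k x * cnj (cexpk l x)) = (if k = l then of_nat ((2*R+1) ^ CARD('d)) else 0)"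
proof -
  define n where "n = 2 * R + 1"
  have n: "0 < n" by (simp add: n_def)
  have "(\<Sum>x\<in>grid n. cexpk k x * cnj (cexpk l x))
      = (\<Sum>f\<in>PiE UNIV (\<lambda>_. {..<n}). \<Prod>i\<in>UNIV. cis (of_int ((k - l)$i) * (2 * pi * real (f i) / real n)))"
    unfolding grid_def using n
    unfolding cexpk_mult_cnj by (subst sum.reindex[OF grid_inj]) (simp_all add: cexpk_prod)
  also have "\<dots> = (\<Prod>i\<in>UNIV. \<Sum>j<n. cis (of_int ((k - l)$i) * (2 * pi * real j / real n)))"
    by (rule prod_sum_PiE[symmetric]) auto
  also have "\<dots> = (\<Prod>i\<in>UNIV. if (k - l)$i = 0 then of_nat n else 0)"
  proof (intro prod.cong refl sum_root_of_unity n)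
    fix i show "\<bar>(k - l)$i\<bar> < int n" using assms(1,2)[of i] by (simp add: n_def)
  qed
  also have "\<dots> = (if k = l then of_nat (n ^ CARD('d)) else 0)"
    by (auto simp: vec_eq_iff)
  finally show ?thesis by (simp add: n_def)
qed

lemma grid_parseval:
  fixes S :: "(int^'d) set"
  assumes "\<And>k i. k \<in> S \<Longrightarrow> \<bar>k$i\<bar> \<le> int R"
  shows "(\<Sum>x\<in>grid (2*R+1). (cmod (\<Sum>k\<in>S. c k * cexpk k x))^2) / real (card (grid (2*R+1) :: (real^'d) set))
      = (\<Sum>k\<in>S. (cmod (c k))^2)"
proof (cases "finite S")
  case True
  let ?X = "grid (2*R+1) :: (real^'d) set" and ?n = "(2*R+1) ^ CARD('d)"
  have cc: "c k * cnj (c k) = (of_real (cmod (c k)))^2" for k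
    by (simp add: complex_norm_square flip: of_real_power)
  have "complex_of_real (\<Sum>x\<in>?X. (cmod (\<Sum>k\<in>S. c k * cexpk k x))^2)
      = (\<Sum>k\<in>S. \<Sum>l\<in>S. c k * cnj (c l) * (\<Sum>x\<in>?X. cexpk k x * cnj (cexpk l x)))"
    unfolding of_real_sum norm_sum_squared_expand
    by (subst sum.swap, intro sum.cong refl, subst sum.swap) (simp add: sum_distrib_left)
  also have "\<dots> = (\<Sum>k\<in>S. \<Sum>l\<in>S. if k = l then of_real ((cmod (c k))^2 * real ?n) else 0)"
    by (intro sum.cong refl, subst grid_orthogonality)
       (use assms in \<open>auto simp: cc\<close>)
  also have "\<dots> = of_real ((\<Sum>k\<in>S. (cmod (c k))^2) * real ?n)"
    using True by (simp add: sum_distrib_right)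
  finally have "(\<Sum>x\<in>?X. (cmod (\<Sum>k\<in>S. c k * cexpk k x))^2) = (\<Sum>k\<in>S. (cmod (c k))^2) * real ?n"
    by (simp only: of_real_eq_iff)
  moreover have "real ?n > 0" by simp
  ultimately show ?thesis by (simp add: card_grid)
qed simp

text \<open>Cauchy-Schwarz gives the factor \<open>v\<close>, and (|Re| + |Im|)^2 <= 2 |c|^2 the
  factor 2. Real and imaginary parts are counted separately because the atoms carry only the phases
  1, -1, i, -i: the sum is the total mass these need.\<close>

lemma l1_le_sqrt_card_l2:
  assumes "finite S" "card S \<le> v"
  shows "(\<Sum>k\<in>S. \<bar>Re (c k)\<bar> + \<bar>Im (c k)\<bar>) \<le> sqrt (2 * real v * (\<Sum>k\<in>S. (cmod (c k))^2))"
proof (rule real_le_rsqrt)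
  have "(\<Sum>k\<in>S. \<bar>Re (c k)\<bar> + \<bar>Im (c k)\<bar>)^2 \<le> (\<Sum>k\<in>S. (\<bar>Re (c k)\<bar> + \<bar>Im (c k)\<bar>)^2) * real (card S)"
    by (rule sum_squared_le_sum_of_squares)
  also have "\<dots> \<le> (\<Sum>k\<in>S. 2 * (cmod (c k))^2) * real v"
  proof (intro mult_mono sum_mono sum_nonneg)
    fix k
    show "(\<bar>Re (c k)\<bar> + \<bar>Im (c k)\<bar>)\<^sup>2 \<le> 2 * (cmod (c k))\<^sup>2"
      using sum_squares_bound[of "\<bar>Re (c k)\<bar>" "\<bar>Im (c k)\<bar>"]
      by (simp add: cmod_power2 power2_sum)
  qed (use assms in auto)
  finally show "(\<Sum>k\<in>S. \<bar>Re (c k)\<bar> + \<bar>Im (c k)\<bar>)\<^sup>2 \<le> 2 * real v * (\<Sum>k\<in>S. (cmod (c k))\<^sup>2)"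
    by (simp add: sum_distrib_left[symmetric] mult_ac)
qed

text \<open>Homogeneity turns additive errors into constants. The scaled polynomial has mean square
  1/(2v) on the grid, while 1/2^t and 2 * (1/(16v)) are at most 1/(8v) each, together half of it.
  This leaves 32 + 1/2 <= 33 above and 2 * 32 = 64 below.\<close>

lemma fourier_sampling:
  fixes \<Lambda> :: "(int^'d) set"
  assumes \<Lambda>: "finite \<Lambda>" "\<Lambda> \<noteq> {}" "\<And>k i. k \<in> \<Lambda> \<Longrightarrow> \<bar>k$i\<bar> \<le> int R"
    and v: "0 < v" and m: "0 < m" and t: "8 * real v \<le> 2^t"
    and K: "1024 * ln (4 * (2 * real R + 1) ^ CARD('d)) \<le> real K"
    and large: "32 * real v * real (t + 1) * (real K * ln (5 * real (card \<Lambda>)) + ln (4 * real (t + 1))) \<le> real m"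
  shows "\<exists>\<xi>::nat \<Rightarrow> real^'d. (\<forall>j. \<xi> j \<in> Td) \<and> (\<forall>S c. S \<subseteq> \<Lambda> \<and> card S \<le> v \<longrightarrow>
      (\<Sum>j<m. (cmod (\<Sum>k\<in>S. c k * cexpk k (\<xi> j)))^2) / real m \<le> 33 * (\<Sum>k\<in>S. (cmod (c k))^2) \<and>
      (\<Sum>k\<in>S. (cmod (c k))^2) \<le> 64 * ((\<Sum>j<m. (cmod (\<Sum>k\<in>S. c k * cexpk k (\<xi> j)))^2) / real m))"
proof -
  define D where "D = {0, 1, -1, \<i>, -\<i>}"
  have D: "finite D" "\<And>\<tau>. \<tau> \<in> D \<Longrightarrow> cmod \<tau> \<le> 1" by (auto simp: D_def)
  have cD: "card D = 5" by (simp add: D_def complex_eq_iff)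
  \<comment> \<open>The phase 0 gives a zero atom that absorbs the missing mass of a subconvex combination.\<close>
  define A where "A = \<Lambda> \<times> D"
  define z where "z = (\<lambda>(k::int^'d,\<tau>::complex) x. \<tau> * cexpk k x)"
  let ?X = "grid (2*R+1) :: (real^'d) set"
  have A: "finite A" "A \<noteq> {}" "real (card A) = 5 * real (card \<Lambda>)"
    using \<Lambda> D cD by (auto simp: A_def card_cartesian_product D_def)
  have cX: "card ?X = (2*R+1) ^ CARD('d)" by (rule card_grid) simp
  then have X: "finite ?X" "?X \<noteq> {}" using finite_grid by (auto simp: card_gt_0_iff)
  have "\<exists>\<xi>::nat \<Rightarrow> real^'d. (\<forall>j. \<xi> j \<in> ?X) \<and> (\<forall>p y. (\<forall>a\<in>A. 0 \<le> p a) \<and> sum p A = 1 \<and>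
       (\<forall>x\<in>?X. y x = (\<Sum>a\<in>A. of_real (p a) * z a x)) \<longrightarrow>
       (\<Sum>j<m. (cmod (y (\<xi> j)))^2) / real m
          \<le> 1 / 2^t + 2 * (1 / (16 * real v)) + 32 * ((\<Sum>x\<in>?X. (cmod (y x))^2) / real (card ?X)) \<and>
       (\<Sum>x\<in>?X. (cmod (y x))^2) / real (card ?X)
          \<le> 1 / 2^t + 2 * (1 / (16 * real v)) + 32 * ((\<Sum>j<m. (cmod (y (\<xi> j)))^2) / real m))"
  proof (rule sampling_convex_hull[where K = K])
    show "cmod (z a x) \<le> 1" if "a \<in> A" for a x
      using that D(2) by (auto simp: A_def z_def norm_mult)
    show "1024 * ln (4 * real (card ?X)) \<le> real K" using K unfolding cX by (simp add: add.commute)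
    show "real K * ln (real (card A)) + ln (4 * real (t + 1)) \<le> real m * (1 / (16 * real v)) / (2 * real (t + 1))"
    proof -
      have "real m * (1 / (16 * real v)) / (2 * real (t + 1)) = real m / (32 * real v * real (t + 1))" by simp
      moreover have "0 < 32 * real v * real (t + 1)" using v by simp
      ultimately show ?thesis using large unfolding A(3) by (simp only: pos_le_divide_eq mult.commute)
    qed
  qed (use A X m v in auto)
  then obtain \<xi> :: "nat \<Rightarrow> real^'d" where \<xi>: "\<And>j. \<xi> j \<in> ?X" and samp: "\<And>p y. (\<forall>a\<in>A. 0 \<le> p a) \<Longrightarrow> sum p A = 1 \<Longrightarrow>
       (\<forall>x\<in>?X. y x = (\<Sum>a\<in>A. of_real (p a) * z a x)) \<Longrightarrow>
       (\<Sum>j<m. (cmod (y (\<xi> j)))^2) / real m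
          \<le> 1 / 2^t + 2 * (1 / (16 * real v)) + 32 * ((\<Sum>x\<in>?X. (cmod (y x))^2) / real (card ?X)) \<and>
       (\<Sum>x\<in>?X. (cmod (y x))^2) / real (card ?X)
          \<le> 1 / 2^t + 2 * (1 / (16 * real v)) + 32 * ((\<Sum>j<m. (cmod (y (\<xi> j)))^2) / real m)"
    by blast
  have main: "(\<Sum>j<m. (cmod (\<Sum>k\<in>S. c k * cexpk k (\<xi> j)))^2) / real m \<le> 33 * (\<Sum>k\<in>S. (cmod (c k))^2) \<and>
      (\<Sum>k\<in>S. (cmod (c k))^2) \<le> 64 * ((\<Sum>j<m. (cmod (\<Sum>k\<in>S. c k * cexpk k (\<xi> j)))^2) / real m)"
    if S: "S \<subseteq> \<Lambda>" "card S \<le> v" for S c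
  proof -
    define C where "C = (\<Sum>k\<in>S. (cmod (c k))^2)"
    have finS: "finite S" using S \<Lambda> finite_subset by blast
    have C0: "0 \<le> C" unfolding C_def by (intro sum_nonneg) auto
    show ?thesis
    proof (cases "C = 0")
      case True
      then have "c k = 0" if "k \<in> S" for k
        using that finS by (simp add: C_def sum_nonneg_eq_0_iff)
      then show ?thesis by simp
    next
      case False
      \<comment> \<open>This is the bound of \<open>l1_le_sqrt_card_l2\<close>, so after division by
        \<open>s\<close> the coefficients have total mass \<sigma> at most 1.\<close>
      define s where "s = sqrt (2 * real v * C)"
      have s: "0 < s" "s^2 = 2 * real v * C" using v C0 False by (auto simp: s_def)
      obtain k0 where k0: "k0 \<in> \<Lambda>" using \<Lambda> by blast
      define \<sigma> where "\<sigma> = (\<Sum>k\<in>S. \<bar>Re (c k)\<bar> + \<bar>Im (c k)\<bar>) / s"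
      have \<sigma>: "\<sigma> \<le> 1" using l1_le_sqrt_card_l2[OF finS S(2), of c] s(1)
        by (simp add: \<sigma>_def s_def C_def)
      \<comment> \<open>For nonzero \<tau> the weight is the positive part of the component of
        \<open>c k\<close> along \<tau>; opposite phases then recombine to the real and imaginary
        parts.\<close>
      define p where "p = (\<lambda>(k,\<tau>). if \<tau> = 0 then (if k = k0 then 1 - \<sigma> else 0)
          else if k \<in> S then max (Re (c k * cnj \<tau>)) 0 / s else 0)"
      have sumD: "sum f D = f 0 + f 1 + f (-1) + f \<i> + f (-\<i>)" for f :: "complex \<Rightarrow> 'z::comm_monoid_add"
        unfolding D_def by (subst sum.insert; simp add: complex_eq_iff add.assoc)+
      have sumA: "sum f A = (\<Sum>k\<in>\<Lambda>. \<Sum>\<tau>\<in>D. f (k, \<tau>))" for f :: "_ \<Rightarrow> 'z::comm_monoid_add"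
        unfolding A_def by (simp add: sum.cartesian_product)
      have restr: "(\<Sum>k\<in>\<Lambda>. if k \<in> S then f k else 0) = sum f S" for f :: "_ \<Rightarrow> 'z::comm_monoid_add"
        using S \<Lambda> by (simp add: sum.If_cases Int_absorb1)
      have mx: "max r 0 + max (- r) 0 = \<bar>r\<bar>" "max r 0 - max (- r) 0 = r" for r :: real by auto
      have "sum p A = (\<Sum>k\<in>\<Lambda>. (if k = k0 then 1 - \<sigma> else 0) + (if k \<in> S then (\<bar>Re (c k)\<bar> + \<bar>Im (c k)\<bar>) / s else 0))"
        unfolding sumA sumD
        by (intro sum.cong refl) (auto simp: p_def mx(1)[symmetric] add_divide_distrib)
      also have "\<dots> = 1" using k0 \<Lambda> by (simp add: sum.distrib[of "\<lambda>k. if k = k0 then 1 - \<sigma> else 0"] restr \<sigma>_def flip: sum_divide_distrib)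
      finally have p1: "sum p A = 1" .
      have p0: "\<forall>a\<in>A. 0 \<le> p a" using \<sigma> s by (auto simp: p_def)
      define y where "y x = (\<Sum>k\<in>S. c k * cexpk k x) / of_real s" for x
      have yp: "\<forall>x\<in>?X. y x = (\<Sum>a\<in>A. of_real (p a) * z a x)"
      proof
        fix x :: "real^'d"
        have cs: "(\<Sum>\<tau>\<in>D. of_real (p (k,\<tau>)) * z (k,\<tau>) x) = (if k \<in> S then c k * cexpk k x / of_real s else 0)" for k
        proof (cases "k \<in> S")
          case True
          have "(\<Sum>\<tau>\<in>D. of_real (p (k,\<tau>)) * z (k,\<tau>) x)
             = Complex (max (Re (c k)) 0 - max (- Re (c k)) 0) (max (Im (c k)) 0 - max (- Im (c k)) 0) * cexpk k x / of_real s"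
            unfolding sumD using True
            by (simp add: p_def z_def complex_eq_iff diff_divide_distrib add_divide_distrib algebra_simps)
          then show ?thesis using True by (simp add: mx(2))
        next
          case False then show ?thesis unfolding sumD by (simp add: p_def z_def)
        qed
        show "y x = (\<Sum>a\<in>A. of_real (p a) * z a x)"
          unfolding sumA cs restr y_def by (simp add: sum_divide_distrib)
      qed
      have ysq: "(cmod (y x))^2 = (cmod (\<Sum>k\<in>S. c k * cexpk k x))^2 / (2 * real v * C)" for x
        using s by (simp add: y_def norm_divide power_divide)
      have EX: "(\<Sum>x\<in>?X. (cmod (y x))^2) / real (card ?X) = 1 / (2 * real v)"
      proof -
        have "(\<Sum>x\<in>?X. (cmod (y x))^2) / real (card ?X)
           = ((\<Sum>x\<in>?X. (cmod (\<Sum>k\<in>S. c k * cexpk k x))^2) / real (card ?X)) / (2 * real v * C)"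
          by (simp add: ysq sum_divide_distrib mult_ac)
        also have "\<dots> = C / (2 * real v * C)"
          using S \<Lambda>(3) by (subst grid_parseval) (auto simp: C_def)
        finally show ?thesis using False by simp
      qed
      have t': "1 / 2^t \<le> 1 / (8 * real v)" using t v by (simp add: field_simps)
      define E where "E = (\<Sum>j<m. (cmod (\<Sum>k\<in>S. c k * cexpk k (\<xi> j)))^2) / real m"
      have EQ: "(\<Sum>j<m. (cmod (y (\<xi> j)))^2) / real m = E / (2 * real v * C)"
        by (simp add: E_def ysq sum_divide_distrib mult_ac)
      have F: "E / (2 * real v * C) \<le> 33 * (1 / (2 * real v))" "1 / (2 * real v) \<le> 64 * (E / (2 * real v * C))"
        using samp[OF p0 p1 yp] t' unfolding EX EQ by (simp_all add: mult.commute)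
      have pos: "0 < 2 * real v * C" using v False C0 by simp
      have "E \<le> 33 * C" using mult_right_mono[OF F(1), of "2 * real v * C"] pos v False by simp
      moreover have "C \<le> 64 * E" using mult_right_mono[OF F(2), of "2 * real v * C"] pos v False by simp
      ultimately show ?thesis by (simp add: E_def C_def)
    qed
  qed
  show ?thesis
    using \<xi> grid_subset_Td main by (intro exI[of _ \<xi>]) auto
qed

subsection \<open>Dyadic blocks\<close>

text \<open>The frequencies of f_j, that is, the index set of the sum in
  \<open>blockA\<close>.\<close>

definition hblock :: "nat \<Rightarrow> (int^'d) set" where
  "hblock j = (\<Union>s\<in>{s::nat^'d. (\<Sum>i\<in>UNIV. s$i) = j}. rho_blk s)"

text \<open>One coordinate of \<open>rho_blk\<close>: blocks are products of shells, and since the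
  shells partition the integers, the sets \<open>hblock j\<close> partition the lattice.\<close>

definition dyadic_shell :: "nat \<Rightarrow> int set" where
  "dyadic_shell s = {q. \<lfloor>2 powr (real s - 1)\<rfloor> \<le> \<bar>q\<bar> \<and> \<bar>q\<bar> < 2^s}"

lemma dyadic_shell_0: "dyadic_shell 0 = {0}"
proof -
  have "\<lfloor>2 powr (-1) :: real\<rfloor> = 0" by (simp add: powr_minus)
  then show ?thesis by (auto simp: dyadic_shell_def)
qed

lemma dyadic_shell_Suc: "dyadic_shell (Suc n) = {q. 2^n \<le> \<bar>q\<bar> \<and> \<bar>q\<bar> < 2^Suc n}"
proof -
  have "(2::real) powr (real (Suc n) - 1) = of_int (2^n)" by (simp add: powr_realpow)
  then have "\<lfloor>2 powr (real (Suc n) - 1) :: real\<rfloor> = 2^n" by (simp only: floor_of_int)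
  then show ?thesis by (simp only: dyadic_shell_def)
qed

lemma dyadic_shell_unique:
  assumes "q \<in> dyadic_shell s" "q \<in> dyadic_shell t" shows "s = t"
proof -
  have "\<not> s < t" if "q \<in> dyadic_shell s" "q \<in> dyadic_shell t" for s t
  proof
    assume "s < t"
    then obtain n where n: "t = Suc n" "s \<le> n" by (cases t) auto
    have "(2::int)^s \<le> 2^n" using n by simp
    moreover have "\<bar>q\<bar> < 2^s" using that by (auto simp: dyadic_shell_def)
    moreover have "2^n \<le> \<bar>q\<bar>" using that n by (auto simp: dyadic_shell_Suc)
    ultimately show False by linarith
  qed
  then show ?thesis using assms by (meson linorder_neqE_nat)
qed

lemma dyadic_shell_exists: "\<exists>s. q \<in> dyadic_shell s"
proof -
  have "\<bar>q\<bar> < 2 ^ nat \<bar>q\<bar>" using less_exp[of "nat \<bar>q\<bar>"]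
    by (metis abs_ge_zero nat_less_iff of_nat_numeral of_nat_power zless_nat_eq_int_zless)
  then have ex: "\<exists>s. \<bar>q\<bar> < 2^s" by blast
  define s where "s = (LEAST s. \<bar>q\<bar> < 2^s)"
  have s: "\<bar>q\<bar> < 2^s" unfolding s_def using ex by (rule LeastI_ex)
  show ?thesis
  proof (cases s)
    case 0 then show ?thesis using s dyadic_shell_0 by (intro exI[of _ 0]) auto
  next
    case (Suc n)
    then have "\<not> \<bar>q\<bar> < 2^n" unfolding s_def by (metis not_less_Least lessI)
    then show ?thesis using s Suc by (intro exI[of _ s]) (auto simp: dyadic_shell_Suc)
  qed
qed

lemma finite_dyadic_shell: "finite (dyadic_shell s)"
  by (rule finite_subset[of _ "{-(2^s)..2^s}"]) (auto simp: dyadic_shell_def)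

lemma card_dyadic_shell: "card (dyadic_shell s) \<le> 2^s"
proof (cases s)
  case 0 then show ?thesis by (simp add: dyadic_shell_0)
next
  case (Suc n)
  have "dyadic_shell s \<subseteq> {2^n..<2^Suc n} \<union> {-(2^Suc n)<..-(2^n)}"
    unfolding Suc dyadic_shell_Suc by auto
  then have "card (dyadic_shell s) \<le> card ({2^n..<2^Suc n::int} \<union> {-(2^Suc n)<..-(2^n)})"
    by (intro card_mono) auto
  also have "\<dots> \<le> card {2^n..<2^Suc n::int} + card {-(2^Suc n)<..-(2^n)::int}" by (rule card_Un_le)
  also have "\<dots> = 2^s" by (simp add: Suc nat_power_eq)
  finally show ?thesis .
qed

lemma rho_blk_iff: "k \<in> rho_blk s \<longleftrightarrow> (\<forall>i. k$i \<in> dyadic_shell (s$i))"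
  by (simp add: rho_blk_def dyadic_shell_def)

lemma card_Collect_vec:
  fixes A :: "'d::finite \<Rightarrow> 'b set"
  assumes "\<And>i. finite (A i)"
  shows "finite {k::'b^'d. \<forall>i. k$i \<in> A i}" "card {k::'b^'d. \<forall>i. k$i \<in> A i} = (\<Prod>i\<in>UNIV. card (A i))"
proof -
  have bij: "bij_betw vec_lambda (PiE UNIV A) {k::'b^'d. \<forall>i. k$i \<in> A i}"
    by (rule bij_betw_byWitness[where f' = vec_nth]) (auto simp: PiE_def Pi_def)
  have fin: "finite (PiE UNIV A)" using assms by (intro finite_PiE) auto
  show "finite {k::'b^'d. \<forall>i. k$i \<in> A i}" using bij_betw_finite[OF bij] fin by blast
  show "card {k::'b^'d. \<forall>i. k$i \<in> A i} = (\<Prod>i\<in>UNIV. card (A i))"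
    using bij_betw_same_card[OF bij] by (simp add: card_PiE)
qed

lemma finite_rho_blk: "finite (rho_blk s :: (int^'d) set)"
  and card_rho_blk: "card (rho_blk s :: (int^'d) set) \<le> 2 ^ (\<Sum>i\<in>UNIV. s$i)"
proof -
  have eq: "rho_blk s = {k::int^'d. \<forall>i. k$i \<in> dyadic_shell (s$i)}" by (auto simp: rho_blk_iff)
  show "finite (rho_blk s :: (int^'d) set)" unfolding eq by (intro card_Collect_vec finite_dyadic_shell)
  have "card (rho_blk s :: (int^'d) set) = (\<Prod>i\<in>UNIV. card (dyadic_shell (s$i)))"
    unfolding eq by (intro card_Collect_vec finite_dyadic_shell)
  also have "\<dots> \<le> (\<Prod>i\<in>UNIV. 2^(s$i))" by (intro prod_mono) (auto simp: card_dyadic_shell)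
  finally show "card (rho_blk s :: (int^'d) set) \<le> 2 ^ (\<Sum>i\<in>UNIV. s$i)" by (simp add: power_sum)
qed

text \<open>One coordinate is determined by the others and the sum, so dropping it is injective and
  leaves \<open>CARD('d) - 1\<close> entries in \<open>{..j}\<close>. This exponent is the source of
  the d - 1 in the logarithmic factor of the rate.\<close>

lemma compositions:
  shows "finite {s::nat^'d. (\<Sum>i\<in>UNIV. s$i) = j}"
    and "card {s::nat^'d. (\<Sum>i\<in>UNIV. s$i) = j} \<le> (j + 1) ^ (CARD('d) - 1)"
proof -
  define i0 where "i0 = (undefined :: 'd)"
  let ?C = "{s::nat^'d. (\<Sum>i\<in>UNIV. s$i) = j}"
  define r where "r s = restrict (vec_nth s) (UNIV - {i0})" for s :: "nat^'d"
  have tot: "s$i0 + (\<Sum>i\<in>UNIV - {i0}. s$i) = (\<Sum>i\<in>UNIV. s$i)" for s :: "nat^'d"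
    by (simp add: sum.remove[of UNIV i0])
  have inj: "inj_on r ?C"
  proof (rule inj_onI)
    fix s t :: "nat^'d" assume st: "s \<in> ?C" "t \<in> ?C" "r s = r t"
    have e: "s$i = t$i" if "i \<noteq> i0" for i
      using st(3) that by (metis r_def restrict_apply' DiffI UNIV_I singletonD)
    then have "(\<Sum>i\<in>UNIV - {i0}. s$i) = (\<Sum>i\<in>UNIV - {i0}. t$i)" by (intro sum.cong) auto
    then have "s$i0 = t$i0" using tot[of s] tot[of t] st by simp
    then show "s = t" using e unfolding vec_eq_iff by metis
  qed
  have sub: "r ` ?C \<subseteq> PiE (UNIV - {i0}) (\<lambda>_. {..j})"
  proof -
    have "s$i \<le> (\<Sum>i\<in>UNIV. s$i)" for s :: "nat^'d" and i by (rule member_le_sum) auto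
    then show ?thesis by (auto simp: r_def split: if_splits)
  qed
  have finP: "finite (PiE (UNIV - {i0}) (\<lambda>_. {..j}))" by (intro finite_PiE) auto
  show "finite ?C" using finite_subset[OF sub finP] inj finite_imageD by blast
  have "card ?C \<le> card (PiE (UNIV - {i0}) (\<lambda>_. {..j}))"
    using card_image[OF inj] card_mono[OF finP sub] by simp
  also have "\<dots> = (j + 1) ^ (CARD('d) - 1)" by (simp add: card_PiE card_Diff_singleton)
  finally show "card ?C \<le> (j + 1) ^ (CARD('d) - 1)" .
qed

lemma finite_hblock: "finite (hblock j :: (int^'d) set)"
  unfolding hblock_def by (intro finite_UN_I compositions finite_rho_blk)

lemma card_hblock: "card (hblock j :: (int^'d) set) \<le> (j + 1) ^ (CARD('d) - 1) * 2^j"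
proof -
  let ?C = "{s::nat^'d. (\<Sum>i\<in>UNIV. s$i) = j}"
  have "card (hblock j :: (int^'d) set) \<le> (\<Sum>s\<in>?C. card (rho_blk s :: (int^'d) set))"
    unfolding hblock_def by (intro card_UN_le compositions)
  also have "\<dots> \<le> (\<Sum>s\<in>?C. 2^j)"
    by (intro sum_mono) (use card_rho_blk in auto)
  also have "\<dots> \<le> (j + 1) ^ (CARD('d) - 1) * 2^j"
    using compositions(2)[where 'd = 'd, of j] by simp
  finally show ?thesis .
qed

lemma hblock_unique:
  assumes "k \<in> hblock i" "k \<in> hblock j" shows "i = j"
proof -
  obtain s t where s: "(\<Sum>l\<in>UNIV. s$l) = i" "k \<in> rho_blk s" and t: "(\<Sum>l\<in>UNIV. t$l) = j" "k \<in> rho_blk t"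
    using assms by (auto simp: hblock_def)
  have "s = t" using s(2) t(2) dyadic_shell_unique unfolding rho_blk_iff vec_eq_iff by blast
  then show ?thesis using s t by simp
qed

lemma hblock_exists: "\<exists>j. k \<in> hblock j"
proof -
  have "\<forall>i. \<exists>s. k$i \<in> dyadic_shell s" using dyadic_shell_exists by blast
  then obtain s where "\<And>i. k$i \<in> dyadic_shell (s i)" by metis
  then have "k \<in> rho_blk (\<chi> i. s i)" by (simp add: rho_blk_iff)
  then show ?thesis unfolding hblock_def by blast
qed

lemma card_hblocks_below: "card (\<Union>j<n. hblock j :: (int^'d) set) \<le> 2^n * (n + 1) ^ (CARD('d) - 1)"
proof -
  have "card (\<Union>j<n. hblock j :: (int^'d) set) \<le> (\<Sum>j<n. card (hblock j :: (int^'d) set))"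
    by (rule card_UN_le) simp
  also have "\<dots> \<le> (\<Sum>j<n. (n + 1) ^ (CARD('d) - 1) * 2^j)"
    by (intro sum_mono order_trans[OF card_hblock] mult_right_mono power_mono) auto
  also have "\<dots> = (n + 1) ^ (CARD('d) - 1) * (2^n - 1)"
    by (simp add: sum_distrib_left[symmetric] mask_eq_sum_exp_nat lessThan_def)
  also have "\<dots> \<le> 2^n * (n + 1) ^ (CARD('d) - 1)" by simp
  finally show ?thesis .
qed

lemma hblock_subset_Gamma: "j \<le> J \<Longrightarrow> hblock j \<subseteq> (Gamma_hc (2^J) :: (int^'d) set)"
proof
  fix k :: "int^'d" assume j: "j \<le> J" and "k \<in> hblock j"
  then obtain s where s: "(\<Sum>i\<in>UNIV. s$i) = j" "k \<in> rho_blk s" by (auto simp: hblock_def)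
  have "(\<Prod>i\<in>UNIV. max \<bar>real_of_int (k$i)\<bar> 1) \<le> (\<Prod>i\<in>UNIV. 2^(s$i))"
  proof (intro prod_mono conjI)
    fix i
    have "\<bar>k$i\<bar> < 2^(s$i)" using s(2) by (simp add: rho_blk_def)
    then have "\<bar>real_of_int (k$i)\<bar> \<le> 2^(s$i)"
      by (metis less_imp_le of_int_abs of_int_le_iff of_int_numeral of_int_power)
    then show "max \<bar>real_of_int (k$i)\<bar> 1 \<le> 2^(s$i)" by simp
  qed simp
  also have "\<dots> = 2^j" using s(1) by (simp add: power_sum[symmetric])
  also have "\<dots> \<le> 2^J" using j by simp
  finally show "k \<in> Gamma_hc (2^J)" by (simp add: Gamma_hc_def)
qed

lemma Gamma_coord_le:
  assumes "k \<in> Gamma_hc (2^J)" shows "\<bar>k$i\<bar> \<le> 2^J"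
proof -
  have "max \<bar>real_of_int (k$i)\<bar> 1 \<le> (\<Prod>i\<in>UNIV. max \<bar>real_of_int (k$i)\<bar> 1)"
  proof -
    have "(1::real) \<le> (\<Prod>j\<in>UNIV - {i}. max \<bar>real_of_int (k$j)\<bar> 1)" by (rule prod_ge_1) auto
    then show ?thesis
      using mult_left_mono[of 1 _ "max \<bar>real_of_int (k$i)\<bar> 1"] by (simp add: prod.remove[of UNIV i])
  qed
  then have "\<bar>real_of_int (k$i)\<bar> \<le> real_of_int (2^J)" using assms by (simp add: Gamma_hc_def)
  then show ?thesis by (simp only: of_int_abs[symmetric] of_int_le_iff)
qed

text \<open>The enclosing box is a crude count, but a power of 2^J is all that is wanted: it becomes
  a power of \<open>v\<close>.\<close>

lemma finite_Gamma: "finite (Gamma_hc (2^J) :: (int^'d) set)"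
  and card_Gamma: "card (Gamma_hc (2^J) :: (int^'d) set) \<le> (2 * 2^J + 1) ^ CARD('d)"
proof -
  have sub: "Gamma_hc (2^J) \<subseteq> {k::int^'d. \<forall>i. k$i \<in> {-(2^J)..2^J}}"
    using Gamma_coord_le by (auto simp: abs_le_iff) (smt (verit) Gamma_coord_le)+
  show "finite (Gamma_hc (2^J) :: (int^'d) set)"
    by (rule finite_subset[OF sub card_Collect_vec(1)]) simp
  have "card (Gamma_hc (2^J) :: (int^'d) set) \<le> card {k::int^'d. \<forall>i. k$i \<in> {-(2^J)..2^J}}"
    by (rule card_mono[OF card_Collect_vec(1) sub]) simp
  also have "\<dots> = (2 * 2^J + 1) ^ CARD('d)"
    by (subst card_Collect_vec(2)) (auto simp: nat_add_distrib nat_mult_distrib nat_power_eq)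
  finally show "card (Gamma_hc (2^J) :: (int^'d) set) \<le> (2 * 2^J + 1) ^ CARD('d)" .
qed

subsection \<open>Fourier series on the torus\<close>

abbreviation torus_measure :: "(real^'d) measure" where
  "torus_measure \<equiv> restrict_space lborel Td"

lemma Td_borel [measurable]: "Td \<in> sets borel"
proof -
  have eq: "Td = (\<Inter>i\<in>UNIV. (\<lambda>x::real^'d. x$i) -` {0..<2*pi} \<inter> space borel)"
    by (auto simp: Td_def)
  have "(\<lambda>x::real^'d. x$i) -` {0..<2*pi} \<inter> space borel \<in> sets borel" for i
    by (intro measurable_sets[of _ borel borel] borel_measurable_continuous_onI continuous_intros) auto
  then show ?thesis unfolding eq by (intro sets.finite_INT) auto
qed

lemma Td_subset_cbox: "Td \<subseteq> (cbox 0 (\<chi> i. 2*pi) :: (real^'d) set)"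
  by (auto simp: Td_def mem_box_cart less_imp_le)

lemma integral_torus: "set_lebesgue_integral lborel Td f = integral\<^sup>L torus_measure f"
  for f :: "real^'d \<Rightarrow> 'b::{banach,second_countable_topology}"
  unfolding set_lebesgue_integral_def by (subst integral_restrict_space) auto

lemma space_torus [simp]: "space torus_measure = Td"
  by (simp add: space_restrict_space)

lemma finite_measure_torus: "finite_measure (torus_measure :: (real^'d) measure)"
proof
  have "emeasure lborel (Td :: (real^'d) set) \<le> emeasure lborel (cbox 0 (\<chi> i. 2*pi) :: (real^'d) set)"
    by (intro emeasure_mono Td_subset_cbox) simp
  then have "emeasure lborel (Td :: (real^'d) set) < \<infinity>"
    using emeasure_lborel_cbox_finite order_le_less_trans by blast
  then show "emeasure (torus_measure :: (real^'d) measure) (space torus_measure) \<noteq> \<infinity>"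
    by (simp add: emeasure_restrict_space)
qed

lemma continuous_bounded_on_Td:
  fixes f :: "real^'d \<Rightarrow> 'b::real_normed_vector"
  assumes "continuous_on UNIV f"
  obtains B where "0 \<le> B" "\<And>x. x \<in> Td \<Longrightarrow> norm (f x) \<le> B"
proof -
  have "compact (f ` cbox 0 (\<chi> i. 2*pi))"
    by (intro compact_continuous_image continuous_on_subset[OF assms]) auto
  then obtain B where B: "\<forall>y\<in>f ` cbox 0 (\<chi> i. 2*pi). norm y \<le> B"
    using compact_imp_bounded bounded_iff by blast
  show ?thesis
    using B Td_subset_cbox by (intro that[of "max B 0"]) fastforce+
qed

lemma integrable_torus:
  fixes f :: "real^'d \<Rightarrow> 'b::{banach,second_countable_topology}"
  assumes "continuous_on UNIV f"
  shows "integrable torus_measure f"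
proof -
  interpret finite_measure "torus_measure :: (real^'d) measure" by (rule finite_measure_torus)
  obtain B where B: "\<And>x. x \<in> Td \<Longrightarrow> norm (f x) \<le> B"
    using continuous_bounded_on_Td[OF assms] by metis
  show ?thesis
  proof (rule integrable_const_bound)
    show "AE x in torus_measure. norm (f x) \<le> B" using B by (intro AE_I2) simp
    show "f \<in> borel_measurable torus_measure"
      using borel_measurable_continuous_onI[OF assms] by (intro measurable_restrict_space1) simp
  qed
qed

lemma continuous_on_cexpk [continuous_intros]: "continuous_on A (cexpk k)"
  unfolding cexpk_def ipk_def by (intro continuous_intros)

lemma integral_cis_period:
  fixes q :: int
  shows "integrable lborel (\<lambda>x. indicat_real {0..<2*pi} x *\<^sub>R cis (of_int q * x))" (is ?I)
    and "(\<integral>x. indicat_real {0..<2*pi} x *\<^sub>R cis (of_int q * x) \<partial>lborel) = (if q = 0 then of_real (2*pi) else 0)"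
proof -
  have cont: "continuous_on A (\<lambda>x. cis (of_int q * x))" for A by (intro continuous_intros)
  have int1: "integrable lborel (\<lambda>x. indicat_real {0..2*pi} x *\<^sub>R cis (of_int q * x))"
    using borel_integrable_atLeastAtMost'[OF cont, of 0 "2*pi"] by (simp add: set_integrable_def)
  have AE: "AE x in lborel. indicat_real {0..2*pi} x *\<^sub>R cis (of_int q * x) = indicat_real {0..<2*pi} x *\<^sub>R cis (of_int q * x)"
    using AE_lborel_singleton[of "2*pi"] by eventually_elim (auto simp: indicator_def)
  have meas: "(\<lambda>x. indicat_real {0..<2*pi} x *\<^sub>R cis (of_int q * x)) \<in> borel_measurable lborel"
    using borel_measurable_continuous_onI[OF cont] by (intro borel_measurable_scaleR) auto
  show ?I using integrable_cong_AE_imp[OF int1 meas] AE by (auto elim: eventually_mono)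
  have "(\<integral>x. indicat_real {0..<2*pi} x *\<^sub>R cis (of_int q * x) \<partial>lborel)
      = (\<integral>x. indicat_real {0..2*pi} x *\<^sub>R cis (of_int q * x) \<partial>lborel)"
    by (rule integral_cong_AE) (use meas int1 AE in \<open>auto elim: eventually_mono\<close>)
  also have "\<dots> = (if q = 0 then of_real (2*pi) else 0)"
  proof (cases "q = 0")
    case True then show ?thesis by (simp add: scaleR_conv_of_real)
  next
    case False
    have "(\<integral>x. indicat_real {0..2*pi} x *\<^sub>R cis (of_int q * x) \<partial>lborel)
       = (\<lambda>x. cis (of_int q * x) / (\<i> * of_int q)) (2*pi) - (\<lambda>x. cis (of_int q * x) / (\<i> * of_int q)) 0"
    proof (rule integral_FTC_Icc)
      fix x :: real
      have "((\<lambda>z. exp (\<i> * (of_int q * z)) / (\<i> * of_int q)) has_field_derivative exp (\<i> * (of_int q * of_real x))) (at (of_real x))"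
        using False by (auto intro!: derivative_eq_intros simp: field_simps)
      from has_vector_derivative_real_field[OF this]
      show "((\<lambda>x. cis (of_int q * x) / (\<i> * of_int q)) has_vector_derivative cis (of_int q * x)) (at x within {0..2*pi})"
        by (simp add: cis_conv_exp has_vector_derivative_at_within)
    qed (use cont in auto)
    also have "\<dots> = 0"
      using cis_multiple_2pi[of "of_int q"] by (simp add: mult_ac)
    finally show ?thesis using False by simp
  qed
  finally show "(\<integral>x. indicat_real {0..<2*pi} x *\<^sub>R cis (of_int q * x) \<partial>lborel) = (if q = 0 then of_real (2*pi) else 0)" .
qed

lemma integral_cexpk:
  fixes k :: "int^'d"
  shows "integral\<^sup>L torus_measure (cexpk k) = (if k = 0 then of_real ((2*pi) ^ CARD('d)) else 0)"
proof -
  \<comment> \<open>Lebesgue measure is a product over basis vectors rather than indices;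
    \<open>q\<close> reads the frequency of an index off its basis vector.\<close>
  define q where "q b = (THE l. \<exists>i. b = axis i (1::real) \<and> l = k$i)" for b :: "real^'d"
  have q: "q (axis i 1) = k$i" for i
    unfolding q_def by (rule the_equality) (auto simp: axis_eq_axis)
  have B: "(Basis :: (real^'d) set) = range (\<lambda>i. axis i 1)" by (auto simp: Basis_vec_def)
  have inj: "inj (\<lambda>i. axis i (1::real) :: real^'d)" by (auto simp: inj_def axis_eq_axis)
  interpret product_sigma_finite "\<lambda>_::real^'d. lborel :: real measure" ..
  define \<Psi> where "\<Psi> x = indicat_real Td x *\<^sub>R cexpk k x" for x
  have m\<Psi>: "\<Psi> \<in> borel_measurable borel"
    unfolding \<Psi>_def using borel_measurable_continuous_onI[OF continuous_on_cexpk[of UNIV k]]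
    by (intro borel_measurable_scaleR) auto
  have "integral\<^sup>L torus_measure (cexpk k) = integral\<^sup>L lborel \<Psi>"
    unfolding integral_torus[symmetric] set_lebesgue_integral_def \<Psi>_def ..
  also have "\<dots> = (\<integral>f. \<Psi> (\<Sum>b\<in>Basis. f b *\<^sub>R b) \<partial>(\<Pi>\<^sub>M b\<in>(Basis :: (real^'d) set). lborel))"
    by (subst lborel_eq, rule integral_distr) (use m\<Psi> in auto)
  also have "\<dots> = (\<integral>f. (\<Prod>b\<in>Basis. indicat_real {0..<2*pi} (f b) *\<^sub>R cis (of_int (q b) * f b))
        \<partial>(\<Pi>\<^sub>M b\<in>(Basis :: (real^'d) set). lborel))"
  proof (intro Bochner_Integration.integral_cong refl)
    fix f :: "real^'d \<Rightarrow> real"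
    define w where "w = (\<Sum>b\<in>(Basis :: (real^'d) set). f b *\<^sub>R b)"
    have comp: "f (axis i 1) = w $ i" for i
      unfolding w_def B sum.reindex[OF inj] by (simp add: axis_def if_distrib cong: if_cong)
    have "(\<Prod>b\<in>Basis. indicat_real {0..<2*pi} (f b) *\<^sub>R cis (of_int (q b) * f b))
       = (\<Prod>i\<in>UNIV. indicat_real {0..<2*pi} (w$i)) *\<^sub>R (\<Prod>i\<in>UNIV. cis (of_int (k$i) * w$i))"
      unfolding B prod.reindex[OF inj] by (simp add: q scaleR_conv_of_real prod.distrib comp)
    also have "(\<Prod>i\<in>UNIV. indicat_real {0..<2*pi} (w$i)) = indicat_real Td w"
    proof (cases "w \<in> Td")
      case True
      then show ?thesis by (simp add: Td_def)
    next
      case False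
      then obtain i where "w$i \<notin> {0..<2*pi}" by (auto simp: Td_def)
      then have "indicat_real {0..<2*pi} (w$i) = 0" by simp
      then show ?thesis using False prod_zero[of UNIV "\<lambda>i. indicat_real {0..<2*pi} (w$i)"] by auto
    qed
    finally show "\<Psi> (\<Sum>b\<in>Basis. f b *\<^sub>R b) = (\<Prod>b\<in>Basis. indicat_real {0..<2*pi} (f b) *\<^sub>R cis (of_int (q b) * f b))"
      by (simp add: \<Psi>_def cexpk_prod flip: w_def)
  qed
  also have "\<dots> = (\<Prod>b\<in>(Basis :: (real^'d) set). \<integral>x. indicat_real {0..<2*pi} x *\<^sub>R cis (of_int (q b) * x) \<partial>lborel)"
    by (rule product_integral_prod) (auto intro: integral_cis_period)
  also have "\<dots> = (\<Prod>i\<in>UNIV. if k$i = 0 then of_real (2*pi) else 0)"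
    unfolding B prod.reindex[OF inj] integral_cis_period by (simp add: q)
  also have "\<dots> = (if k = 0 then of_real ((2*pi) ^ CARD('d)) else 0)"
    by (auto simp: vec_eq_iff)
  finally show ?thesis .
qed

lemma measure_torus: "measure torus_measure (Td :: (real^'d) set) = (2*pi) ^ CARD('d)"
proof -
  have "cexpk 0 = (\<lambda>x::real^'d. 1)" by auto
  then have "complex_of_real (measure torus_measure (Td :: (real^'d) set)) = of_real ((2*pi) ^ CARD('d))"
    using integral_cexpk[of "0 :: int^'d"] by (simp add: scaleR_conv_of_real)
  then show ?thesis by (simp only: of_real_eq_iff)
qed

lemma fourier_torus:
  "fourier f k = integral\<^sup>L torus_measure (\<lambda>x. f x * cexpk (- k) x) / of_real ((2*pi) ^ CARD('d))"
  for k :: "int^'d"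
proof -
  have "exp (- (\<i> * complex_of_real (ipk k x))) = cexpk (- k) x" for x
    by (simp add: cexpk_def ipk_def sum_negf)
  then show ?thesis by (simp add: fourier_def integral_torus field_simps)
qed

lemma L2norm_torus:
  "(L2norm f)^2 = integral\<^sup>L torus_measure (\<lambda>x. (cmod (f x))^2) / (2*pi) ^ CARD('d)"
  for f :: "real^'d \<Rightarrow> complex"
  unfolding L2norm_def integral_torus
  by (subst real_sqrt_pow2) (auto intro!: divide_nonneg_nonneg integral_nonneg_AE)

lemma torus_parseval:
  fixes S :: "(int^'d) set"
  assumes "finite S"
  shows "(L2norm (\<lambda>x. \<Sum>k\<in>S. c k * cexpk k x))^2 = (\<Sum>k\<in>S. (cmod (c k))^2)"
proof -
  let ?N = "(2*pi) ^ CARD('d)"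
  have cc: "c k * cnj (c k) = (of_real (cmod (c k)))^2" for k
    by (simp add: complex_norm_square flip: of_real_power)
  have "complex_of_real (integral\<^sup>L torus_measure (\<lambda>x. (cmod (\<Sum>k\<in>S. c k * cexpk k x))^2))
      = integral\<^sup>L torus_measure (\<lambda>x. \<Sum>k\<in>S. \<Sum>l\<in>S. c k * cnj (c l) * cexpk (k - l) x)"
    unfolding integral_complex_of_real[symmetric] norm_sum_squared_expand cexpk_mult_cnj ..
  also have "\<dots> = (\<Sum>k\<in>S. \<Sum>l\<in>S. c k * cnj (c l) * integral\<^sup>L torus_measure (cexpk (k - l)))"
    by (simp add: Bochner_Integration.integral_sum integrable_torus continuous_intros)
  also have "\<dots> = (\<Sum>k\<in>S. \<Sum>l\<in>S. if k = l then of_real ((cmod (c k))^2 * ?N) else 0)"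
    by (intro sum.cong refl) (auto simp: integral_cexpk cc)
  also have "\<dots> = of_real ((\<Sum>k\<in>S. (cmod (c k))^2) * ?N)"
    using assms by (simp add: sum_distrib_right)
  finally have "integral\<^sup>L torus_measure (\<lambda>x. (cmod (\<Sum>k\<in>S. c k * cexpk k x))^2) = (\<Sum>k\<in>S. (cmod (c k))^2) * ?N"
    by (simp only: of_real_eq_iff)
  then show ?thesis by (simp add: L2norm_torus)
qed

lemma L2norm_le_sup:
  fixes f :: "real^'d \<Rightarrow> complex"
  assumes "continuous_on UNIV f" "\<And>x. x \<in> Td \<Longrightarrow> cmod (f x) \<le> T"
  shows "(L2norm f)^2 \<le> T^2"
proof -
  interpret finite_measure "torus_measure :: (real^'d) measure" by (rule finite_measure_torus)
  have "integral\<^sup>L torus_measure (\<lambda>x. (cmod (f x))^2) \<le> integral\<^sup>L torus_measure (\<lambda>x::real^'d. T^2)"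
    using assms by (intro integral_mono integrable_torus continuous_intros power_mono) auto
  also have "\<dots> = (2*pi) ^ CARD('d) * T^2" by (simp add: measure_torus)
  finally show ?thesis by (simp add: L2norm_torus field_simps)
qed

lemma L2norm_add3:
  fixes f g h :: "real^'d \<Rightarrow> complex"
  assumes "continuous_on UNIV f" "continuous_on UNIV g" "continuous_on UNIV h"
  shows "(L2norm (\<lambda>x. f x + g x + h x))^2 \<le> 3 * ((L2norm f)^2 + (L2norm g)^2 + (L2norm h)^2)"
proof -
  have "(cmod (a + b + c))^2 \<le> 3 * (cmod a)^2 + 3 * (cmod b)^2 + 3 * (cmod c)^2" for a b c
  proof -
    have "(cmod (a + b + c))^2 \<le> (cmod a + cmod b + cmod c)^2"
      by (intro power_mono order_trans[OF norm_triangle_ineq] add_right_mono norm_triangle_ineq) auto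
    also have "\<dots> \<le> 3 * (cmod a)^2 + 3 * (cmod b)^2 + 3 * (cmod c)^2"
      using sum_squares_bound[of "cmod a" "cmod b"] sum_squares_bound[of "cmod a" "cmod c"]
        sum_squares_bound[of "cmod b" "cmod c"] by (simp add: power2_eq_square algebra_simps)
    finally show ?thesis .
  qed
  then have "integral\<^sup>L torus_measure (\<lambda>x. (cmod (f x + g x + h x))^2)
      \<le> integral\<^sup>L torus_measure (\<lambda>x. 3 * (cmod (f x))^2 + 3 * (cmod (g x))^2 + 3 * (cmod (h x))^2)"
    using assms by (intro integral_mono integrable_torus continuous_intros)
  also have "\<dots> = 3 * integral\<^sup>L torus_measure (\<lambda>x. (cmod (f x))^2)
      + 3 * integral\<^sup>L torus_measure (\<lambda>x. (cmod (g x))^2) + 3 * integral\<^sup>L torus_measure (\<lambda>x. (cmod (h x))^2)"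
    using assms by (simp add: integrable_torus continuous_intros)
  finally show ?thesis by (simp add: L2norm_torus field_simps)
qed

section \<open>Uniqueness of Fourier coefficients and summation by dyadic blocks\<close>

lemma cexpk_axis: "cexpk (axis i q) x = cis (of_int q * x$i)"
proof -
  have "of_int (axis i q $ j) * x$j = (if j = i then of_int q * x$i else 0)" for j
    by (auto simp: axis_def)
  then have "ipk (axis i q) x = of_int q * x$i" by (simp add: ipk_def)
  then show ?thesis by (simp add: cexpk_def cis_conv_exp)
qed

text \<open>Each cosine is a combination of two exponentials, so multiplying by \<open>q\<close>
  only shifts the frequency by unit vectors. Vanishing at all frequencies therefore passes from one
  power of \<open>q\<close> to the next, with \<open>k\<close> arbitrary in the induction.\<close>

lemma fourier_kernel_vanishing:
  fixes h :: "real^'d \<Rightarrow> complex" and x0 :: "real^'d" and \<kappa> :: real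
  assumes h: "continuous_on UNIV h" and zero: "\<And>k. integral\<^sup>L torus_measure (\<lambda>x. h x * cexpk k x) = 0"
  defines "q \<equiv> \<lambda>x. (\<Sum>i\<in>UNIV. cos (x$i - x0$i)) / real CARD('d) + \<kappa>"
  shows "integral\<^sup>L torus_measure (\<lambda>x. h x * cexpk k x * of_real (q x ^ n)) = 0"
proof (induction n arbitrary: k)
  case 0 then show ?case using zero by simp
next
  case (Suc n)
  have q_cont: "continuous_on UNIV q" unfolding q_def by (intro continuous_intros) auto
  define u where "u k x = h x * cexpk k x * of_real (q x ^ n)" for k x
  have int: "integrable torus_measure (u k)" for k
    unfolding u_def by (intro integrable_torus continuous_intros h q_cont)
  have u0: "integral\<^sup>L torus_measure (u k) = 0" for k using Suc.IH unfolding u_def .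
  define \<alpha> where "\<alpha> i = cis (- x0$i) / of_real (2 * real CARD('d))" for i
  have cos_split: "of_real (cos (x$i - x0$i)) / of_real (real CARD('d))
      = \<alpha> i * cexpk (axis i 1) x + cnj (\<alpha> i) * cexpk (axis i (-1)) x" for i x
    by (simp add: \<alpha>_def cexpk_axis complex_eq_iff cos_diff field_simps)
  have "h x * cexpk k x * of_real (q x ^ Suc n)
     = of_real \<kappa> * u k x + (\<Sum>i\<in>UNIV. \<alpha> i * u (k + axis i 1) x + cnj (\<alpha> i) * u (k + axis i (-1)) x)" for x
  proof -
    have "of_real (q x) = (\<Sum>i\<in>UNIV. \<alpha> i * cexpk (axis i 1) x + cnj (\<alpha> i) * cexpk (axis i (-1)) x) + of_real \<kappa>"
      unfolding cos_split[symmetric] q_def by (simp add: sum_divide_distrib)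
    moreover have "h x * cexpk k x * of_real (q x ^ Suc n) = u k x * of_real (q x)"
      by (simp add: u_def)
    moreover have "u (k + l) x = u k x * cexpk l x" for l by (simp add: u_def cexpk_add)
    ultimately show ?thesis by (simp add: distrib_left sum_distrib_left mult_ac)
  qed
  then show ?case by (simp add: int u0)
qed

text \<open>
  The trigonometric polynomial \<open>q\<close> below exceeds 1 near \<open>x0\<close> and is at most 1 in absolute
  value away from it, so integrating \<open>h\<close> against its even powers blows up if \<open>Re (h x0) > 0\<close>.
\<close>

lemma fourier_uniqueness_interior:
  fixes h :: "real^'d \<Rightarrow> complex"
  assumes h: "continuous_on UNIV h" and zero: "\<And>k. integral\<^sup>L torus_measure (\<lambda>x. h x * cexpk k x) = 0"
    and x0: "x0 \<in> box 0 (\<chi> i. 2*pi)"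
  shows "Re (h x0) \<le> 0"
proof (rule ccontr)
  assume neg: "\<not> Re (h x0) \<le> 0"
  define \<delta> where "\<delta> = Re (h x0) / 2"
  have \<delta>: "0 < \<delta>" using neg by (simp add: \<delta>_def)
  interpret finite_measure "torus_measure :: (real^'d) measure" by (rule finite_measure_torus)
  let ?O = "box 0 (\<chi> i. 2*pi) :: (real^'d) set"
  have "open ({x. \<delta> < Re (h x)} \<inter> ?O)"
    by (intro open_Int open_box open_Collect_less continuous_intros h)
  moreover have "x0 \<in> {x. \<delta> < Re (h x)} \<inter> ?O" using x0 \<delta> by (simp add: \<delta>_def)
  ultimately obtain \<epsilon> where \<epsilon>: "0 < \<epsilon>" "ball x0 \<epsilon> \<subseteq> {x. \<delta> < Re (h x)} \<inter> ?O"
    using open_contains_ball by blast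
  \<comment> \<open>Small enough for the cube of half-side \<open>r\<close> around \<open>x0\<close>
    to lie in the ball, and below pi so that the cosine is monotone where it is compared.\<close>
  define r where "r = min (\<epsilon> / real CARD('d)) pi / 2"
  have r: "0 < r" "r < pi" "real CARD('d) * r < \<epsilon>"
    using \<epsilon>(1) by (auto simp: r_def min_def field_simps)
  have near: "x \<in> ball x0 \<epsilon>" if "\<And>i. \<bar>x$i - x0$i\<bar> \<le> r" for x
  proof -
    have "norm (x - x0) \<le> (\<Sum>i\<in>UNIV. \<bar>(x - x0)$i\<bar>)" by (rule norm_le_l1_cart)
    also have "\<dots> \<le> (\<Sum>i\<in>(UNIV::'d set). r)" using that by (intro sum_mono) simp
    finally show ?thesis using r(3) by (simp add: dist_norm norm_minus_commute)
  qed
  \<comment> \<open>The cosine peaks again at distance 2 pi. As \<open>x0\<close> stays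
    \<open>r\<close> away from all faces, coordinate differences are at most 2 pi - r, which
    excludes that peak.\<close>
  have edge: "r \<le> x0$i \<and> x0$i \<le> 2*pi - r" for i
  proof -
    have "x0 + s *\<^sub>R axis i 1 \<in> ?O" if "\<bar>s\<bar> \<le> r" for s
      using near[of "x0 + s *\<^sub>R axis i 1"] that r(1) \<epsilon>(2) by (auto simp: axis_def)
    then have "0 < (x0 + s *\<^sub>R axis i 1)$i \<and> (x0 + s *\<^sub>R axis i 1)$i < 2*pi" if "\<bar>s\<bar> \<le> r" for s
      using \<open>\<And>s. \<bar>s\<bar> \<le> r \<Longrightarrow> x0 + s *\<^sub>R axis i 1 \<in> ?O\<close>[OF that] unfolding mem_box_cart
      by (auto dest: spec[of _ i])
    from this[of r] this[of "-r"] show ?thesis using r(1) by (simp add: axis_def)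
  qed
  \<comment> \<open>Outside the cube some coordinate costs 1 - cos r, so the mean of the cosines is
    at most 1 - 2 \<kappa> there. Adding \<kappa> splits the gap: \<open>q\<close> lies between -1 +
    \<kappa> and 1 - \<kappa> off the cube and equals 1 + \<kappa> at \<open>x0\<close>.\<close>
  define \<kappa> where "\<kappa> = (1 - cos r) / (2 * real CARD('d))"
  have "cos r < cos 0" using r by (intro cos_monotone_0_pi) auto
  then have cr: "0 < 1 - cos r" by simp
  then have \<kappa>: "0 < \<kappa>" by (simp add: \<kappa>_def)
  define q where "q x = (\<Sum>i\<in>UNIV. cos (x$i - x0$i)) / real CARD('d) + \<kappa>" for x :: "real^'d"
  have q_cont: "continuous_on UNIV q" unfolding q_def by (intro continuous_intros) auto
  have far: "\<bar>q x\<bar> \<le> 1" if x: "x \<in> Td" and i: "r < \<bar>x$i - x0$i\<bar>" for x i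
  proof -
    have "0 \<le> x$i" "x$i < 2*pi" using x by (auto simp: Td_def)
    then have "\<bar>x$i - x0$i\<bar> \<le> 2*pi - r" using edge[of i] by linarith
    have "cos \<bar>x$i - x0$i\<bar> \<le> cos r"
    proof (cases "\<bar>x$i - x0$i\<bar> \<le> pi")
      case True then show ?thesis using i r by (intro cos_monotone_0_pi_le) auto
    next
      case False
      have "cos (2*pi - \<bar>x$i - x0$i\<bar>) \<le> cos r"
        using False \<open>\<bar>x$i - x0$i\<bar> \<le> 2*pi - r\<close> r by (intro cos_monotone_0_pi_le) auto
      then show ?thesis by (simp add: cos_diff)
    qed
    then have ci: "cos (x$i - x0$i) \<le> cos r" by simp
    have "(\<Sum>j\<in>UNIV. cos (x$j - x0$j)) = cos (x$i - x0$i) + (\<Sum>j\<in>UNIV - {i}. cos (x$j - x0$j))"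
      by (simp add: sum.remove)
    also have "\<dots> \<le> cos r + (\<Sum>j\<in>UNIV - {i}. 1)" using ci by (intro add_mono sum_mono) auto
    also have "\<dots> = real CARD('d) - 2 * real CARD('d) * \<kappa>" by (simp add: \<kappa>_def card_Diff_singleton of_nat_diff)
    finally have up: "(\<Sum>j\<in>UNIV. cos (x$j - x0$j)) / real CARD('d) \<le> 1 - 2 * \<kappa>" by (simp add: field_simps)
    have "(\<Sum>j\<in>(UNIV::'d set). -1) \<le> (\<Sum>j\<in>UNIV. cos (x$j - x0$j))" by (intro sum_mono) auto
    then have "- 1 \<le> (\<Sum>j\<in>UNIV. cos (x$j - x0$j)) / real CARD('d)" by (simp add: field_simps)
    then show ?thesis using up \<kappa> by (simp add: q_def abs_le_iff)
  qed
  define V where "V = {x. 1 + \<kappa>/2 < q x} \<inter> ball x0 \<epsilon>"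
  have "open V" unfolding V_def by (intro open_Int open_ball open_Collect_less continuous_intros q_cont)
  moreover have "x0 \<in> V" using \<epsilon>(1) \<kappa> by (simp add: V_def q_def)
  moreover have VO: "V \<subseteq> Td"
    using \<epsilon>(2) by (auto simp: V_def Td_def mem_box_cart subset_eq less_imp_le)
  ultimately obtain \<epsilon>' where \<epsilon>': "0 < \<epsilon>'" "ball x0 \<epsilon>' \<subseteq> V" using open_contains_ball by metis
  define W where "W = ball x0 \<epsilon>'"
  define \<mu> where "\<mu> = measure torus_measure W"
  have WTd: "W \<subseteq> Td" using \<epsilon>'(2) VO by (auto simp: W_def)
  have "\<mu> = measure lborel W" unfolding \<mu>_def by (rule measure_restrict_space) (use WTd in auto)
  then have \<mu>: "0 < \<mu>" using content_ball_pos[OF \<epsilon>'(1), of x0] by (simp add: W_def)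
  have WB: "W \<in> sets torus_measure"
    unfolding W_def sets_restrict_space using WTd W_def by (auto simp: image_iff intro!: bexI[of _ W])
  obtain B where B: "0 \<le> B" "\<And>x. x \<in> Td \<Longrightarrow> cmod (h x) \<le> B"
    using continuous_bounded_on_Td[OF h] by metis
  have bound: "\<delta> * (1 + \<kappa>/2) ^ (2*n) * \<mu> \<le> B * (2*pi) ^ CARD('d)" for n
  proof -
    define G where "G x = Re (h x) * q x ^ (2*n)" for x
    have Gint: "integrable torus_measure G"
      unfolding G_def by (intro integrable_torus continuous_intros h q_cont)
    have Wint: "integrable torus_measure (\<lambda>x. \<delta> * (1 + \<kappa>/2) ^ (2*n) * indicat_real W x)"
      using WB by (intro integrable_mult_right integrable_real_indicator) (auto simp: less_top[symmetric])
    have z: "integral\<^sup>L torus_measure (\<lambda>x. h x * cexpk 0 x * of_real (q x ^ (2*n))) = 0"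
      unfolding q_def by (rule fourier_kernel_vanishing[OF h zero])
    have "integrable torus_measure (\<lambda>x. h x * cexpk 0 x * of_real (q x ^ (2*n)))"
      by (intro integrable_torus continuous_intros h q_cont)
    from integral_Re[OF this]
    have "integral\<^sup>L torus_measure (\<lambda>x. Re (h x * cexpk 0 x * of_real (q x ^ (2*n)))) = 0"
      unfolding z by (simp only: complex.sel zero_complex.sel)
    moreover have "Re (h x * cexpk 0 x * of_real (q x ^ (2*n))) = G x" for x
      unfolding G_def by (simp del: of_real_power)
    ultimately have G0: "integral\<^sup>L torus_measure G = 0" by simp
    \<comment> \<open>Even powers are nonnegative, so inside the ball only \<open>W\<close> has to
      be counted, where \<open>q\<close> exceeds 1 + \<kappa>/2; outside the ball the subtracted
      \<open>B\<close> covers the loss.\<close>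
    have "integral\<^sup>L torus_measure (\<lambda>x. \<delta> * (1 + \<kappa>/2) ^ (2*n) * indicat_real W x - B) \<le> integral\<^sup>L torus_measure G"
    proof (rule integral_mono)
      show "integrable torus_measure (\<lambda>x. \<delta> * (1 + \<kappa>/2) ^ (2*n) * indicat_real W x - B)" using Wint by simp
      fix x :: "real^'d" assume "x \<in> space torus_measure"
      then have x: "x \<in> Td" by simp
      show "\<delta> * (1 + \<kappa>/2) ^ (2*n) * indicat_real W x - B \<le> G x"
      proof (cases "x \<in> ball x0 \<epsilon>")
        case True
        then have Re: "\<delta> < Re (h x)" using \<epsilon>(2) by auto
        have "\<delta> * ((1 + \<kappa>/2) ^ (2*n) * indicat_real W x) \<le> Re (h x) * q x ^ (2*n)"
        proof (intro mult_mono)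
          show "(1 + \<kappa>/2) ^ (2*n) * indicat_real W x \<le> q x ^ (2*n)"
          proof (cases "x \<in> W")
            case True
            then have "1 + \<kappa>/2 \<le> q x" using \<epsilon>'(2) by (auto simp: W_def V_def less_imp_le)
            then show ?thesis using \<kappa> by (simp add: indicator_def power_mono)
          qed simp
        qed (use Re \<delta> \<kappa> in auto)
        then show ?thesis using B(1) by (simp add: G_def)
      next
        case False
        then obtain i where "r < \<bar>x$i - x0$i\<bar>" using near[of x] by (metis not_le)
        then have "\<bar>q x\<bar> ^ (2*n) \<le> 1" using far[OF x] by (intro power_le_one) auto
        then have "\<bar>G x\<bar> \<le> B * 1"
          unfolding G_def abs_mult power_abs using abs_Re_le_cmod[of "h x"] B(2)[OF x] by (intro mult_mono) auto
        moreover have "x \<notin> W" using False \<epsilon>'(2) by (auto simp: W_def V_def)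
        ultimately show ?thesis by simp
      qed
    qed (rule Gint)
    moreover have "integral\<^sup>L torus_measure (\<lambda>x. \<delta> * (1 + \<kappa>/2) ^ (2*n) * indicat_real W x - B)
        = \<delta> * (1 + \<kappa>/2) ^ (2*n) * \<mu> - B * (2*pi) ^ CARD('d)"
      using Wint WTd by (simp add: measure_torus \<mu>_def Int_absorb2)
    ultimately show ?thesis using G0 by simp
  qed
  obtain n where n: "B * (2*pi) ^ CARD('d) / (\<delta> * \<mu>) < (1 + \<kappa>/2) ^ n"
    using real_arch_pow[of "1 + \<kappa>/2"] \<kappa> by auto
  also have "(1 + \<kappa>/2) ^ n \<le> (1 + \<kappa>/2) ^ (2*n)" using \<kappa> by (intro power_increasing) auto
  finally have "B * (2*pi) ^ CARD('d) < \<delta> * (1 + \<kappa>/2) ^ (2*n) * \<mu>"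
    using \<delta> \<mu> by (simp add: pos_divide_less_eq mult_ac)
  then show False using bound[of n] by simp
qed

text \<open>The interior bound concerns real parts only; applied to cnj (h y) * h at the point
  \<open>y\<close> it gives |h y|^2 <= 0. Continuity carries the result to the faces that belong to
  \<open>Td\<close>.\<close>

lemma fourier_uniqueness:
  fixes h :: "real^'d \<Rightarrow> complex"
  assumes h: "continuous_on UNIV h" and zero: "\<And>k. fourier h k = 0" and x: "x \<in> Td"
  shows "h x = 0"
proof -
  let ?O = "box 0 (\<chi> i. 2*pi) :: (real^'d) set"
  have zero': "integral\<^sup>L torus_measure (\<lambda>x. h x * cexpk k x) = 0" for k
    using zero[of "- k"] by (simp add: fourier_torus)
  have O: "h y = 0" if y: "y \<in> ?O" for y
  proof -
    have "Re (cnj (h y) * h y) \<le> 0"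
    proof (rule fourier_uniqueness_interior[where h = "\<lambda>x. cnj (h y) * h x", OF _ _ y])
      show "continuous_on UNIV (\<lambda>x. cnj (h y) * h x)" by (intro continuous_intros h)
      show "integral\<^sup>L torus_measure (\<lambda>x. cnj (h y) * h x * cexpk k x) = 0" for k
        using zero' by (simp add: mult.assoc)
    qed
    then have "(Re (h y))^2 + (Im (h y))^2 \<le> 0" by (simp add: power2_eq_square)
    then show ?thesis by (simp add: sum_power2_le_zero_iff complex_eq_iff)
  qed
  have "(\<chi> i. pi) \<in> ?O" by (simp add: mem_box_cart)
  then have "closure ?O = cbox 0 (\<chi> i. 2*pi)" by (intro closure_box) auto
  moreover have "x \<in> cbox 0 (\<chi> i. 2*pi)" using x Td_subset_cbox by blast
  ultimately have "x \<in> closure ?O" by simp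
  then show ?thesis
    by (rule continuous_constant_on_closure[OF continuous_on_subset[OF h] O, rotated -1]) auto
qed

text \<open>The function f_j of the class definition; \<open>blockA\<close> is its A-norm.\<close>

definition block_sum :: "(real^'d \<Rightarrow> complex) \<Rightarrow> nat \<Rightarrow> real^'d \<Rightarrow> complex" where
  "block_sum f j x = (\<Sum>k\<in>hblock j. fourier f k * cexpk k x)"

lemma norm_block_sum: "cmod (block_sum f j x) \<le> blockA f j"
  unfolding block_sum_def blockA_def hblock_def[symmetric]
  by (rule order_trans[OF norm_sum]) (simp add: norm_mult)

lemma continuous_on_block_sum: "continuous_on A (block_sum f j)"
  unfolding block_sum_def by (intro continuous_intros)

text \<open>By the Weierstrass test the block series has a continuous sum \<open>S\<close>; termwise
  integration shows that \<open>S\<close> has the coefficients of \<open>f\<close>, and uniqueness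
  identifies the two. The equality is pointwise because \<open>f\<close> is evaluated at sample
  points.\<close>

lemma fourier_series_sums:
  fixes f :: "real^'d \<Rightarrow> complex"
  assumes f: "continuous_on UNIV f" and sm: "summable (blockA f)" and x: "x \<in> Td"
  shows "(\<lambda>j. block_sum f j x) sums f x"
proof -
  interpret finite_measure "torus_measure :: (real^'d) measure" by (rule finite_measure_torus)
  let ?N = "(2*pi) ^ CARD('d)"
  define S where "S x = (\<Sum>j. block_sum f j x)" for x
  have sums: "(\<lambda>j. block_sum f j x) sums S x" for x
    unfolding S_def by (rule summable_sums, rule summable_norm_cancel, rule summable_comparison_test'[OF sm])
      (simp add: norm_block_sum)
  have "uniform_limit UNIV (\<lambda>n x. \<Sum>j<n. block_sum f j x) S sequentially"
    unfolding S_def by (rule Weierstrass_m_test[OF _ sm]) (simp add: norm_block_sum)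
  then have S_cont: "continuous_on UNIV S"
    by (rule uniform_limit_theorem[rotated])
       (auto intro!: always_eventually continuous_on_sum continuous_on_block_sum)
  have FS: "fourier S k = fourier f k" for k
  proof -
    obtain j0 where j0: "k \<in> hblock j0" using hblock_exists by blast
    have coeff: "integral\<^sup>L torus_measure (\<lambda>x. block_sum f j x * cexpk (- k) x)
        = (if j = j0 then fourier f k * of_real ?N else 0)" for j
    proof -
      have "integral\<^sup>L torus_measure (\<lambda>x. block_sum f j x * cexpk (- k) x)
          = integral\<^sup>L torus_measure (\<lambda>x. \<Sum>l\<in>hblock j. fourier f l * cexpk (l - k) x)"
        unfolding block_sum_def sum_distrib_right
        by (simp add: mult.assoc cexpk_add[symmetric])
      also have "\<dots> = (\<Sum>l\<in>hblock j. fourier f l * integral\<^sup>L torus_measure (cexpk (l - k)))"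
        by (simp add: integrable_torus continuous_intros)
      also have "\<dots> = (\<Sum>l\<in>hblock j. if l = k then fourier f k * of_real ?N else 0)"
        by (intro sum.cong refl) (auto simp: integral_cexpk)
      also have "\<dots> = (if k \<in> hblock j then fourier f k * of_real ?N else 0)"
        by (simp add: finite_hblock)
      also have "k \<in> hblock j \<longleftrightarrow> j = j0" using j0 hblock_unique by blast
      finally show ?thesis .
    qed
    have "(\<lambda>j. integral\<^sup>L torus_measure (\<lambda>x. block_sum f j x * cexpk (- k) x))
       sums (\<integral>x. (\<Sum>j. block_sum f j x * cexpk (- k) x) \<partial>torus_measure)"
    proof (rule sums_integral)
      show "integrable torus_measure (\<lambda>x. block_sum f j x * cexpk (- k) x)" for j
        by (intro integrable_torus continuous_intros continuous_on_block_sum)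
      show "AE x in torus_measure. summable (\<lambda>j. norm (block_sum f j x * cexpk (- k) x))"
        by (intro AE_I2 summable_comparison_test'[OF sm]) (simp add: norm_mult norm_block_sum)
      show "summable (\<lambda>j. \<integral>x. norm (block_sum f j x * cexpk (- k) x) \<partial>torus_measure)"
      proof (rule summable_comparison_test'[OF summable_mult[OF sm, of ?N]])
        fix j
        have "(\<integral>x. norm (block_sum f j x * cexpk (- k) x) \<partial>torus_measure) \<le> (\<integral>x. blockA f j \<partial>(torus_measure :: (real^'d) measure))"
          by (intro integral_mono integrable_torus continuous_intros continuous_on_block_sum)
             (simp add: norm_mult norm_block_sum)
        then show "norm (\<integral>x. norm (block_sum f j x * cexpk (- k) x) \<partial>torus_measure) \<le> ?N * blockA f j"
          by (simp add: measure_torus integral_nonneg_AE)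
      qed
    qed
    moreover have "(\<Sum>j. block_sum f j x * cexpk (- k) x) = S x * cexpk (- k) x" for x
      using sums_mult2[OF sums] by (simp add: sums_iff)
    moreover have "(\<lambda>j. if j = j0 then fourier f k * of_real ?N else 0) sums (fourier f k * of_real ?N)"
      by (rule sums_single)
    ultimately have "(\<integral>x. S x * cexpk (- k) x \<partial>torus_measure) = fourier f k * of_real ?N"
      unfolding coeff by (simp add: sums_unique2)
    then show ?thesis by (simp add: fourier_torus[of S])
  qed
  have "f x - S x = 0"
  proof (rule fourier_uniqueness[where h = "\<lambda>x. f x - S x", OF _ _ x])
    show "continuous_on UNIV (\<lambda>x. f x - S x)" by (intro continuous_intros f S_cont)
    have "integral\<^sup>L torus_measure (\<lambda>x. (f x - S x) * cexpk (- k) x)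
        = integral\<^sup>L torus_measure (\<lambda>x. f x * cexpk (- k) x) - integral\<^sup>L torus_measure (\<lambda>x. S x * cexpk (- k) x)" for k
      unfolding left_diff_distrib by (intro Bochner_Integration.integral_diff integrable_torus continuous_intros f S_cont)
    then show "fourier (\<lambda>x. f x - S x) k = 0" for k
      using FS[of k] unfolding fourier_torus by (simp add: diff_divide_distrib)
  qed
  then show ?thesis using sums by simp
qed

subsection \<open>Least squares on a subspace of frequencies\<close>

text \<open>Injectivity lets \<open>v\<close> frequencies count as \<open>v\<close> elements of
  \<open>Phi\<close>, as \<open>Xv\<close> demands. If two exponentials agreed, the one with
  frequency \<open>k - l\<close> would be constantly 1, with nonzero integral.\<close>

lemma cexpk_eq_iff: "cexpk k = cexpk l \<longleftrightarrow> k = l" for k l :: "int^'d"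
proof
  assume eq: "cexpk k = cexpk l"
  have "cexpk (k - l) = (\<lambda>x. 1)"
    using eq by (auto simp flip: cexpk_mult_cnj simp: complex_norm_square[symmetric])
  then have "integral\<^sup>L torus_measure (cexpk (k - l)) \<noteq> 0"
    by (simp add: measure_torus scaleR_conv_of_real)
  then show "k = l" by (auto simp: integral_cexpk split: if_splits)
qed simp

lemma spanc_cexpk: "spanc (cexpk ` S) = {(\<lambda>x. \<Sum>k\<in>S. d k * cexpk k x) | d. True}" for S :: "(int^'d) set"
proof -
  have inj: "inj_on cexpk S" by (auto simp: inj_on_def cexpk_eq_iff)
  have "\<exists>e. (\<lambda>x. \<Sum>k\<in>S. d k * cexpk k x) = (\<lambda>x. \<Sum>\<phi>\<in>cexpk ` S. e \<phi> * \<phi> x)" for d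
    by (intro exI[of _ "d \<circ> the_inv_into S cexpk"])
       (auto simp: sum.reindex[OF inj] the_inv_into_f_f[OF inj])
  moreover have "\<exists>d. (\<lambda>x. \<Sum>\<phi>\<in>cexpk ` S. e \<phi> * \<phi> x) = (\<lambda>x. \<Sum>k\<in>S. d k * cexpk k x)" for e :: "_ \<Rightarrow> complex"
    by (intro exI[of _ "\<lambda>k. e (cexpk k)"]) (auto simp: sum.reindex[OF inj])
  ultimately show ?thesis unfolding spanc_def by auto
qed

section \<open>Greedy decomposition and the least squares error\<close>

lemma largest_elements_exist:
  fixes w :: "'a \<Rightarrow> real"
  assumes "finite F" "n \<le> card F"
  shows "\<exists>U\<subseteq>F. card U = n \<and> (\<forall>k\<in>U. \<forall>l\<in>F - U. w l \<le> w k)"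
  using assms(2)
proof (induction n)
  case 0 then show ?case by (intro exI[of _ "{}"]) auto
next
  case (Suc n)
  then obtain U where U: "U \<subseteq> F" "card U = n" "\<forall>k\<in>U. \<forall>l\<in>F - U. w l \<le> w k" by auto
  have "card (F - U) = card F - n" using U assms(1) by (simp add: card_Diff_subset finite_subset)
  then have ne: "F - U \<noteq> {}" using Suc.prems by (metis Suc_diff_le Suc_eq_plus1 card.empty diff_is_0_eq not_less_eq_eq)
  have fin: "finite (F - U)" using assms(1) by simp
  have "Max (w ` (F - U)) \<in> w ` (F - U)" using fin ne by (intro Max_in) auto
  then obtain x where x: "x \<in> F - U" "w x = Max (w ` (F - U))" by (metis imageE)
  then have "\<forall>l\<in>F - U. w l \<le> w x" using fin by simp
  note x = x(1) this
  show ?case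
    using U x assms(1) by (intro exI[of _ "insert x U"]) (auto simp: finite_subset card_insert_if)
qed

lemma average_bound:
  fixes w :: "'a \<Rightarrow> real"
  assumes "card U = n" "0 < n" "\<And>k. k \<in> U \<Longrightarrow> s \<le> w k"
  shows "s \<le> sum w U / real n"
proof -
  have "real n * s = (\<Sum>k\<in>U. s)" using assms(1) by simp
  also have "\<dots> \<le> sum w U" using assms(3) by (intro sum_mono)
  finally show ?thesis using assms(2) by (simp add: field_simps)
qed

text \<open>Remove the \<open>v\<close> largest weights \<open>U\<close>. They cost \<kappa> t, and
  all remaining weights are at most the mean of \<open>w\<close> over \<open>U\<close>, which serves
  as the next \<open>t\<close>. Summed over the steps, these means account for sum w F / v: this is
  how 1/v is gained against the l1 norm.\<close>

lemma peeling:
  fixes N :: "'a set \<Rightarrow> real" and w :: "'a \<Rightarrow> real"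
  assumes sub: "\<And>A B. A \<union> B \<subseteq> \<Lambda> \<Longrightarrow> A \<inter> B = {} \<Longrightarrow> N (A \<union> B) \<le> N A + N B"
    and small: "\<And>T s. T \<subseteq> \<Lambda> \<Longrightarrow> card T \<le> v \<Longrightarrow> 0 \<le> s \<Longrightarrow> (\<And>k. k \<in> T \<Longrightarrow> w k \<le> s) \<Longrightarrow> N T \<le> \<kappa> * s"
    and v: "0 < v" and \<kappa>: "0 \<le> \<kappa>" and \<Lambda>: "finite \<Lambda>" and w: "\<And>k. 0 \<le> w k"
  shows "F \<subseteq> \<Lambda> \<Longrightarrow> 0 \<le> t \<Longrightarrow> (\<And>k. k \<in> F \<Longrightarrow> w k \<le> t) \<Longrightarrow> N F \<le> \<kappa> * (t + sum w F / real v)"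
proof (induction "card F" arbitrary: F t rule: less_induct)
  case less
  have finF: "finite F" using less.prems(1) \<Lambda> finite_subset by blast
  show ?case
  proof (cases "card F \<le> v")
    case True
    have "N F \<le> \<kappa> * t" using small[OF less.prems(1) True] less.prems by auto
    also have "\<dots> \<le> \<kappa> * (t + sum w F / real v)" using \<kappa> w by (intro mult_left_mono) (auto intro!: sum_nonneg divide_nonneg_nonneg)
    finally show ?thesis .
  next
    case False
    then obtain U where U: "U \<subseteq> F" "card U = v" "\<forall>k\<in>U. \<forall>l\<in>F - U. w l \<le> w k"
      using largest_elements_exist[OF finF, of v w] by auto
    have "card (F - U) < card F" using U v finF False by (simp add: card_Diff_subset finite_subset)
    moreover have "w l \<le> sum w U / real v" if "l \<in> F - U" for l
      using average_bound[OF U(2) v, of "w l" w] U(3) that by auto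
    moreover have "0 \<le> sum w U / real v" using w by (auto intro!: divide_nonneg_nonneg sum_nonneg)
    ultimately have "N (F - U) \<le> \<kappa> * (sum w U / real v + sum w (F - U) / real v)"
      using less.prems(1) by (intro less.hyps) auto
    moreover have "N U \<le> \<kappa> * t"
      by (rule small) (use U less.prems in auto)
    moreover have "N F \<le> N U + N (F - U)"
      using sub[of U "F - U"] U(1) less.prems(1) by (simp add: Un_absorb1)
    moreover have "sum w F = sum w U + sum w (F - U)" using sum.subset_diff[OF U(1) finF, of w] by simp
    ultimately show ?thesis by (simp add: algebra_simps add_divide_distrib)
  qed
qed

lemma norm_add_squared_le: "(norm (x + y))^2 \<le> 2 * (norm x)^2 + 2 * (norm y)^2"
  for x y :: "'a::real_normed_vector"
proof -
  have "(norm (x + y))^2 \<le> (norm x + norm y)^2" by (intro power_mono norm_triangle_ineq) auto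
  also have "\<dots> \<le> 2 * (norm x)^2 + 2 * (norm y)^2"
    using sum_squares_bound[of "norm x" "norm y"] by (simp add: power2_sum)
  finally show ?thesis .
qed

text \<open>\<open>P\<close> takes at most half of the \<open>v\<close> places, the largest other
  coefficients take the rest. The minimiser \<open>u\<close> and the partial sum \<open>g\<close>
  lie in the same span, so the lower sampling inequality turns their empirical distance, controlled
  through minimality by the empirical error of \<open>g\<close>, into an L2 distance. The bound
  \<open>T\<close> is in the sup norm because it must serve at the sample points as well as in
  L2.\<close>

lemma least_squares_error:
  fixes f :: "real^'d \<Rightarrow> complex" and \<Lambda> P :: "(int^'d) set" and \<xi> :: "nat \<Rightarrow> real^'d"
  assumes f: "continuous_on UNIV f" and \<Lambda>: "finite \<Lambda>" "v \<le> card \<Lambda>" and v: "0 < v" and m: "0 < m"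
    and T: "\<And>x. x \<in> Td \<Longrightarrow> cmod (f x - (\<Sum>k\<in>\<Lambda>. c k * cexpk k x)) \<le> T"
    and P: "P \<subseteq> \<Lambda>" "2 * card P \<le> v" and A: "(\<Sum>k\<in>\<Lambda> - P. cmod (c k)) \<le> A"
    and \<xi>: "\<And>j. \<xi> j \<in> Td"
    and samp: "\<And>S c. S \<subseteq> \<Lambda> \<Longrightarrow> card S \<le> v \<Longrightarrow>
      (\<Sum>j<m. (cmod (\<Sum>k\<in>S. c k * cexpk k (\<xi> j)))^2) / real m \<le> 33 * (\<Sum>k\<in>S. (cmod (c k))^2) \<and>
      (\<Sum>k\<in>S. (cmod (c k))^2) \<le> 64 * ((\<Sum>j<m. (cmod (\<Sum>k\<in>S. c k * cexpk k (\<xi> j)))^2) / real m)"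
  shows "\<exists>L\<in>Xv v (Phi \<Lambda>). \<forall>u\<in>LSset m \<xi> L f. (L2norm (\<lambda>x. f x - u x))^2 \<le> 500000 * (T^2 + A^2 / real v)"
proof -
  define w where "w k = cmod (c k)" for k
  define F where "F = \<Lambda> - P"
  have finF: "finite F" and finP: "finite P" using \<Lambda> P finite_subset by (auto simp: F_def)
  define n where "n = v - card P"
  have n: "0 < n" "real v \<le> 2 * real n" "n + card P = v" using P(2) v by (auto simp: n_def)
  have "n \<le> card F" using \<Lambda> P finP by (simp add: F_def n_def card_Diff_subset)
  then obtain U where U: "U \<subseteq> F" "card U = n" "\<forall>k\<in>U. \<forall>l\<in>F - U. w l \<le> w k"
    using largest_elements_exist[OF finF, of n w] by auto
  have finU: "finite U" using U(1) finF finite_subset by blast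
  have A0: "0 \<le> A" using A by (rule order_trans[rotated]) (auto intro: sum_nonneg)
  define S where "S = P \<union> U"
  have "P \<inter> U = {}" using U(1) by (auto simp: F_def)
  then have S: "S \<subseteq> \<Lambda>" "finite S" "card S = v"
    using P U finP finU n(3) by (auto simp: S_def F_def card_Un_disjoint)
  define Q where "Q = F - U"
  have Q: "Q \<subseteq> \<Lambda>" "finite Q" "\<Lambda> = S \<union> Q" "S \<inter> Q = {}"
    using P U finF by (auto simp: Q_def S_def F_def)
  \<comment> \<open>\<open>U\<close> holds at least v/2 coefficients with sum at most
    \<open>A\<close>, so each coefficient left in \<open>Q\<close> is at most 2A/v.\<close>
  define t where "t = 2 * A / real v"
  have t0: "0 \<le> t" using A0 by (simp add: t_def)
  have wsub: "sum w B \<le> A" if "B \<subseteq> F" for B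
  proof -
    have "sum w B \<le> sum w F" using finF that by (intro sum_mono2) (auto simp: w_def)
    then show ?thesis using A by (simp add: F_def w_def)
  qed
  have wt: "w l \<le> t" if "l \<in> Q" for l
  proof -
    have "w l \<le> sum w U / real n" using average_bound[OF U(2) n(1), of "w l" w] U(3) that by (auto simp: Q_def)
    also have "\<dots> \<le> A / real n" using wsub[OF U(1)] by (intro divide_right_mono) auto
    also have "\<dots> \<le> t"
    proof -
      have "A * real v \<le> A * (2 * real n)" using n(2) A0 by (intro mult_left_mono) auto
      then show ?thesis using n(1) v by (simp add: t_def field_simps)
    qed
    finally show ?thesis .
  qed
  have wQ: "sum w Q \<le> A" by (rule wsub) (auto simp: Q_def)

  define E where "E B = (\<Sum>j<m. (cmod (\<Sum>k\<in>B. c k * cexpk k (\<xi> j)))^2) / real m" for B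
  define N where "N B = sqrt (E B)" for B
  have E0: "0 \<le> E B" for B unfolding E_def by (intro divide_nonneg_nonneg sum_nonneg) auto
  have NL: "N B = L2_set (\<lambda>j. cmod (\<Sum>k\<in>B. c k * cexpk k (\<xi> j))) {..<m} / sqrt (real m)" for B
    by (simp add: N_def E_def L2_set_def real_sqrt_divide)
  \<comment> \<open>\<open>N\<close> is the empirical seminorm: a piece of at most \<open>v\<close>
    frequencies with coefficients up to \<open>s\<close> has \<open>E\<close> at most 33 v s^2. With
    2A/v from \<open>t\<close> and A/v from the sum, squaring gives 33 * 3^2 = 297.\<close>
  have "N Q \<le> sqrt (33 * real v) * (t + sum w Q / real v)"
  proof (rule peeling[where \<Lambda> = \<Lambda> and v = v])
    fix B C assume BC: "B \<union> C \<subseteq> \<Lambda>" "B \<inter> C = {}"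
    then have fin: "finite B" "finite C" using \<Lambda> finite_subset by blast+
    have "L2_set (\<lambda>j. cmod (\<Sum>k\<in>B \<union> C. c k * cexpk k (\<xi> j))) {..<m}
       \<le> L2_set (\<lambda>j. cmod (\<Sum>k\<in>B. c k * cexpk k (\<xi> j)) + cmod (\<Sum>k\<in>C. c k * cexpk k (\<xi> j))) {..<m}"
      unfolding sum.union_disjoint[OF fin BC(2)] by (intro L2_set_mono norm_triangle_ineq) auto
    also have "\<dots> \<le> L2_set (\<lambda>j. cmod (\<Sum>k\<in>B. c k * cexpk k (\<xi> j))) {..<m}
        + L2_set (\<lambda>j. cmod (\<Sum>k\<in>C. c k * cexpk k (\<xi> j))) {..<m}" by (rule L2_set_triangle_ineq)
    finally show "N (B \<union> C) \<le> N B + N C"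
      unfolding NL add_divide_distrib[symmetric] by (intro divide_right_mono) auto
  next
    fix B s assume B: "B \<subseteq> \<Lambda>" "card B \<le> v" "0 \<le> s" "\<And>k. k \<in> B \<Longrightarrow> w k \<le> s"
    have "E B \<le> 33 * (\<Sum>k\<in>B. (cmod (c k))^2)" using samp[OF B(1,2)] by (simp add: E_def)
    also have "(\<Sum>k\<in>B. (cmod (c k))^2) \<le> (\<Sum>k\<in>B. s^2)"
      using B(4) by (intro sum_mono power_mono) (auto simp: w_def)
    also have "\<dots> \<le> real v * s^2" using B(2) by (simp add: mult_right_mono)
    finally have "E B \<le> 33 * real v * s^2" by simp
    then have "N B \<le> sqrt (33 * real v * s^2)" unfolding N_def by (rule real_sqrt_le_mono)
    then show "N B \<le> sqrt (33 * real v) * s" using B(3) by (simp add: real_sqrt_mult)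
  qed (use v \<Lambda> Q wt t0 in \<open>auto simp: w_def\<close>)
  also have "\<dots> \<le> sqrt (33 * real v) * (3 * A / real v)"
  proof (intro mult_left_mono)
    have "sum w Q / real v \<le> A / real v" using wQ by (intro divide_right_mono) auto
    then show "t + sum w Q / real v \<le> 3 * A / real v" by (simp add: t_def)
  qed simp
  finally have "(N Q)^2 \<le> (sqrt (33 * real v) * (3 * A / real v))^2"
    using E0 by (intro power_mono) (auto simp: N_def)
  then have EQ: "E Q \<le> 297 * (A^2 / real v)"
    using E0[of Q] v by (simp add: N_def power_mult_distrib power_divide power2_eq_square field_simps)
  have l2Q: "(\<Sum>k\<in>Q. (cmod (c k))^2) \<le> 2 * (A^2 / real v)"
  proof -
    have "(\<Sum>k\<in>Q. (cmod (c k))^2) \<le> (\<Sum>k\<in>Q. t * w k)"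
      unfolding power2_eq_square w_def[symmetric] using wt by (intro sum_mono mult_right_mono) (auto simp: w_def)
    also have "\<dots> \<le> t * A" unfolding sum_distrib_left[symmetric] using wQ t0 by (intro mult_left_mono)
    finally show ?thesis by (simp add: t_def power2_eq_square)
  qed

  define g where "g x = (\<Sum>k\<in>S. c k * cexpk k x)" for x
  define L where "L = spanc (cexpk ` S)"
  have inj: "inj_on cexpk S" by (auto simp: inj_on_def cexpk_eq_iff)
  have L: "L \<in> Xv v (Phi \<Lambda>)"
    unfolding Xv_def Phi_def L_def using S by (auto intro!: exI[of _ "cexpk ` S"] simp: card_image[OF inj])
  have gL: "g \<in> L" unfolding L_def spanc_cexpk g_def by auto
  have split: "f x - g x = (f x - (\<Sum>k\<in>\<Lambda>. c k * cexpk k x)) + (\<Sum>k\<in>Q. c k * cexpk k x)" for x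
    unfolding g_def Q(3) sum.union_disjoint[OF S(2) Q(2) Q(4)] by simp
  have err: "lserr m \<xi> f g \<le> 2 * T^2 + 594 * (A^2 / real v)"
  proof -
    have "(\<Sum>j<m. (cmod (f (\<xi> j) - g (\<xi> j)))^2) \<le> (\<Sum>j<m. 2 * T^2 + 2 * (cmod (\<Sum>k\<in>Q. c k * cexpk k (\<xi> j)))^2)"
    proof (rule sum_mono)
      fix j
      have "(cmod (f (\<xi> j) - (\<Sum>k\<in>\<Lambda>. c k * cexpk k (\<xi> j))))^2 \<le> T^2" using T[OF \<xi>] by (intro power_mono) auto
      then show "(cmod (f (\<xi> j) - g (\<xi> j)))^2 \<le> 2 * T^2 + 2 * (cmod (\<Sum>k\<in>Q. c k * cexpk k (\<xi> j)))^2"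
        unfolding split by (intro order_trans[OF norm_add_squared_le]) simp
    qed
    then have "lserr m \<xi> f g \<le> (\<Sum>j<m. 2 * T^2 + 2 * (cmod (\<Sum>k\<in>Q. c k * cexpk k (\<xi> j)))^2) / real m"
      unfolding lserr_def by (simp add: divide_right_mono)
    also have "\<dots> = 2 * T^2 + 2 * E Q"
      using m by (simp add: E_def sum.distrib add_divide_distrib sum_distrib_left)
    finally show ?thesis using EQ by linarith
  qed
  have "(L2norm (\<lambda>x. f x - u x))^2 \<le> 500000 * (T^2 + A^2 / real v)" if u: "u \<in> LSset m \<xi> L f" for u
  proof -
    have uL: "u \<in> L" and min: "lserr m \<xi> f u \<le> lserr m \<xi> f g" using u gL by (auto simp: LSset_def)
    obtain d where d: "u = (\<lambda>x. \<Sum>k\<in>S. d k * cexpk k x)" using uL unfolding L_def spanc_cexpk by auto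
    have gu: "g x - u x = (\<Sum>k\<in>S. (c k - d k) * cexpk k x)" for x
      by (simp add: g_def d left_diff_distrib sum_subtractf)
    have "(\<Sum>k\<in>S. (cmod (c k - d k))^2) \<le> 64 * ((\<Sum>j<m. (cmod (g (\<xi> j) - u (\<xi> j)))^2) / real m)"
      using samp[of S "\<lambda>k. c k - d k"] S unfolding gu by auto
    also have "(\<Sum>j<m. (cmod (g (\<xi> j) - u (\<xi> j)))^2)
        \<le> (\<Sum>j<m. 2 * (cmod (f (\<xi> j) - u (\<xi> j)))^2 + 2 * (cmod (f (\<xi> j) - g (\<xi> j)))^2)"
      using norm_add_squared_le[of "f (\<xi> j) - u (\<xi> j)" "- (f (\<xi> j) - g (\<xi> j))" for j]
      by (intro sum_mono) (simp add: norm_minus_commute)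
    also have "\<dots> / real m = 2 * lserr m \<xi> f u + 2 * lserr m \<xi> f g"
      by (simp add: lserr_def sum.distrib add_divide_distrib sum_distrib_left sum_divide_distrib)
    finally have "(\<Sum>k\<in>S. (cmod (c k - d k))^2) \<le> 64 * (2 * lserr m \<xi> f u + 2 * lserr m \<xi> f g)"
      by (simp add: divide_right_mono)
    then have l2S: "(\<Sum>k\<in>S. (cmod (c k - d k))^2) \<le> 256 * (2 * T^2 + 594 * (A^2 / real v))"
      using min err by simp
    have cont: "continuous_on UNIV (\<lambda>x. \<Sum>k\<in>B. e k * cexpk k x)" for B and e :: "int^'d \<Rightarrow> complex"
      by (intro continuous_intros)
    have "f x - u x = (f x - (\<Sum>k\<in>\<Lambda>. c k * cexpk k x)) + (\<Sum>k\<in>Q. c k * cexpk k x) + (\<Sum>k\<in>S. (c k - d k) * cexpk k x)" for x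
      unfolding split[symmetric] gu[symmetric] by simp
    then have "(L2norm (\<lambda>x. f x - u x))^2 \<le> 3 * ((L2norm (\<lambda>x. f x - (\<Sum>k\<in>\<Lambda>. c k * cexpk k x)))^2
       + (L2norm (\<lambda>x. \<Sum>k\<in>Q. c k * cexpk k x))^2 + (L2norm (\<lambda>x. \<Sum>k\<in>S. (c k - d k) * cexpk k x))^2)"
      by (simp only:) (intro L2norm_add3 continuous_on_diff f cont)
    moreover have "(L2norm (\<lambda>x. f x - (\<Sum>k\<in>\<Lambda>. c k * cexpk k x)))^2 \<le> T^2"
      by (intro L2norm_le_sup continuous_on_diff f cont T)
    moreover have "0 \<le> A^2 / real v" "0 \<le> T^2" by auto
    \<comment> \<open>The coefficients are 3 * (1 + 512) = 1539 for T^2 and 3 * (2 + 256 * 594) =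
      456198 for A^2/v.\<close>
    ultimately show ?thesis
      using l2Q l2S unfolding torus_parseval[OF S(2)] torus_parseval[OF Q(2)] distrib_left by linarith
  qed
  then show ?thesis using L by blast
qed

subsection \<open>Rates\<close>

text \<open>As \<open>b\<close> is any real, the exponents of the logarithmic factors may be
  negative; comparing the bases from both sides handles either sign.\<close>

lemma powr_comparable:
  fixes x y c e :: real
  assumes "0 < y" "1 \<le> c" "y \<le> c * x" "x \<le> c * y"
  shows "x powr e \<le> c powr \<bar>e\<bar> * y powr e"
proof (cases "0 \<le> e")
  case True
  have "0 < x" using assms by (metis less_le_trans zero_less_mult_pos zero_less_one)
  then have "x powr e \<le> (c * y) powr e" using assms True by (intro powr_mono2) auto
  then show ?thesis using assms True by (simp add: powr_mult)
next
  case False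
  have "y / c \<le> x" using assms by (simp add: pos_divide_le_eq mult.commute)
  then have "x powr e \<le> (y / c) powr e" using assms False by (intro powr_mono2') auto
  also have "\<dots> = c powr (- e) * y powr e" using assms by (simp add: powr_divide powr_minus field_simps)
  finally show ?thesis using False by simp
qed

lemma powr_le_exponential:
  fixes a \<gamma> :: real
  assumes "0 < a" "0 \<le> \<gamma>"
  obtains C where "\<And>x. 1 \<le> x \<Longrightarrow> x powr \<gamma> \<le> C * 2 powr (a * x)"
proof -
  \<comment> \<open>From ln y <= y - 1 at y = s x: the slope \<gamma> s must not exceed a ln 2, and
    \<gamma> + 1 in the denominator keeps \<open>s\<close> positive when \<gamma> = 0.\<close>
  define s where "s = a * ln 2 / (\<gamma> + 1)"
  have s: "0 < s" "\<gamma> * s \<le> a * ln 2" using assms by (auto simp: s_def field_simps)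
  have "x powr \<gamma> \<le> exp (- \<gamma> * ln s) * 2 powr (a * x)" if x: "1 \<le> x" for x
  proof -
    have "ln (s * x) \<le> s * x" using ln_le_minus_one[of "s * x"] s x by simp
    then have "ln x \<le> s * x - ln s" using s x by (simp add: ln_mult)
    then have "\<gamma> * ln x \<le> \<gamma> * (s * x - ln s)" using assms by (intro mult_left_mono) auto
    also have "\<dots> \<le> - \<gamma> * ln s + a * x * ln 2"
      using mult_right_mono[OF s(2), of x] x by (simp add: algebra_simps)
    finally show ?thesis using x by (simp add: powr_def exp_add[symmetric] mult_ac)
  qed
  then show ?thesis by (rule that)
qed

text \<open>For \<beta> = (d-1) b this is the bound on \<open>blockA\<close> in
  \<open>WA\<close>.\<close>

definition decay :: "real \<Rightarrow> real \<Rightarrow> nat \<Rightarrow> real" where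
  "decay a \<beta> j = 2 powr (- a * real j) * real (max j 1) powr \<beta>"

lemma decay_nonneg: "0 \<le> decay a \<beta> j"
  by (simp add: decay_def)

text \<open>The tail has the order of its first term: passing from \<open>n\<close> to
  \<open>i + n\<close> changes the base of the polynomial factor by at most 1 + i either way, so the
  quotient is dominated by \<open>u i\<close>, which is summable and free of
  \<open>n\<close>.\<close>

lemma decay_tail:
  assumes a: "0 < a"
  obtains C where "0 < C" "\<And>n. summable (\<lambda>i. decay a \<beta> (i + n))"
    "\<And>n. (\<Sum>i. decay a \<beta> (i + n)) \<le> C * decay a \<beta> n"
proof -
  define u where "u i = 2 powr (- a * real i) * (1 + real i) powr \<bar>\<beta>\<bar>" for i :: nat
  obtain C where C: "\<And>x. 1 \<le> x \<Longrightarrow> x powr \<bar>\<beta>\<bar> \<le> C * 2 powr (a / 2 * x)"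
    using powr_le_exponential[of "a / 2" "\<bar>\<beta>\<bar>"] a by auto
  have ub: "u i \<le> C * 2 powr (a / 2) * (2 powr (- a / 2)) ^ i" for i
  proof -
    have "u i \<le> 2 powr (- a * real i) * (C * 2 powr (a / 2 * (1 + real i)))"
      unfolding u_def by (intro mult_left_mono C) auto
    also have "\<dots> = C * 2 powr (a / 2) * (2 powr (- a / 2)) ^ i"
      by (simp add: powr_add[symmetric] powr_power field_simps)
    finally show ?thesis .
  qed
  have "(2::real) powr (- a / 2) < 1" using a by (simp add: powr_less_one)
  then have "summable (\<lambda>i. C * 2 powr (a / 2) * (2 powr (- a / 2)) ^ i)"
    by (intro summable_mult summable_geometric) simp
  then have su: "summable u"
    by (rule summable_comparison_test') (use ub in \<open>auto simp: u_def\<close>)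
  have dom: "decay a \<beta> (i + n) \<le> decay a \<beta> n * u i" for i n
  proof -
    have "real (max n 1) \<le> (1 + real i) * real (max (i + n) 1)"
    proof -
      have "real (max n 1) \<le> 1 * real (max (i + n) 1)" by auto
      also have "\<dots> \<le> (1 + real i) * real (max (i + n) 1)" by (intro mult_right_mono) auto
      finally show ?thesis .
    qed
    moreover have "real (max (i + n) 1) \<le> (1 + real i) * real (max n 1)"
      by (auto simp: max_def algebra_simps simp flip: of_nat_mult of_nat_add)
    ultimately have "real (max (i + n) 1) powr \<beta> \<le> (1 + real i) powr \<bar>\<beta>\<bar> * real (max n 1) powr \<beta>"
      by (intro powr_comparable) auto
    then have "decay a \<beta> (i + n) \<le> 2 powr (- a * real (i + n)) * ((1 + real i) powr \<bar>\<beta>\<bar> * real (max n 1) powr \<beta>)"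
      unfolding decay_def by (intro mult_left_mono) auto
    also have "\<dots> = decay a \<beta> n * u i"
    proof -
      have e: "- a * real (i + n) = - a * real n + - a * real i" by (simp add: algebra_simps)
      show ?thesis unfolding decay_def u_def e powr_add by (simp only: mult_ac)
    qed
    finally show ?thesis .
  qed
  have sd: "summable (\<lambda>i. decay a \<beta> (i + n))" for n
    by (rule summable_comparison_test'[OF summable_mult[OF su, of "decay a \<beta> n"]]) (use dom decay_nonneg in auto)
  have u0: "0 \<le> u i" for i by (simp add: u_def)
  show ?thesis
  proof (rule that[of "suminf u + 1"])
    show "0 < suminf u + 1" using suminf_nonneg[OF su u0] by simp
    fix n
    have "(\<Sum>i. decay a \<beta> (i + n)) \<le> (\<Sum>i. decay a \<beta> n * u i)"
      by (rule suminf_le[OF dom sd summable_mult[OF su]])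
    also have "\<dots> \<le> (suminf u + 1) * decay a \<beta> n"
      unfolding suminf_mult[OF su] using decay_nonneg[of a \<beta> n] by (simp add: algebra_simps)
    finally show "(\<Sum>i. decay a \<beta> (i + n)) \<le> (suminf u + 1) * decay a \<beta> n" .
  qed (rule sd)
qed

lemma blockA_eq: "blockA f j = (\<Sum>k\<in>hblock j. cmod (fourier f k))"
  by (simp add: blockA_def hblock_def)

lemma hblock_truncation_error:
  fixes f :: "real^'d \<Rightarrow> complex"
  assumes f: "continuous_on UNIV f" and dec: "\<And>j. blockA f j \<le> \<tau> j" and \<tau>: "\<And>n. summable (\<lambda>j. \<tau> (j + n))"
    and x: "x \<in> Td"
  shows "cmod (f x - (\<Sum>k\<in>(\<Union>j<J. hblock j). fourier f k * cexpk k x)) \<le> (\<Sum>j. \<tau> (j + J))"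
proof -
  have b0: "0 \<le> blockA f j" for j by (simp add: blockA_eq sum_nonneg)
  have sm: "summable (blockA f)"
    by (rule summable_comparison_test'[OF \<tau>[of 0, simplified]]) (use b0 dec in auto)
  have sums: "(\<lambda>j. block_sum f j x) sums f x" by (rule fourier_series_sums[OF f sm x])
  have "(\<Sum>k\<in>(\<Union>j<J. hblock j). fourier f k * cexpk k x) = (\<Sum>j<J. block_sum f j x)"
    unfolding block_sum_def using hblock_unique
    by (intro sum.UNION_disjoint) (auto simp: finite_hblock)
  then have "f x - (\<Sum>k\<in>(\<Union>j<J. hblock j). fourier f k * cexpk k x) = (\<Sum>j. block_sum f (j + J) x)"
    using sums_split_initial_segment[OF sums, of J] by (simp add: sums_iff)
  also have "cmod \<dots> \<le> (\<Sum>j. \<tau> (j + J))"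
  proof -
    have le: "cmod (block_sum f (j + J) x) \<le> \<tau> (j + J)" for j
      using norm_block_sum[of f "j + J" x] dec[of "j + J"] by linarith
    have sn: "summable (\<lambda>j. cmod (block_sum f (j + J) x))"
      by (rule summable_comparison_test'[OF \<tau>[of J]]) (use le in auto)
    show ?thesis by (rule order_trans[OF summable_norm[OF sn] suminf_le[OF le sn \<tau>]])
  qed
  finally show ?thesis .
qed

lemma high_frequency_l1:
  fixes f :: "real^'d \<Rightarrow> complex"
  assumes dec: "\<And>j. blockA f j \<le> \<tau> j" and \<tau>: "\<And>n. summable (\<lambda>j. \<tau> (j + n))"
  shows "(\<Sum>k\<in>(\<Union>j<J. hblock j) - (\<Union>j<n. hblock j). cmod (fourier f k)) \<le> (\<Sum>j. \<tau> (j + n))"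
proof -
  have b0: "0 \<le> blockA f j" for j by (simp add: blockA_eq sum_nonneg)
  have \<tau>0: "0 \<le> \<tau> j" for j using b0[of j] dec[of j] by linarith
  have sub: "(\<Union>j<J. hblock j) - (\<Union>j<n. hblock j) \<subseteq> (\<Union>j<J. hblock (j + n) :: (int^'d) set)"
  proof
    fix k :: "int^'d" assume k: "k \<in> (\<Union>j<J. hblock j) - (\<Union>j<n. hblock j)"
    then obtain j where j: "j < J" "k \<in> hblock j" by auto
    moreover have "n \<le> j" using k j(2) by (meson DiffE UN_I lessThan_iff not_less)
    ultimately have j: "j < J" "k \<in> hblock j" "n \<le> j" by auto
    then show "k \<in> (\<Union>j<J. hblock (j + n))" by (intro UN_I[of "j - n"]) auto
  qed
  have "(\<Sum>k\<in>(\<Union>j<J. hblock j) - (\<Union>j<n. hblock j). cmod (fourier f k))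
      \<le> (\<Sum>k\<in>(\<Union>j<J. hblock (j + n)). cmod (fourier f k))"
    by (intro sum_mono2 sub) (auto simp: finite_hblock)
  also have "\<dots> = (\<Sum>j<J. blockA f (j + n))"
    unfolding blockA_eq
    by (intro sum.UNION_disjoint) (auto simp: finite_hblock dest: hblock_unique[of _ "_ + n" "_ + n"])
  also have "\<dots> \<le> (\<Sum>j<J. \<tau> (j + n))" by (intro sum_mono dec)
  also have "\<dots> \<le> (\<Sum>j. \<tau> (j + n))" by (intro sum_le_suminf \<tau>) (auto simp: \<tau>0)
  finally show ?thesis .
qed

text \<open>Members of \<open>Xv\<close> need \<open>v\<close> distinct exponentials. The
  frequencies 0, ..., v - 1 on one axis provide them, since numbers below 2^J lie in shells of index
  at most \<open>J\<close>.\<close>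

lemma card_hblocks_lower:
  assumes "v \<le> 2^J"
  shows "v \<le> card (\<Union>j<Suc J. hblock j :: (int^'d) set)"
proof -
  define i0 where "i0 = (undefined :: 'd)"
  define \<iota> where "\<iota> q = (axis i0 (int q) :: int^'d)" for q
  have inj: "inj_on \<iota> {..<v}" by (auto simp: inj_on_def \<iota>_def axis_eq_axis)
  have "\<iota> q \<in> (\<Union>j<Suc J. hblock j)" if q: "q < v" for q
  proof -
    obtain s where s: "int q \<in> dyadic_shell s" using dyadic_shell_exists by blast
    have "s \<le> J"
    proof (cases s)
      case (Suc n)
      then have "2^n \<le> int q" using s by (auto simp: dyadic_shell_Suc)
      also have "int q < int (2^J)" using q assms by (simp only: of_nat_less_iff)
      finally have "(2::int)^n < 2^J" by simp
      then show ?thesis using Suc by simp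
    qed simp
    have "\<iota> q \<in> rho_blk (axis i0 s)"
      using s by (auto simp: rho_blk_iff \<iota>_def axis_def dyadic_shell_0)
    moreover have "(\<Sum>i\<in>UNIV. (axis i0 s :: nat^'d) $ i) = s" by (simp add: axis_def)
    ultimately have "\<iota> q \<in> hblock s" unfolding hblock_def by blast
    then show ?thesis using \<open>s \<le> J\<close> by auto
  qed
  then have "\<iota> ` {..<v} \<subseteq> (\<Union>j<Suc J. hblock j)" by auto
  then have "card (\<iota> ` {..<v}) \<le> card (\<Union>j<Suc J. hblock j :: (int^'d) set)"
    by (intro card_mono) (auto simp: finite_hblock)
  then show ?thesis by (simp add: card_image[OF inj])
qed

section \<open>Choice of the two levels and of the sample size\<close>

lemma half_le_ln2: "1 / 2 \<le> ln (2::real)"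
proof -
  have "exp (1::real) \<le> 4" using exp_le by simp
  then have "1 \<le> ln (4::real)" by (simp add: ln_ge_iff)
  also have "ln (4::real) = 2 * ln 2" using ln_realpow[of 2 2] by simp
  finally show ?thesis by simp
qed

text \<open>For \<open>D\<close> = d - 1 the number 2^n (n+1)^D bounds the frequency count of the
  blocks below \<open>n\<close>. These fill at most half of \<open>v\<close>, while the bound for
  the next level would overshoot; v >= 2 makes level 0 admissible.\<close>

lemma low_frequency_level_exists:
  assumes "2 \<le> v"
  obtains n where "2 * (2^n * (n + 1)^D) \<le> v" "v < 2 * (2^(n + 1) * (n + 2)^D)"
proof -
  define k where "k = (LEAST k. v < 2 * (2^k * (k + 1)^D))"
  have "2^v * 1 \<le> 2^v * (v + 1)^D" by (intro mult_left_mono) auto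
  then have "v < 2 * (2^v * (v + 1)^D)" using less_exp[of v] by linarith
  then have k: "v < 2 * (2^k * (k + 1)^D)" unfolding k_def by (rule LeastI)
  show ?thesis
  proof (cases k)
    case 0 then show ?thesis using k assms by simp
  next
    case (Suc n)
    then have "\<not> v < 2 * (2^n * (n + 1)^D)" unfolding k_def by (metis not_less_Least lessI)
    then show ?thesis using k Suc by (intro that[of n]) auto
  qed
qed

text \<open>The exponent a + b arises here: 2^n is at least of order v / n^D and \<open>n\<close> is
  of order ln v, so 2^(-a n) contributes (ln v)^(D a) besides v^(-a), to be multiplied by n^(D b).
  In the proof \<open>y\<close> replaces \<open>n\<close> to stay positive at n = 0.\<close>

lemma decay_at_low_level:
  fixes v n D :: nat and a b :: real
  assumes a: "0 < a" and v: "2 \<le> v"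
    and lo: "2 * (2^n * (n + 1)^D) \<le> v" and hi: "v < 2 * (2^(n + 1) * (n + 2)^D)"
  shows "decay a (real D * b) n \<le> (4 * 3^D) powr a * (3 * (real D + 1)) powr \<bar>real D * (a + b)\<bar>
           * (real v powr (- a) * ln (real v) powr (real D * (a + b)))"
proof -
  define y where "y = real (max n 1)"
  have y: "1 \<le> y" "real n + 2 \<le> 3 * y" "real n \<le> y" by (auto simp: y_def max_def)
  have lnv: "1 / 2 \<le> ln (real v)" using v half_le_ln2 ln_le_cancel_iff[of 2 "real v"] by linarith
  have vv: "real v \<le> 4 * (2^n * (real n + 2)^D)"
    using of_nat_less_iff[where 'a = real, THEN iffD2, OF hi] by (simp add: add.commute mult.assoc)
  also have "(real n + 2)^D \<le> (3 * y)^D" using y by (intro power_mono) auto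
  finally have "real v \<le> (4 * 3^D * y^D) * 2^n" by (simp add: power_mult_distrib mult_ac)
  then have "real v / (4 * 3^D * y^D) \<le> 2^n" using y by (simp add: pos_divide_le_eq mult.commute)
  then have "(2^n) powr (- a) \<le> (real v / (4 * 3^D * y^D)) powr (- a)"
    using a v y by (intro powr_mono2') auto
  also have "\<dots> = (4 * 3^D) powr a * y powr (real D * a) * real v powr (- a)"
    using y v by (simp add: powr_divide powr_mult powr_minus powr_realpow[symmetric] powr_powr field_simps)
  finally have "decay a (real D * b) n \<le> (4 * 3^D) powr a * y powr (real D * a) * real v powr (- a) * y powr (real D * b)"
    unfolding decay_def y_def[symmetric]
    by (intro mult_right_mono) (auto simp: powr_realpow[symmetric] powr_powr mult.commute)
  also have "\<dots> = (4 * 3^D) powr a * real v powr (- a) * y powr (real D * (a + b))"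
    by (simp add: distrib_left powr_add mult_ac)
  also have "\<dots> \<le> (4 * 3^D) powr a * real v powr (- a)
      * ((3 * (real D + 1)) powr \<bar>real D * (a + b)\<bar> * ln (real v) powr (real D * (a + b)))"
  proof (intro mult_left_mono powr_comparable)
    show "0 < ln (real v)" using lnv by linarith
    \<comment> \<open>Together with v <= 2^(n+2) (n+2)^D this gives v <= 2^((n+2)(D+1)), hence ln v
      is at most a multiple of \<open>y\<close>. The converse comparison rests on 2^n <= v from
      \<open>lo\<close>.\<close>
    have "real n + 2 \<le> 2^(n + 2)"
      using less_exp[of "n + 2"] of_nat_le_iff[where 'a = real, of "n + 2" "2^(n + 2)"] by simp
    then have "(real n + 2)^D \<le> (2^(n + 2))^D" by (intro power_mono) auto
    then have "2^(n + 2) * (real n + 2)^D \<le> 2^(n + 2) * (2^(n + 2))^D" by (intro mult_left_mono) auto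
    moreover have "real v \<le> 2^(n + 2) * (real n + 2)^D" using vv by (simp add: power_add)
    ultimately have "real v \<le> 2^(n + 2) * (2^(n + 2))^D" by (rule order_trans[rotated])
    also have "\<dots> = 2^((n + 2) * (D + 1))"
    proof -
      have e: "(n + 2) * (D + 1) = (n + 2) + (n + 2) * D" by simp
      show ?thesis by (simp only: e power_add[of _ "n + 2" "(n + 2) * D"] power_mult)
    qed
    finally have "ln (real v) \<le> ln (2^((n + 2) * (D + 1)))" using v by (subst ln_le_cancel_iff) auto
    also have "\<dots> = real ((n + 2) * (D + 1)) * ln 2" by (rule ln_realpow)
    also have "\<dots> \<le> real ((n + 2) * (D + 1)) * 1" using ln_2_less_1 by (intro mult_left_mono) auto
    also have "\<dots> = (real n + 2) * (real D + 1)" by (simp add: algebra_simps)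
    also have "\<dots> \<le> (3 * y) * (real D + 1)" using y by (intro mult_right_mono) auto
    finally show "ln (real v) \<le> 3 * (real D + 1) * y" by (simp add: mult_ac)
    have "2^n * 1 \<le> 2^n * (n + 1)^D" by (intro mult_left_mono) auto
    then have "(2::nat)^n \<le> v" using lo by linarith
    then have "(2::real)^n \<le> real v" by (metis of_nat_le_iff of_nat_numeral of_nat_power)
    then have "ln (2^n) \<le> ln (real v)" using v by (subst ln_le_cancel_iff) auto
    then have "real n * ln 2 \<le> ln (real v)" by (simp add: ln_realpow)
    then have "real n * (1 / 2) \<le> ln (real v)"
      using mult_left_mono[OF half_le_ln2, of "real n"] by simp
    then have "y \<le> 2 * ln (real v)" using lnv by (auto simp: y_def max_def)
    also have "\<dots> \<le> 3 * (real D + 1) * ln (real v)" using lnv by (intro mult_right_mono) auto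
    finally show "y \<le> 3 * (real D + 1) * ln (real v)" .
  qed auto
  finally show ?thesis by (simp add: mult_ac)
qed

lemma truncation_level_exists:
  fixes v :: nat and \<kappa> :: real
  assumes v: "2 \<le> v" and \<kappa>: "1 \<le> \<kappa>"
  obtains J where "real v powr \<kappa> \<le> 2^J" "2^J \<le> 2 * real v powr \<kappa>"
    "ln (real v) \<le> real (Suc J)" "real (Suc J) \<le> (4 + 2 * \<kappa>) * ln (real v)"
proof -
  define J where "J = nat \<lceil>\<kappa> * log 2 (real v)\<rceil>"
  have l: "ln (real v) \<le> log 2 (real v)" "log 2 (real v) \<le> 2 * ln (real v)" "1 / 2 \<le> ln (real v)"
  proof -
    show lv: "1 / 2 \<le> ln (real v)" using v half_le_ln2 ln_le_cancel_iff[of 2 "real v"] by linarith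
    have "ln (real v) * ln 2 \<le> ln (real v) * 1" using lv ln_2_less_1 by (intro mult_left_mono) auto
    then show "ln (real v) \<le> log 2 (real v)" by (simp add: log_def field_simps)
    have "ln (real v) * (1 / 2) \<le> ln (real v) * ln 2" using lv half_le_ln2 by (intro mult_left_mono) auto
    then show "log 2 (real v) \<le> 2 * ln (real v)" by (simp add: log_def field_simps)
  qed
  have pos: "0 \<le> \<kappa> * log 2 (real v)" using l \<kappa> by (intro mult_nonneg_nonneg) auto
  have J: "\<kappa> * log 2 (real v) \<le> real J" "real J \<le> \<kappa> * log 2 (real v) + 1"
    unfolding J_def using pos by linarith+
  have e: "real v powr \<kappa> = 2 powr (\<kappa> * log 2 (real v))"
  proof -
    have "real v = 2 powr log 2 (real v)" using v by simp
    then show ?thesis by (metis powr_powr mult.commute)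
  qed
  show ?thesis
  proof (rule that[of J])
    show "real v powr \<kappa> \<le> 2^J" using J(1) by (simp add: e powr_realpow[symmetric])
    have "2 powr real J \<le> 2 powr (\<kappa> * log 2 (real v) + 1)" using J(2) by (intro powr_mono) auto
    then show "2^J \<le> 2 * real v powr \<kappa>" by (simp add: e powr_realpow powr_add)
    have "1 * log 2 (real v) \<le> \<kappa> * log 2 (real v)" using \<kappa> l by (intro mult_right_mono) auto
    then show "ln (real v) \<le> real (Suc J)" using J(1) l unfolding of_nat_Suc by linarith
    have "\<kappa> * log 2 (real v) \<le> \<kappa> * (2 * ln (real v))" using \<kappa> l by (intro mult_left_mono) auto
    then show "real (Suc J) \<le> (4 + 2 * \<kappa>) * ln (real v)" using J(2) l by (simp add: algebra_simps)
  qed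
qed

text \<open>\<kappa> solves \<kappa> a = a + 1/2, so 2^(-a J) supplies the whole power of
  \<open>v\<close>. The term itself carries (ln v)^(D b) only; the factor (ln v)^(D a) is inserted
  at the cost of 2 powr (D a), as 2 ln v >= 1.\<close>

lemma decay_at_truncation_level:
  fixes v J :: nat and D a b :: real
  assumes a: "0 < a" and v: "2 \<le> v" and D: "0 \<le> D" and \<kappa>: "\<kappa> = 1 + 1 / (2 * a)"
    and J: "real v powr \<kappa> \<le> 2^J" "ln (real v) \<le> real (Suc J)" "real (Suc J) \<le> (4 + 2 * \<kappa>) * ln (real v)"
  shows "decay a (D * b) (Suc J) \<le> (4 + 2 * \<kappa>) powr \<bar>D * b\<bar> * 2 powr (D * a)
           * (real v powr (- a - 1/2) * ln (real v) powr (D * (a + b)))"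
proof -
  have lv: "1 / 2 \<le> ln (real v)" using v half_le_ln2 ln_le_cancel_iff[of 2 "real v"] by linarith
  have \<kappa>1: "1 \<le> \<kappa>" "\<kappa> * - a = - a - 1/2" using a by (auto simp: \<kappa> field_simps)
  have "real v powr \<kappa> \<le> 2^Suc J" using J(1) by (simp add: less_le_trans order_trans[OF J(1)])
  then have "(2^Suc J) powr (- a) \<le> (real v powr \<kappa>) powr (- a)"
    using a v by (intro powr_mono2') auto
  also have "\<dots> = real v powr (- a - 1/2)" by (simp only: powr_powr \<kappa>1)
  finally have 1: "2 powr (- a * real (Suc J)) \<le> real v powr (- a - 1/2)"
    by (simp add: powr_realpow[symmetric] powr_powr mult.commute del: of_nat_Suc power_Suc)
  have "real (Suc J) powr (D * b) \<le> (4 + 2 * \<kappa>) powr \<bar>D * b\<bar> * ln (real v) powr (D * b)"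
  proof (rule powr_comparable)
    have "1 * real (Suc J) \<le> (4 + 2 * \<kappa>) * real (Suc J)" using \<kappa>1 by (intro mult_right_mono) auto
    then show "ln (real v) \<le> (4 + 2 * \<kappa>) * real (Suc J)" using order_trans[OF J(2)] by simp
  qed (use lv \<kappa>1 J(3) in auto)
  moreover have "ln (real v) powr (D * b) \<le> 2 powr (D * a) * ln (real v) powr (D * (a + b))"
  proof -
    have "(1::real) \<le> (2 * ln (real v)) powr (D * a)" using lv D a by (intro ge_one_powr_ge_zero) auto
    then have "1 * ln (real v) powr (D * b) \<le> (2 * ln (real v)) powr (D * a) * ln (real v) powr (D * b)"
      by (intro mult_right_mono) auto
    then show ?thesis using lv by (simp add: powr_mult powr_add distrib_left)
  qed
  ultimately have 2: "real (Suc J) powr (D * b)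
      \<le> (4 + 2 * \<kappa>) powr \<bar>D * b\<bar> * (2 powr (D * a) * ln (real v) powr (D * (a + b)))"
    by (meson mult_left_mono order_trans powr_ge_zero)
  have "decay a (D * b) (Suc J) \<le> real v powr (- a - 1/2) *
      ((4 + 2 * \<kappa>) powr \<bar>D * b\<bar> * (2 powr (D * a) * ln (real v) powr (D * (a + b))))"
    unfolding decay_def using 1 2 by (intro mult_mono) (auto simp: max_def simp del: of_nat_Suc)
  then show ?thesis by (simp add: mult_ac)
qed

text \<open>With l = ln(2v) the factors are t + 1 <= 6 l, K <= 1025 q l and ln(5N) <= (q+1) l; 24
  l^2 bounds the remaining logarithm and 192 = 32 * 6. So v l^3 is enough, and l >= 1 passes to l^4.
  The exponent q - 1 = d (\<kappa> + 4) comes from 2 * 2^J + 1 <= 12 v^\<kappa> <=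
  v^(\<kappa>+4).\<close>

lemma sample_size_sufficient:
  fixes v J N d m :: nat and \<kappa> :: real
  defines "q \<equiv> 1 + real d * (\<kappa> + 4)"
  assumes v: "2 \<le> v" and \<kappa>: "1 \<le> \<kappa>" and J: "2^J \<le> 4 * real v powr \<kappa>"
    and N: "0 < N" "real N \<le> (2 * 2^J + 1)^d"
    and m: "192 * (1025 * q * (q + 1) + 24) * real v * (ln (2 * real v))^4 \<le> real m"
  shows "(2 * 2^J + 1)^d \<le> real v powr (q - 1) \<and> (\<exists>t K::nat. 8 * real v \<le> 2^t \<and>
     1024 * ln (4 * (2 * 2^J + 1)^d) \<le> real K \<and>
     32 * real v * real (t + 1) * (real K * ln (5 * real N) + ln (4 * real (t + 1))) \<le> real m)"
proof -
  define l where "l = ln (2 * real v)"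
  have lv: "1 / 2 \<le> ln (real v)" using v half_le_ln2 ln_le_cancel_iff[of 2 "real v"] by linarith
  have l: "1 \<le> l" "ln (real v) \<le> l" "2 * ln 2 \<le> l"
    using v lv half_le_ln2 ln_le_cancel_iff[of 2 "real v"] by (auto simp: l_def ln_mult)
  have q: "1 \<le> q" using \<kappa> by (simp add: q_def)
  have "(2 * 2^J + 1 :: real) \<le> 3 * 2^J" by simp
  also have "\<dots> \<le> 12 * real v powr \<kappa>" using J by simp
  also have "\<dots> \<le> real v powr 4 * real v powr \<kappa>"
  proof (intro mult_right_mono)
    have "(2::real)^4 \<le> real v^4" using v by (intro power_mono) auto
    then show "12 \<le> real v powr 4" using v by (simp add: powr_numeral)
  qed simp
  also have "\<dots> = real v powr (\<kappa> + 4)" by (simp add: powr_add)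
  finally have "(2 * 2^J + 1)^d \<le> (real v powr (\<kappa> + 4))^d" by (intro power_mono) auto
  also have "\<dots> = real v powr (q - 1)"
    using v by (simp add: q_def powr_realpow[symmetric] powr_powr mult.commute)
  finally have G: "(2 * 2^J + 1)^d \<le> real v powr (q - 1)" .
  have pos: "0 < (2 * 2^J + 1 :: real)^d" by (intro zero_less_power add_nonneg_pos) auto
  then have "ln ((2 * 2^J + 1)^d) \<le> ln (real v powr (q - 1))" using G v by (subst ln_le_cancel_iff) auto
  also have "\<dots> \<le> (q - 1) * l" using v q l by (simp add: ln_powr mult_left_mono)
  finally have lnG: "ln ((2 * 2^J + 1)^d) \<le> (q - 1) * l" .
  have ln4: "ln (4 * (2 * 2^J + 1)^d) \<le> q * l"
  proof -
    have "ln (4::real) = 2 * ln 2" using ln_realpow[of 2 2] by simp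
    then have "ln (4 * (2 * 2^J + 1)^d) \<le> l + ln ((2 * 2^J + 1)^d)"
      using l(3) ln_mult_pos[OF _ pos, of 4] by linarith
    then show ?thesis using lnG by (simp add: algebra_simps)
  qed
  \<comment> \<open>Rounding up adds at most 1 <= q l, hence 1025.\<close>
  define K where "K = nat \<lceil>1024 * (q * l)\<rceil>"
  have ql: "1 \<le> q * l" using q l mult_mono[of 1 q 1 l] by simp
  have K: "1024 * ln (4 * (2 * 2^J + 1)^d) \<le> real K" "real K \<le> 1025 * (q * l)"
    unfolding K_def using ql ln4 by linarith+
  have lnN: "ln (5 * real N) \<le> (q + 1) * l"
  proof -
    have "5 * real N \<le> (2 * real v)^2 * (2 * 2^J + 1)^d"
    proof (intro mult_mono N)
      have "(4::real)^2 \<le> (2 * real v)^2" using v by (intro power_mono) auto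
      then show "5 \<le> (2 * real v)^2" by simp
    qed auto
    then have "ln (5 * real N) \<le> ln ((2 * real v)^2 * (2 * 2^J + 1)^d)"
      using N v by (subst ln_le_cancel_iff) auto
    also have "\<dots> = 2 * l + ln ((2 * 2^J + 1)^d)" 
    proof -
      have "ln ((2 * real v)^2) = 2 * l" unfolding l_def by (subst ln_realpow) simp
      moreover have "0 < (2 * real v)^2" using v by simp
      ultimately show ?thesis by (simp only: ln_mult_pos[OF _ pos])
    qed
    finally show ?thesis using lnG by (simp add: algebra_simps)
  qed
  have lnN0: "0 \<le> ln (5 * real N)" using N by simp
  define t where "t = nat \<lceil>log 2 (8 * real v)\<rceil>"
  have t1: "log 2 (8 * real v) \<le> real t" "real t \<le> log 2 (8 * real v) + 1"
  proof -
    have "0 \<le> log 2 (8 * real v)" using v by simp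
    then show "log 2 (8 * real v) \<le> real t" "real t \<le> log 2 (8 * real v) + 1" unfolding t_def by linarith+
  qed
  have t: "8 * real v \<le> 2^t"
  proof -
    have "8 * real v = 2 powr log 2 (8 * real v)" using v by simp
    also have "\<dots> \<le> 2 powr real t" using t1 by (intro powr_mono) auto
    finally show ?thesis by (simp add: powr_realpow)
  qed
  have t6: "real (t + 1) \<le> 6 * l"
  proof -
    have "8 * real v \<le> (2 * real v)^2" using v by (simp add: power2_eq_square)
    then have "ln (8 * real v) \<le> ln ((2 * real v)^2)" using v by (subst ln_le_cancel_iff) auto
    also have "ln ((2 * real v)^2) = 2 * l" unfolding l_def by (subst ln_realpow) simp
    finally have l8: "ln (8 * real v) \<le> 2 * l" .
    have "ln (8 * real v) * (1 / 2) \<le> ln (8 * real v) * ln 2"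
      using v half_le_ln2 by (intro mult_left_mono) auto
    then have "log 2 (8 * real v) \<le> 2 * ln (8 * real v)" by (simp add: log_def field_simps)
    then show ?thesis using t1 l8 l by simp
  qed
  have ll: "l \<le> l^2" "l^3 \<le> l^4" using l by (auto intro: power_increasing self_le_power)
  have "ln (4 * real (t + 1)) \<le> 4 * real (t + 1)" using ln_le_minus_one[of "4 * real (t + 1)"] by simp
  then have lnt: "ln (4 * real (t + 1)) \<le> 24 * l^2" 
  proof -
    note \<open>ln (4 * real (t + 1)) \<le> 4 * real (t + 1)\<close>
    also have "4 * real (t + 1) \<le> 4 * (6 * l)" using t6 by (intro mult_left_mono) auto
    also have "\<dots> \<le> 24 * l^2" using ll by simp
    finally show ?thesis .
  qed
  have "real K * ln (5 * real N) \<le> (1025 * (q * l)) * ((q + 1) * l)"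
    using K lnN lnN0 ql by (intro mult_mono) auto
  then have inner: "real K * ln (5 * real N) + ln (4 * real (t + 1)) \<le> (1025 * q * (q + 1) + 24) * l^2"
    using lnt by (simp add: algebra_simps power2_eq_square)
  have Q0: "0 \<le> 1025 * q * (q + 1) + 24" using q by auto
  have "32 * real v * real (t + 1) * (real K * ln (5 * real N) + ln (4 * real (t + 1)))
     \<le> (32 * real v * (6 * l)) * ((1025 * q * (q + 1) + 24) * l^2)"
    using t6 inner lnN0 Q0 l by (intro mult_mono) auto
  also have "\<dots> = 192 * (1025 * q * (q + 1) + 24) * real v * l^3"
    by (simp add: power2_eq_square power3_eq_cube)
  also have "\<dots> \<le> 192 * (1025 * q * (q + 1) + 24) * real v * l^4"
    using ll Q0 by (intro mult_left_mono) auto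
  also have "\<dots> \<le> real m" using m by (simp add: l_def)
  finally show ?thesis using G t K(1) by blast
qed

text \<open>The constant has to precede \<open>v\<close>, \<open>J\<close>, \<open>m\<close>, the
  points and \<open>f\<close>, hence the explicit quantifiers. The two levels are tuned so that the
  truncation error and the l1 remainder divided by sqrt v have the same order.\<close>

lemma WA_least_squares_rate:
  fixes a b :: real
  assumes a: "0 < a"
  defines "D \<equiv> real CARD('d) - 1"
  shows "\<exists>C>0. \<forall>v\<ge>2. \<forall>J::nat. \<forall>m>0. \<forall>\<xi>::nat \<Rightarrow> real^'d. \<forall>f\<in>(WA a b :: (real^'d \<Rightarrow> complex) set).
      real v powr (1 + 1 / (2 * a)) \<le> 2^J \<longrightarrow> ln (real v) \<le> real (Suc J) \<longrightarrow>
      real (Suc J) \<le> (4 + 2 * (1 + 1 / (2 * a))) * ln (real v) \<longrightarrow>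
      (\<forall>j. \<xi> j \<in> Td) \<longrightarrow>
      (\<forall>S c. S \<subseteq> (\<Union>j<Suc J. hblock j) \<and> card S \<le> v \<longrightarrow>
        (\<Sum>j<m. (cmod (\<Sum>k\<in>S. c k * cexpk k (\<xi> j)))^2) / real m \<le> 33 * (\<Sum>k\<in>S. (cmod (c k))^2) \<and>
        (\<Sum>k\<in>S. (cmod (c k))^2) \<le> 64 * ((\<Sum>j<m. (cmod (\<Sum>k\<in>S. c k * cexpk k (\<xi> j)))^2) / real m)) \<longrightarrow>
      (\<exists>L\<in>Xv v (Phi (\<Union>j<Suc J. hblock j)). \<forall>u\<in>LSset m \<xi> L f.
        L2norm (\<lambda>x. f x - u x) \<le> C * (real v powr (- a - 1/2) * ln (real v) powr (D * (a + b))))"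
proof -
  define \<kappa> where "\<kappa> = 1 + 1 / (2 * a)"
  define D' where "D' = CARD('d) - 1"
  have D: "D = real D'" "0 \<le> D" unfolding D_def D'_def by (simp_all add: of_nat_diff Suc_leI)
  define \<tau> where "\<tau> = decay a (D * b)"
  obtain Ct where Ct: "0 < Ct" "\<And>n. summable (\<lambda>i. \<tau> (i + n))" "\<And>n. (\<Sum>i. \<tau> (i + n)) \<le> Ct * \<tau> n"
    using decay_tail[OF a, of "D * b"] unfolding \<tau>_def by blast
  define C1 where "C1 = Ct * ((4 + 2 * \<kappa>) powr \<bar>D * b\<bar> * 2 powr (D * a))"
  define C2 where "C2 = Ct * ((4 * 3^D') powr a * (3 * (D + 1)) powr \<bar>D * (a + b)\<bar>)"
  define C where "C = sqrt (500000 * (C1^2 + C2^2)) + 1"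
  have C0: "0 < C" unfolding C_def by (intro add_nonneg_pos) auto
  have main: "\<exists>L\<in>Xv v (Phi (\<Union>j<Suc J. hblock j)). \<forall>u\<in>LSset m \<xi> L f.
        L2norm (\<lambda>x. f x - u x) \<le> C * (real v powr (- a - 1/2) * ln (real v) powr (D * (a + b)))"
    if v: "2 \<le> v" and m: "0 < m" and fW: "f \<in> (WA a b :: (real^'d \<Rightarrow> complex) set)"
      and J: "real v powr \<kappa> \<le> 2^J" "ln (real v) \<le> real (Suc J)" "real (Suc J) \<le> (4 + 2 * \<kappa>) * ln (real v)"
      and \<xi>: "\<forall>j. \<xi> j \<in> Td"
      and samp: "\<forall>S c. S \<subseteq> (\<Union>j<Suc J. hblock j) \<and> card S \<le> v \<longrightarrow>
        (\<Sum>j<m. (cmod (\<Sum>k\<in>S. c k * cexpk k (\<xi> j)))^2) / real m \<le> 33 * (\<Sum>k\<in>S. (cmod (c k))^2) \<and>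
        (\<Sum>k\<in>S. (cmod (c k))^2) \<le> 64 * ((\<Sum>j<m. (cmod (\<Sum>k\<in>S. c k * cexpk k (\<xi> j)))^2) / real m)"
    for v J m :: nat and \<xi> :: "nat \<Rightarrow> real^'d" and f
  proof -
    let ?\<Lambda> = "\<Union>j<Suc J. hblock j :: (int^'d) set"
    define R where "R = ln (real v) powr (D * (a + b))"
    have f: "continuous_on UNIV f" and dec: "\<And>j. blockA f j \<le> \<tau> j"
      using fW by (auto simp: WA_def \<tau>_def decay_def D_def mult.commute)
    obtain n where n: "2 * (2^n * (n + 1)^D') \<le> v" "v < 2 * (2^(n + 1) * (n + 2)^D')"
      using low_frequency_level_exists[OF v] by blast
    \<comment> \<open>The intersection gives the required inclusion in the dictionary without
      comparing \<open>n\<close> with \<open>J\<close>.\<close>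
    let ?P = "?\<Lambda> \<inter> (\<Union>j<n. hblock j)"
    have cardP: "2 * card ?P \<le> v"
    proof -
      have "card ?P \<le> card (\<Union>j<n. hblock j :: (int^'d) set)" by (intro card_mono) (auto simp: finite_hblock)
      also have "\<dots> \<le> 2^n * (n + 1)^D'" unfolding D'_def by (rule card_hblocks_below)
      finally show ?thesis using n(1) by linarith
    qed
    have card\<Lambda>: "v \<le> card ?\<Lambda>"
    proof (rule card_hblocks_lower)
      have "real v powr 1 \<le> real v powr \<kappa>" using a v by (intro powr_mono) (auto simp: \<kappa>_def)
      then have "real v \<le> real v powr \<kappa>" using v by simp
      then have "real v \<le> 2^J" using J(1) by linarith
      then show "v \<le> 2^J" by (metis of_nat_le_iff of_nat_numeral of_nat_power)
    qed
    have T: "cmod (f x - (\<Sum>k\<in>?\<Lambda>. fourier f k * cexpk k x)) \<le> C1 * (real v powr (- a - 1/2) * R)" if x: "x \<in> Td" for x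
    proof -
      have "cmod (f x - (\<Sum>k\<in>?\<Lambda>. fourier f k * cexpk k x)) \<le> Ct * \<tau> (Suc J)"
        using hblock_truncation_error[OF f dec Ct(2) x, of "Suc J"] Ct(3)[of "Suc J"] by linarith
      also have "\<dots> \<le> Ct * ((4 + 2 * \<kappa>) powr \<bar>D * b\<bar> * 2 powr (D * a) * (real v powr (- a - 1/2) * R))"
        unfolding \<tau>_def R_def using Ct(1) J
        by (intro mult_left_mono decay_at_truncation_level[OF a v D(2) \<kappa>_def]) auto
      finally show ?thesis by (simp add: C1_def mult_ac)
    qed
    have A: "(\<Sum>k\<in>?\<Lambda> - ?P. cmod (fourier f k)) \<le> C2 * (real v powr (- a) * R)"
    proof -
      have "?\<Lambda> - ?P = ?\<Lambda> - (\<Union>j<n. hblock j)" by blast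
      then have "(\<Sum>k\<in>?\<Lambda> - ?P. cmod (fourier f k)) \<le> Ct * \<tau> n"
        using high_frequency_l1[OF dec Ct(2), of "Suc J" n] Ct(3)[of n] by simp
      also have "\<dots> \<le> Ct * ((4 * 3^D') powr a * (3 * (D + 1)) powr \<bar>D * (a + b)\<bar> * (real v powr (- a) * R))"
        unfolding \<tau>_def R_def D(1) using Ct(1) by (intro mult_left_mono decay_at_low_level[OF a v n]) auto
      finally show ?thesis by (simp add: C2_def mult_ac)
    qed
    have "\<exists>L\<in>Xv v (Phi ?\<Lambda>). \<forall>u\<in>LSset m \<xi> L f. (L2norm (\<lambda>x. f x - u x))^2
       \<le> 500000 * ((C1 * (real v powr (- a - 1/2) * R))^2 + (C2 * (real v powr (- a) * R))^2 / real v)"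
    proof (rule least_squares_error[OF f _ card\<Lambda> _ m T _ cardP A])
      show "finite ?\<Lambda>" by (simp add: finite_hblock)
    qed (use v \<xi> samp in auto)
    then obtain L where L: "L \<in> Xv v (Phi ?\<Lambda>)" "\<And>u. u \<in> LSset m \<xi> L f \<Longrightarrow> (L2norm (\<lambda>x. f x - u x))^2
       \<le> 500000 * ((C1 * (real v powr (- a - 1/2) * R))^2 + (C2 * (real v powr (- a) * R))^2 / real v)"
      by blast
    have "L2norm (\<lambda>x. f x - u x) \<le> C * (real v powr (- a - 1/2) * R)" if u: "u \<in> LSset m \<xi> L f" for u
    proof -
      have sq: "(real v powr (- a))^2 / real v = (real v powr (- a - 1/2))^2"
      proof -
        have "(real v powr (- a))^2 = real v powr (- 2 * a)" "(real v powr (- a - 1/2))^2 = real v powr (- 2 * a - 1)"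
          using v by (simp_all add: powr_power algebra_simps)
        then show ?thesis using v by (simp add: powr_diff)
      qed
      have "(L2norm (\<lambda>x. f x - u x))^2 \<le> 500000 * (C1^2 + C2^2) * (real v powr (- a - 1/2) * R)^2"
      proof -
        have "(C2 * (real v powr (- a) * R))^2 / real v = C2^2 * R^2 * ((real v powr (- a))^2 / real v)"
          by (simp add: power_mult_distrib)
        then show ?thesis using L(2)[OF u] unfolding sq by (simp add: power_mult_distrib algebra_simps)
      qed
      then have "L2norm (\<lambda>x. f x - u x) \<le> sqrt (500000 * (C1^2 + C2^2) * (real v powr (- a - 1/2) * R)^2)"
        by (rule real_le_rsqrt)
      also have "\<dots> = sqrt (500000 * (C1^2 + C2^2)) * (real v powr (- a - 1/2) * R)"
        by (simp add: real_sqrt_mult R_def)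
      also have "\<dots> \<le> C * (real v powr (- a - 1/2) * R)"
        unfolding C_def by (intro mult_right_mono) (auto simp: R_def)
      finally show ?thesis .
    qed
    then show ?thesis using L(1) unfolding R_def by blast
  qed
  show ?thesis
    by (intro exI[of _ C] conjI allI ballI impI C0) (rule main[unfolded \<kappa>_def]; assumption)
qed

section \<open>Choice of the dictionary and conclusion\<close>

lemma Xv_mono: "P \<subseteq> Q \<Longrightarrow> Xv v P \<subseteq> Xv v Q"
  unfolding Xv_def by blast

theorem theorem5p4:
  fixes a :: real
  assumes "a > 0"
  shows "\<exists>c c'::real. \<forall>b::real. \<exists>C'::real. \<forall>v::nat. v \<ge> 2 \<longrightarrow>
     (\<exists>M::real. real (card (Gamma_hc M :: (int^'d) set)) \<le> real v powr c \<and>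
        (\<forall>m::nat. real m \<ge> c' * real v * (ln (2 * real v)) ^ 4 \<longrightarrow>
           rho_ls m v (WA a b :: (real^'d \<Rightarrow> complex) set) (Phi (Gamma_hc M :: (int^'d) set))
             \<le> ereal (C' * real v powr (- a - 1/2) *
                       (ln (real v)) powr ((real CARD('d) - 1) * (a + b)))))"
proof -
  define \<kappa> where "\<kappa> = 1 + 1 / (2 * a)"
  \<comment> \<open>Neither \<open>q\<close> nor \<open>c'\<close> involves \<open>b\<close>, which
    enters only through the constant of \<open>WA_least_squares_rate\<close>; the exponent
    \<open>c\<close> is \<open>q - 1\<close>.\<close>
  define q where "q = 1 + real CARD('d) * (\<kappa> + 4)"
  define c' where "c' = 192 * (1025 * q * (q + 1) + 24)"
  have \<kappa>: "1 \<le> \<kappa>" using assms by (simp add: \<kappa>_def)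
  then have q: "1 \<le> q" by (simp add: q_def)
  have c': "0 < c'" using q by (simp add: c'_def add_nonneg_pos)
  have "\<exists>C'::real. \<forall>v::nat. v \<ge> 2 \<longrightarrow>
     (\<exists>M::real. real (card (Gamma_hc M :: (int^'d) set)) \<le> real v powr (q - 1) \<and>
        (\<forall>m::nat. real m \<ge> c' * real v * (ln (2 * real v)) ^ 4 \<longrightarrow>
           rho_ls m v (WA a b :: (real^'d \<Rightarrow> complex) set) (Phi (Gamma_hc M :: (int^'d) set))
             \<le> ereal (C' * real v powr (- a - 1/2) *
                       (ln (real v)) powr ((real CARD('d) - 1) * (a + b)))))" for b
  proof -
    obtain C where C: "\<forall>v\<ge>2. \<forall>J::nat. \<forall>m>0. \<forall>\<xi>::nat \<Rightarrow> real^'d. \<forall>f\<in>(WA a b :: (real^'d \<Rightarrow> complex) set).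
      real v powr \<kappa> \<le> 2^J \<longrightarrow> ln (real v) \<le> real (Suc J) \<longrightarrow>
      real (Suc J) \<le> (4 + 2 * \<kappa>) * ln (real v) \<longrightarrow>
      (\<forall>j. \<xi> j \<in> Td) \<longrightarrow>
      (\<forall>S c. S \<subseteq> (\<Union>j<Suc J. hblock j) \<and> card S \<le> v \<longrightarrow>
        (\<Sum>j<m. (cmod (\<Sum>k\<in>S. c k * cexpk k (\<xi> j)))^2) / real m \<le> 33 * (\<Sum>k\<in>S. (cmod (c k))^2) \<and>
        (\<Sum>k\<in>S. (cmod (c k))^2) \<le> 64 * ((\<Sum>j<m. (cmod (\<Sum>k\<in>S. c k * cexpk k (\<xi> j)))^2) / real m)) \<longrightarrow>
      (\<exists>L\<in>Xv v (Phi (\<Union>j<Suc J. hblock j)). \<forall>u\<in>LSset m \<xi> L f.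
        L2norm (\<lambda>x. f x - u x) \<le> C * (real v powr (- a - 1/2) * ln (real v) powr ((real CARD('d) - 1) * (a + b))))"
      using WA_least_squares_rate[OF assms, of b, where 'd = 'd] unfolding \<kappa>_def by blast
    show ?thesis
    proof (rule exI[of _ C], intro allI impI)
      fix v :: nat assume v: "2 \<le> v"
      obtain J where J: "real v powr \<kappa> \<le> 2^J" "2^J \<le> 2 * real v powr \<kappa>"
        "ln (real v) \<le> real (Suc J)" "real (Suc J) \<le> (4 + 2 * \<kappa>) * ln (real v)"
        using truncation_level_exists[OF v \<kappa>] by blast
      have J': "2^Suc J \<le> 4 * real v powr \<kappa>" using J(2) by simp
      \<comment> \<open>Sampling and subspace selection use the blocks only. Passing to the larger
        cross enlarges the family of subspaces and so can only lower the infimum.\<close>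
      let ?\<Lambda> = "\<Union>j<Suc J. hblock j :: (int^'d) set" and ?\<Gamma> = "Gamma_hc (2^Suc J) :: (int^'d) set"
      have sub: "?\<Lambda> \<subseteq> ?\<Gamma>" by (intro UN_least hblock_subset_Gamma) simp
      have cG: "real (card B) \<le> (2 * 2^Suc J + 1)^CARD('d)" if "B \<subseteq> ?\<Gamma>" for B
      proof -
        have "card B \<le> (2 * 2^Suc J + 1)^CARD('d)"
          using card_mono[OF finite_Gamma that] card_Gamma[of "Suc J", where 'd = 'd] by linarith
        then have "real (card B) \<le> real ((2 * 2^Suc J + 1)^CARD('d))" by (simp only: of_nat_le_iff)
        then show ?thesis by (simp add: add.commute)
      qed
      have \<Lambda>pos: "0 < card ?\<Lambda>"
      proof -
        have "1 \<le> card ?\<Lambda>" by (rule card_hblocks_lower) simp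
        then show ?thesis by simp
      qed
      have size: "(2 * 2^Suc J + 1)^CARD('d) \<le> real v powr (q - 1) \<and> (\<exists>t K::nat. 8 * real v \<le> 2^t \<and>
         1024 * ln (4 * (2 * 2^Suc J + 1)^CARD('d)) \<le> real K \<and>
         32 * real v * real (t + 1) * (real K * ln (5 * real (card ?\<Lambda>)) + ln (4 * real (t + 1))) \<le> real m)"
        if "c' * real v * (ln (2 * real v))^4 \<le> real m" for m
        unfolding q_def
        by (rule sample_size_sufficient[OF v \<kappa> J' \<Lambda>pos cG[OF sub]]) (use that in \<open>simp add: c'_def q_def\<close>)
      show "\<exists>M::real. real (card (Gamma_hc M :: (int^'d) set)) \<le> real v powr (q - 1) \<and>
        (\<forall>m::nat. real m \<ge> c' * real v * (ln (2 * real v)) ^ 4 \<longrightarrow>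
           rho_ls m v (WA a b :: (real^'d \<Rightarrow> complex) set) (Phi (Gamma_hc M :: (int^'d) set))
             \<le> ereal (C * real v powr (- a - 1/2) *
                       (ln (real v)) powr ((real CARD('d) - 1) * (a + b))))"
      proof (intro exI[of _ "2^Suc J"] conjI allI impI)
        \<comment> \<open>The cardinality bound is free of \<open>m\<close> but is read off from
          \<open>size\<close>, which speaks of admissible sample sizes; any large one
          serves.\<close>
        obtain m0 :: nat where "c' * real v * (ln (2 * real v))^4 \<le> real m0" using real_arch_simple by blast
        then show "real (card ?\<Gamma>) \<le> real v powr (q - 1)" using size cG[OF order_refl] by force
      next
        fix m :: nat assume m: "c' * real v * (ln (2 * real v))^4 \<le> real m"
        have "0 < ln (2 * real v)" using v by simp
        then have "0 < c' * real v * (ln (2 * real v))^4" using c' v by (intro mult_pos_pos zero_less_power) auto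
        then have m0: "0 < m" using m by linarith
        obtain t K :: nat where tK: "8 * real v \<le> 2^t"
          "1024 * ln (4 * (2 * 2^Suc J + 1)^CARD('d)) \<le> real K"
          "32 * real v * real (t + 1) * (real K * ln (5 * real (card ?\<Lambda>)) + ln (4 * real (t + 1))) \<le> real m"
          using size[OF m] by blast
        have "\<exists>\<xi>::nat \<Rightarrow> real^'d. (\<forall>j. \<xi> j \<in> Td) \<and> (\<forall>S c. S \<subseteq> ?\<Lambda> \<and> card S \<le> v \<longrightarrow>
          (\<Sum>j<m. (cmod (\<Sum>k\<in>S. c k * cexpk k (\<xi> j)))^2) / real m \<le> 33 * (\<Sum>k\<in>S. (cmod (c k))^2) \<and>
          (\<Sum>k\<in>S. (cmod (c k))^2) \<le> 64 * ((\<Sum>j<m. (cmod (\<Sum>k\<in>S. c k * cexpk k (\<xi> j)))^2) / real m))"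
        proof (rule fourier_sampling[where R = "2^Suc J" and t = t and K = K])
          show "\<bar>k$i\<bar> \<le> int (2^Suc J)" if "k \<in> ?\<Lambda>" for k i
            using Gamma_coord_le[of k "Suc J" i] sub that by auto
          show "?\<Lambda> \<noteq> {}" using \<Lambda>pos by force
        qed (use v m0 tK in \<open>auto simp: finite_hblock simp del: power_Suc\<close>)
        then obtain \<xi> :: "nat \<Rightarrow> real^'d" where \<xi>: "\<forall>j. \<xi> j \<in> Td" and samp: "\<forall>S c. S \<subseteq> ?\<Lambda> \<and> card S \<le> v \<longrightarrow>
          (\<Sum>j<m. (cmod (\<Sum>k\<in>S. c k * cexpk k (\<xi> j)))^2) / real m \<le> 33 * (\<Sum>k\<in>S. (cmod (c k))^2) \<and>
          (\<Sum>k\<in>S. (cmod (c k))^2) \<le> 64 * ((\<Sum>j<m. (cmod (\<Sum>k\<in>S. c k * cexpk k (\<xi> j)))^2) / real m)"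
          by blast
        have X: "Xv v (Phi ?\<Lambda>) \<subseteq> Xv v (Phi ?\<Gamma>)" using sub by (intro Xv_mono) (auto simp: Phi_def)
        show "rho_ls m v (WA a b :: (real^'d \<Rightarrow> complex) set) (Phi ?\<Gamma>)
            \<le> ereal (C * real v powr (- a - 1/2) * (ln (real v)) powr ((real CARD('d) - 1) * (a + b)))"
          unfolding rho_ls_def
        proof (rule INF_lower2[of \<xi>], use \<xi> in simp, rule SUP_least)
          fix f assume fW: "f \<in> (WA a b :: (real^'d \<Rightarrow> complex) set)"
          have "\<exists>L\<in>Xv v (Phi ?\<Lambda>). \<forall>u\<in>LSset m \<xi> L f.
            L2norm (\<lambda>x. f x - u x) \<le> C * (real v powr (- a - 1/2) * ln (real v) powr ((real CARD('d) - 1) * (a + b)))"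
            by (rule C[rule_format, OF v m0 fW J(1,3,4)]) (use \<xi> samp in auto)
          then obtain L where L: "L \<in> Xv v (Phi ?\<Lambda>)" "\<And>u. u \<in> LSset m \<xi> L f \<Longrightarrow>
            L2norm (\<lambda>x. f x - u x) \<le> C * (real v powr (- a - 1/2) * ln (real v) powr ((real CARD('d) - 1) * (a + b)))"
            by blast
          show "(INF L \<in> Xv v (Phi ?\<Gamma>). SUP u \<in> LSset m \<xi> L f. ereal (L2norm (\<lambda>x. f x - u x)))
            \<le> ereal (C * real v powr (- a - 1/2) * (ln (real v)) powr ((real CARD('d) - 1) * (a + b)))"
          proof (rule INF_lower2[of L], use L X in blast, rule SUP_least)
            fix u assume "u \<in> LSset m \<xi> L f"
            then show "ereal (L2norm (\<lambda>x. f x - u x))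
              \<le> ereal (C * real v powr (- a - 1/2) * (ln (real v)) powr ((real CARD('d) - 1) * (a + b)))"
              using L(2) by (simp add: mult.assoc)
          qed
        qed
      qed
    qed
  qed
  then show ?thesis by blast
qed

end
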